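(* Let $n_0\ge 1$, $k\in\mathbb{N}$, let $f\in\operatorname{ReLU}^{\mathbb{Z}}_{\mathbf{0}}(n_0,k)$, and let $$f_\theta:\mathbb{R}^{n_0}\xrightarrow{\varsigma\circ L_1}\mathbb{R}^{n_1}\xrightarrow{\varsigma\circ L_2}\cdots\xrightarrow{\varsigma\circ L_k}\mathbb{R}^{n_k}\xrightarrow{L_{k+1}}\mathbb{R}$$ be an unbiased ReLU neural network with rational weights realizing $f$, whose ReLU fan $\Sigma_{f_\theta}$ is a fan. Let $D=D_f$ be the ReLU Cartier divisor of $f$ on the toric variety $X_{\Sigma_{f_\theta}}$. If $f$ is a tropical polynomial, or a convex function, then $$P_{-D}=-\operatorname{Newt}(f),$$ and furthermore $$\operatorname{Vol}(\operatorname{Newt}(f))=\operatorname{Vol}\bigl(\mathcal{O}_{X_{\Sigma_{f_\theta}}}(-D)\bigr).$$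
   Context: Networks. $\varsigma$ applies $x\mapsto\max\{0,x\}$ to each coordinate. An unbiased ReLU neural network with $k$ hidden layers is a composition $L_{k+1}\circ(\varsigma\circ L_k)\circ\cdots\circ(\varsigma\circ L_1)$ with $L_i:\mathbb{R}^{n_{i-1}}\to\mathbb{R}^{n_i}$ linear maps (matrices) and $n_{k+1}=1$. $\operatorname{ReLU}^{\mathbb{Z}}_{\mathbf{0}}(n_0,k)$ is the set of functions $\mathbb{R}^{n_0}\to\mathbb{R}$ equal to such a composition, with some widths $n_1,\dots,n_k$ and all matrix entries integers. "Convex" means $f(\lambda x+(1-\lambda)y)\le\lambda f(x)+(1-\lambda)f(y)$ for all $x,y\in\mathbb{R}^{n_0}$ and $\lambda\in[0,1]$. ReLU fan. Write $F_i=\varsigma\circ L_i$ for $1\le i\le k$. Each nonzero row $\ell$ of $L_i$ defines a hyperplane $\{x\in\mathbb{R}^{n_{i-1}}:\ell\cdot x=0\}$; let $R^{(i)}$ be the polyhedral complex in $\mathbb{R}^{n_{i-1}}$ induced by this hyperplane arrangement (all faces of all closed chambers). Set $\mathcal{C}(F_1)=R^{(1)}$ and, for $i\ge 2$, $$\mathcal{C}(F_i\circ\cdots\circ F_1)=\{S\cap(F_{i-1}\circ\cdots\circ F_1)^{-1}(Y): S\in\mathcal{C}(F_{i-1}\circ\cdots\circ F_1),\ Y\in R^{(i)}\}.$$ The ReLU fan is $\Sigma_{f_\theta}=\mathcal{C}(F_k\circ\cdots\circ F_1)$, a finite collection of rational polyhedral cones covering $\mathbb{R}^{n_0}$. Standing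 assumption: $\Sigma_{f_\theta}$ is a fan, i.e. all its cones are strongly convex. Here $N=\mathbb{Z}^{n_0}$, $N_{\mathbb{R}}=\mathbb{R}^{n_0}$, $M=\mathbb{Z}^{n_0}$ is the dual lattice, and $\langle\cdot,\cdot\rangle$ is the dot product. $X_{\Sigma_{f_\theta}}$ is the complex toric variety of this (complete) fan. ReLU Cartier divisor. $f$ is linear on each cone of $\Sigma_{f_\theta}$, with linear part $m_\sigma$ on each maximal cone $\sigma$ (so $f(u)=\langle m_\sigma,u\rangle$ for $u\in\sigma$). For a ray $\rho\in\Sigma_{f_\theta}(1)$ let $u_\rho\in N$ be its minimal lattice generator and $D_\rho$ the corresponding torus-invariant prime divisor. The sign convention is that the support function $\varphi_D$ of $D=\sum_\rho a_\rho D_\rho$ satisfies $\varphi_D(u_\rho)=-a_\rho$. The ReLU Cartier divisor $D_f$ is the torus-invariant divisor with support function $f$, i.e. $D_f=-\sum_\rho f(u_\rho)D_\rho$. Polytopes and volumes. For $E=\sum_\rho a_\rho D_\rho$, $P_E=\{m\in M_{\mathbb{R}}=\mathbb{R}^{n_0}:\langle m,u_\rho\rangle\ge -a_\rho\text{ for all rays }\rho\}$. A tropical polynomial is a function of the form $f(x)=\max_{1\le i\le r}\{c_i+\langle u_i,x\rangle\}$ with $c_i\in\mathbb{R}$ and $u_i\in\mathbb{Z}^{n_0}$, and its Newton polytope is $\operatorname{Newt}(f)=\operatorname{Conv}(u_1,\dots,u_r)\subseteq\mathbb{R}^{n_0}$; for a convex $f$, $\operatorname{Newt}(f)$ is formed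 from an expression of $f$ as a tropical polynomial. For a lattice polytope $P\subseteq\mathbb{R}^{n_0}$, $\operatorname{Vol}(P)$ is $n_0!$ times the $n_0$-dimensional Euclidean volume of $P$ (called the "mixed volume" of $P$). For a torus-invariant Cartier divisor $E$ on $X=X_{\Sigma_{f_\theta}}$, $$\operatorname{Vol}(\mathcal{O}_X(E))=\limsup_{m\to\infty}\frac{h^0(X,\mathcal{O}_X(mE))}{m^{n_0}/n_0!},\qquad h^0=\dim_{\mathbb{C}}\Gamma.$$ *)

theory Defs
  imports
    "HOL-Analysis.Analysis"
    "HOL-Library.Poly_Mapping"
    "HOL-Computational_Algebra.Fraction_Field"
    "HOL-Algebra.Ideal"
    "Jordan_Normal_Form.Matrix"
begin

no_notation vec_index (infixl "$" 100)
no_notation scalar_prod (infix "\<bullet>" 70)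

text \<open>
  The input space of dimension \<open>n\<^sub>0\<close> is \<^typ>\<open>real ^ 'n\<close> with \<open>n\<^sub>0 = CARD('n)\<close>. The hidden layers have
  arbitrary widths, so their vectors and all weight matrices are the dimension-carrying
  \<^typ>\<open>real Matrix.vec\<close> and \<^typ>\<open>real mat\<close>. The linear order on \<^typ>\<open>'n\<close> fixes the numbering of
  the input coordinates.
\<close>

section \<open>Unbiased ReLU networks\<close>

definition coords :: "real ^ 'n::{finite,linorder} \<Rightarrow> real Matrix.vec" where
  "coords x = Matrix.vec CARD('n) (\<lambda>i. x $ (sorted_list_of_set UNIV ! i))"

definition relu_layer :: "real mat \<Rightarrow> real Matrix.vec \<Rightarrow> real Matrix.vec" where
  "relu_layer L v = map_vec (max 0) (L *\<^sub>v v)"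

definition unbiased_network :: "nat \<Rightarrow> nat \<Rightarrow> real mat list \<Rightarrow> bool" where
  "unbiased_network n0 k Ls \<longleftrightarrow>
     length Ls = Suc k \<and> dim_col (Ls ! 0) = n0 \<and>
     (\<forall>i<k. dim_col (Ls ! Suc i) = dim_row (Ls ! i)) \<and> dim_row (Ls ! k) = 1"

definition hidden :: "real mat list \<Rightarrow> nat \<Rightarrow> real ^ 'n::{finite,linorder} \<Rightarrow> real Matrix.vec" where
  "hidden Ls i x = fold relu_layer (take i Ls) (coords x)"

definition network_fun :: "nat \<Rightarrow> real mat list \<Rightarrow> real ^ 'n::{finite,linorder} \<Rightarrow> real" where
  "network_fun k Ls x = vec_index (Ls ! k *\<^sub>v hidden Ls k x) 0"

definition ReLU_Z :: "nat \<Rightarrow> (real ^ 'n::{finite,linorder} \<Rightarrow> real) set" where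
  "ReLU_Z k = {network_fun k Ls | Ls.
     unbiased_network CARD('n) k Ls \<and> (\<forall>L\<in>set Ls. elements_mat L \<subseteq> \<int>)}"

section \<open>The ReLU fan\<close>

text \<open>
  The sign function \<open>s\<close> selects a side of the hyperplane of every nonzero row; the cell is a chamber
  if it contains a point off all hyperplanes.
\<close>
definition closed_chambers :: "real mat \<Rightarrow> real Matrix.vec set set" where
  "closed_chambers L =
     {{x \<in> carrier_vec (dim_col L). \<forall>i<dim_row L. 0 \<le> s i * scalar_prod (row L i) x} | s.
        (\<forall>i. s i \<in> {1, -1}) \<and>
        (\<exists>x \<in> carrier_vec (dim_col L). \<forall>i<dim_row L.
           row L i \<noteq> 0\<^sub>v (dim_col L) \<longrightarrow> 0 < s i * scalar_prod (row L i) x)}"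

definition cone_faces :: "nat \<Rightarrow> real Matrix.vec set \<Rightarrow> real Matrix.vec set set" where
  "cone_faces n Q =
     {{x \<in> Q. scalar_prod c x = 0} | c. c \<in> carrier_vec n \<and> (\<forall>x\<in>Q. 0 \<le> scalar_prod c x)}"

definition arrangement_complex :: "real mat \<Rightarrow> real Matrix.vec set set" where
  "arrangement_complex L = (\<Union>Q \<in> closed_chambers L. cone_faces (dim_col L) Q)"

text \<open>
  Starting from the trivial complex, the first step yields the arrangement complex of the first
  layer. For \<open>k = 0\<close> the only cone is the whole space, which is not strongly convex.
\<close>
fun relu_fan :: "nat \<Rightarrow> real mat list \<Rightarrow> (real ^ 'n::{finite,linorder}) set set" where
  "relu_fan 0 Ls = {UNIV}"
| "relu_fan (Suc i) Ls =
     {S \<inter> {x. hidden Ls i x \<in> Y} | S Y. S \<in> relu_fan i Ls \<and> Y \<in> arrangement_complex (Ls ! i)}"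

definition strongly_convex_cone :: "(real ^ 'n) set \<Rightarrow> bool" where
  "strongly_convex_cone \<sigma> \<longleftrightarrow> \<sigma> \<inter> uminus ` \<sigma> = {0}"

section \<open>Rays and torus-invariant divisors\<close>

definition lattice :: "(real ^ 'n) set" where
  "lattice = {u. \<forall>i. u $ i \<in> \<int>}"

definition rays :: "(real ^ 'n) set set \<Rightarrow> (real ^ 'n) set set" where
  "rays \<Sigma> = {\<rho> \<in> \<Sigma>. dim \<rho> = 1}"

definition ray_gen :: "(real ^ 'n) set \<Rightarrow> real ^ 'n" where
  "ray_gen \<rho> = (THE u. \<rho> \<inter> lattice = range (\<lambda>j::nat. real j *\<^sub>R u))"

text \<open>
  Torus-invariant divisors form the free abelian group on the rays; \<^term>\<open>frag_of \<rho>\<close> stands for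
  the prime divisor \<open>D\<^sub>\<rho>\<close>, whose generic point is \<open>prime_divisor \<rho>\<close> below.
\<close>
type_synonym 'n divisor = "(real ^ 'n) set \<Rightarrow>\<^sub>0 int"

text \<open>
  The floor only converts to \<^typ>\<open>int\<close>: functions in \<^const>\<open>ReLU_Z\<close> are integer-valued on the
  lattice, see \<open>ReLU_Z_lattice\<close>.
\<close>
definition relu_divisor :: "(real ^ 'n) set set \<Rightarrow> (real ^ 'n \<Rightarrow> real) \<Rightarrow> 'n divisor" where
  "relu_divisor \<Sigma> f = - (\<Sum>\<rho>\<in>rays \<Sigma>. frag_cmul \<lfloor>f (ray_gen \<rho>)\<rfloor> (frag_of \<rho>))"

definition divisor_polytope :: "(real ^ 'n) set set \<Rightarrow> 'n divisor \<Rightarrow> (real ^ 'n) set" where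
  "divisor_polytope \<Sigma> E =
     {m. \<forall>\<rho>\<in>rays \<Sigma>. m \<bullet> ray_gen \<rho> \<ge> - real_of_int (Poly_Mapping.lookup E \<rho>)}"

section \<open>The toric variety and its line bundles\<close>

text \<open>
  The character lattice is \<^typ>\<open>'n \<Rightarrow>\<^sub>0 int\<close>, its group algebra is the ring of Laurent
  polynomials, and the field of fractions of the latter is the function field of the toric variety.
\<close>
type_synonym 'n laurent = "('n \<Rightarrow>\<^sub>0 int) \<Rightarrow>\<^sub>0 complex"
type_synonym 'n ratfun = "'n laurent fract"

definition char_vec :: "('n::finite \<Rightarrow>\<^sub>0 int) \<Rightarrow> real ^ 'n" where
  "char_vec m = (\<chi> i. real_of_int (Poly_Mapping.lookup m i))"

definition cone_algebra :: "(real ^ 'n::{finite,linorder}) set \<Rightarrow> 'n laurent set" where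
  "cone_algebra \<sigma> = {a. \<forall>m\<in>Poly_Mapping.keys a. \<forall>u\<in>\<sigma>. 0 \<le> char_vec m \<bullet> u}"

definition cone_ring :: "(real ^ 'n::{finite,linorder}) set \<Rightarrow> 'n laurent ring" where
  "cone_ring \<sigma> =
     \<lparr>carrier = cone_algebra \<sigma>, mult = (*), one = 1, zero = 0, add = (+)\<rparr>"

definition local_ring ::
  "(real ^ 'n::{finite,linorder}) set \<Rightarrow> 'n laurent set \<Rightarrow> 'n ratfun set" where
  "local_ring \<sigma> P = {Fract a b | a b. a \<in> cone_algebra \<sigma> \<and> b \<in> cone_algebra \<sigma> \<and> b \<notin> P}"

text \<open>
  The toric variety is an integral separated scheme, glued from the spectra of the rings
  \<^term>\<open>cone_ring \<sigma>\<close>. A point of such a scheme is determined by its local ring, seen inside the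
  function field, so a point is represented by its local ring. Two prime ideals in different
  charts are glued exactly if their local rings agree.
\<close>
definition chart :: "(real ^ 'n::{finite,linorder}) set \<Rightarrow> 'n ratfun set set" where
  "chart \<sigma> = {local_ring \<sigma> P | P. primeideal P (cone_ring \<sigma>)}"

definition toric_variety :: "(real ^ 'n::{finite,linorder}) set set \<Rightarrow> 'n ratfun set set" where
  "toric_variety \<Sigma> = (\<Union>\<sigma>\<in>\<Sigma>. chart \<sigma>)"

definition units_at :: "'a::field set \<Rightarrow> 'a set" where
  "units_at R = {t \<in> R. t \<noteq> 0 \<and> inverse t \<in> R}"

text \<open>Order of vanishing with respect to a discrete valuation ring \<open>R\<close>; \<open>\<pi>\<close> is a uniformizer.\<close>
definition vanishing_order :: "'a::field set \<Rightarrow> 'a \<Rightarrow> int" where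
  "vanishing_order R g =
     (THE j. \<exists>\<pi>. R - units_at R = (\<lambda>t. \<pi> * t) ` R \<and> g / \<pi> powi j \<in> units_at R)"

text \<open>
  The local ring at the generic point of \<open>D\<^sub>\<rho>\<close>, the closure of the orbit of \<open>\<rho>\<close>. In the chart of
  \<open>\<rho>\<close> the ideal of \<open>D\<^sub>\<rho>\<close> is spanned by the characters that are positive on \<open>\<rho>\<close>.
\<close>
definition prime_divisor :: "(real ^ 'n::{finite,linorder}) set \<Rightarrow> 'n ratfun set" where
  "prime_divisor \<rho> = local_ring \<rho>
     {a \<in> cone_algebra \<rho>. \<forall>m\<in>Poly_Mapping.keys a. 0 < char_vec m \<bullet> ray_gen \<rho>}"

text \<open>
  \<open>g\<close> is a local equation of \<open>E\<close> on the chart of \<open>\<sigma>\<close>: the divisor of \<open>g\<close> has no component meeting the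
  torus, which is the chart of the zero cone, and has the coefficients of \<open>E\<close> at the remaining prime
  divisors of the chart, which are the \<open>D\<^sub>\<rho>\<close> for the rays \<open>\<rho>\<close> of \<open>\<sigma>\<close>.
\<close>
definition local_equation ::
  "(real ^ 'n::{finite,linorder}) set set \<Rightarrow> 'n divisor \<Rightarrow>
   (real ^ 'n::{finite,linorder}) set \<Rightarrow> 'n ratfun \<Rightarrow> bool" where
  "local_equation \<Sigma> E \<sigma> g \<longleftrightarrow>
     (\<forall>x\<in>chart {0}. g \<in> units_at x) \<and>
     (\<forall>\<rho>\<in>rays \<Sigma>. \<rho> face_of \<sigma> \<longrightarrow>
        vanishing_order (prime_divisor \<rho>) g = Poly_Mapping.lookup E \<rho>)"

text \<open>
  The line bundle of a Cartier divisor is the subsheaf of the constant sheaf of rational functions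
  generated on every chart by the inverse of a local equation. A section over \<open>U\<close> is a rational
  function whose germ at every point of \<open>U\<close> lies in the stalk.
\<close>
definition line_bundle_sections ::
  "(real ^ 'n::{finite,linorder}) set set \<Rightarrow> 'n divisor \<Rightarrow> 'n ratfun set set \<Rightarrow> 'n ratfun set" where
  "line_bundle_sections \<Sigma> E U =
     {s. \<forall>\<sigma>\<in>\<Sigma>. \<exists>g. local_equation \<Sigma> E \<sigma> g \<and> (\<forall>x\<in>chart \<sigma> \<inter> U. g * s \<in> x)}"

definition cscale :: "complex \<Rightarrow> 'n::{finite,linorder} ratfun \<Rightarrow> 'n ratfun" where
  "cscale c s = Fract (Poly_Mapping.single 0 c) 1 * s"

definition h0 :: "(real ^ 'n::{finite,linorder}) set set \<Rightarrow> 'n divisor \<Rightarrow> nat" where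
  "h0 \<Sigma> E = vector_space.dim cscale (line_bundle_sections \<Sigma> E (toric_variety \<Sigma>))"

definition divisor_volume :: "(real ^ 'n::{finite,linorder}) set set \<Rightarrow> 'n divisor \<Rightarrow> ereal" where
  "divisor_volume \<Sigma> E = limsup (\<lambda>m::nat.
     ereal (real (h0 \<Sigma> (frag_cmul (int m) E)) / (real m ^ CARD('n) / fact CARD('n))))"

section \<open>Tropical polynomials and Newton polytopes\<close>

definition tropical_expression ::
  "(real ^ 'n \<Rightarrow> real) \<Rightarrow> nat \<Rightarrow> (nat \<Rightarrow> real) \<Rightarrow> (nat \<Rightarrow> real ^ 'n) \<Rightarrow> bool" where
  "tropical_expression f r c u \<longleftrightarrow>
     1 \<le> r \<and> (\<forall>i\<in>{1..r}. u i \<in> lattice) \<and>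
     (\<forall>x. f x = Max ((\<lambda>i. c i + u i \<bullet> x) ` {1..r}))"

definition tropical_polynomial :: "(real ^ 'n \<Rightarrow> real) \<Rightarrow> bool" where
  "tropical_polynomial f \<longleftrightarrow> (\<exists>r c u. tropical_expression f r c u)"

text \<open>All expressions of \<open>f\<close> as a tropical polynomial have the same convex hull of exponents.\<close>
definition newton_polytope :: "(real ^ 'n \<Rightarrow> real) \<Rightarrow> (real ^ 'n) set" where
  "newton_polytope f =
     (THE P. \<exists>r c u. tropical_expression f r c u \<and> P = convex hull (u ` {1..r}))"

definition lattice_volume :: "(real ^ 'n) set \<Rightarrow> real" where
  "lattice_volume P = fact CARD('n) * measure lebesgue P"

section \<open>Well-definedness\<close>

lemma vector_space_cscale: "vector_space (cscale :: complex \<Rightarrow> 'n::{finite,linorder} ratfun \<Rightarrow> _)"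
proof
  fix a b :: complex and x y :: "'n ratfun"
  show "cscale a (x + y) = cscale a x + cscale a y"
    by (simp add: cscale_def distrib_left)
  show "cscale (a + b) x = cscale a x + cscale b x"
    by (simp add: cscale_def single_add flip: distrib_right)
  show "cscale a (cscale b x) = cscale (a * b) x"
    by (simp add: cscale_def mult_single flip: mult.assoc)
  show "cscale 1 x = x"
    by (simp add: cscale_def flip: One_fract_def)
qed

lemma hidden_Suc: "i < length Ls \<Longrightarrow> hidden Ls (Suc i) x = relu_layer (Ls ! i) (hidden Ls i x)"
  by (simp add: hidden_def take_Suc_conv_app_nth)

lemma mult_mat_vec_Ints:
  assumes "elements_mat L \<subseteq> \<int>" "dim_vec v = dim_col L" "\<forall>j<dim_vec v. vec_index v j \<in> \<int>" "i < dim_row L"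
  shows "vec_index (L *\<^sub>v v) i \<in> (\<int> :: real set)"
proof -
  have "L $$ (i, j) \<in> \<int>" if "j < dim_col L" for j
    using assms(1,4) that by (force simp: elements_mat_def)
  then show ?thesis
    using assms by (auto simp: scalar_prod_def intro!: Ints_mult)
qed

lemma ReLU_Z_lattice:
  fixes f :: "real ^ 'n::{finite,linorder} \<Rightarrow> real"
  assumes "f \<in> ReLU_Z k" "u \<in> lattice"
  shows "f u \<in> \<int>"
proof -
  obtain Ls where f: "f = network_fun k Ls" and net: "unbiased_network CARD('n) k Ls"
    and int: "\<forall>L\<in>set Ls. elements_mat L \<subseteq> \<int>"
    using assms(1) by (auto simp: ReLU_Z_def)
  have el: "elements_mat (Ls ! i) \<subseteq> \<int>" if "i \<le> k" for i
    using int net that by (auto simp: unbiased_network_def)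
  have "dim_vec (hidden Ls i u) = dim_col (Ls ! i) \<and>
      (\<forall>j<dim_vec (hidden Ls i u). vec_index (hidden Ls i u) j \<in> \<int>)" if "i \<le> k" for i
    using that
  proof (induction i)
    case 0
    then show ?case
      using net assms(2) by (simp add: hidden_def coords_def unbiased_network_def lattice_def)
  next
    case (Suc i)
    then have "vec_index (Ls ! i *\<^sub>v hidden Ls i u) j \<in> \<int>" if "j < dim_row (Ls ! i)" for j
      using el that by (intro mult_mat_vec_Ints) auto
    with Suc.prems net show ?case
      by (auto simp: hidden_Suc relu_layer_def unbiased_network_def max_def)
  qed
  from this[of k] show ?thesis
    using net el unfolding f network_fun_def
    by (intro mult_mat_vec_Ints) (auto simp: unbiased_network_def)
qed

end

theory Submission
  imports Defs
begin

text \<open>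
  On every cone of the fan, f is linear, and a pointed cone is generated by its rays. So a vector m
  satisfies the inequalities on the rays if and only if m is everywhere at most f. For a convex f,
  which is the maximum of its finitely many integral slopes, these m form the Newton polytope, by
  separation from the convex hull of the slopes.

  A global section is a Laurent polynomial, because on the torus the local equations are units. Its
  order along the divisor of a ray u is the minimum of m u over the exponents m. Hence the sections
  of the k-th multiple have as a basis the characters whose negatives lie in k times the Newton
  polytope, and the number of these lattice points, divided by the power of k whose exponent is the dimension, tends to the volume.
\<close>

section \<open>Counting lattice points\<close>

text \<open>Linearity and integrality have different sources: the rational network \<open>Ls\<close>
  yields the fan and the slopes of \<open>f\<close> on its cones, whereas membership in
  \<open>ReLU_Z\<close> makes \<open>f\<close> integral on the lattice. An integral slope is read
  off on a full-dimensional cone, where \<open>f\<close> can be evaluated at neighbouring lattice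
  points. On a smaller cone the slope is not unique, and convexity finds an integral one among those
  of the full-dimensional cones; it is the exponent of a character that serves as a local equation
  there.

  Testing inequalities on rays needs the rays of each cone to belong to the fan. The fan is built by
  intersecting preimages of cells, with no mention of faces of the result. The induction over the
  layers therefore carries, for each cone, a finite set of rational inequalities such that turning
  any subset of them into equalities stays in the fan.

  A section may be given with any local equation, not only a character. So the order along a ray is
  determined for arbitrary nonzero Laurent polynomials, and regularity of a product is converted
  into an inequality between orders.\<close>

lemma finite_lattice_bounded:
  fixes S :: "(real ^ 'n) set"
  assumes "bounded S"
  shows "finite (S \<inter> lattice)"
proof -
  obtain B where B: "\<And>x. x \<in> S \<Longrightarrow> norm x \<le> B"
    using assms by (auto simp: bounded_iff)
  let ?g = "\<lambda>h::'n \<Rightarrow> int. \<chi> i. real_of_int (h i)"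
  have "S \<inter> lattice \<subseteq> ?g ` (Pi\<^sub>E UNIV (\<lambda>i. {-\<lceil>B\<rceil>..\<lceil>B\<rceil>}))"
  proof
    fix x assume x: "x \<in> S \<inter> lattice"
    have "x $ i = of_int \<lfloor>x $ i\<rfloor>" for i
      using x by (simp add: lattice_def)
    moreover have "\<lfloor>x $ i\<rfloor> \<in> {-\<lceil>B\<rceil>..\<lceil>B\<rceil>}" for i
      using component_le_norm_cart[of x i] B[of x] x by (auto simp: le_floor_iff) linarith+
    ultimately show "x \<in> ?g ` (Pi\<^sub>E UNIV (\<lambda>i. {-\<lceil>B\<rceil>..\<lceil>B\<rceil>}))"
      by (intro image_eqI[of _ _ "\<lambda>i. \<lfloor>x $ i\<rfloor>"]) (auto simp: Finite_Cartesian_Product.vec_eq_iff)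
  qed
  then show ?thesis
    by (rule finite_subset) (intro finite_imageI finite_PiE, auto)
qed

text \<open>Half-open cubes tile space, so every point belongs to exactly one of them; the open and
  the closed box squeeze the measure.\<close>

lemma measure_half_open_cube:
  fixes p :: "real ^ 'n"
  assumes "0 \<le> h"
  defines "C \<equiv> {x. \<forall>i. p $ i \<le> x $ i \<and> x $ i < p $ i + h}"
  shows "C \<in> lmeasurable" "measure lebesgue C = h ^ CARD('n)"
proof -
  let ?q = "p + (\<chi> i. h)"
  have sub: "box p ?q \<subseteq> C" "C \<subseteq> cbox p ?q"
    by (auto simp: C_def mem_box_cart less_imp_le)
  have "C = (\<Inter>i. {x. p $ i \<le> x $ i} \<inter> {x. x $ i < p $ i + h})"
    by (auto simp: C_def)
  moreover have "(\<Inter>i. {x::real ^ 'n. p $ i \<le> x $ i} \<inter> {x. x $ i < p $ i + h}) \<in> sets lebesgue"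
    by (intro sets.countable_INT' sets.Int) (auto intro!: sets_completionI_sets borel_closed borel_open
        closed_halfspace_component_ge_cart open_halfspace_component_lt_cart)
  ultimately show C: "C \<in> lmeasurable"
    using sub(2) by (metis bounded_cbox bounded_subset bounded_set_imp_lmeasurable)
  have "measure lebesgue (cbox p ?q) = h ^ CARD('n)"
    using \<open>0 \<le> h\<close> content_cbox_cart[of p ?q] by (simp add: interval_ne_empty_cart)
  moreover have "measure lebesgue (box p ?q) = measure lebesgue (cbox p ?q)"
    by (simp add: measure_def emeasure_lborel_box_eq emeasure_lborel_cbox_eq)
  moreover have "measure lebesgue (box p ?q) \<le> measure lebesgue C"
    using sub C by (intro measure_mono_fmeasurable) auto
  moreover have "measure lebesgue C \<le> measure lebesgue (cbox p ?q)"
    using sub C by (intro measure_mono_fmeasurable) auto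
  ultimately show "measure lebesgue C = h ^ CARD('n)" by simp
qed

text \<open>The cubes of side \<open>1 / m\<close> based at the points of \<open>K\<close> in the
  lattice scaled by \<open>1 / m\<close> have a union \<open>Q m\<close> whose volume is the
  normalized count. Off the frontier of \<open>K\<close> the indicator of \<open>Q m\<close> is
  eventually that of \<open>K\<close>, and the frontier of a convex set is null, so dominated
  convergence applies. A polytope of lower dimension is covered, with limit 0.\<close>

lemma lattice_points_scaled_tendsto:
  fixes K :: "(real ^ 'n) set"
  assumes "compact K" "convex K"
  shows "(\<lambda>m. real (card {p \<in> lattice. (1 / real m) *\<^sub>R p \<in> K}) / real m ^ CARD('n))
    \<longlonglongrightarrow> measure lebesgue K"
proof -
  define fl where "fl m x = (\<chi> i. real_of_int \<lfloor>real m * x $ i\<rfloor>)" for m and x :: "real ^ 'n"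
  define Q where "Q m = {x. (1 / real m) *\<^sub>R fl m x \<in> K}" for m
  define A where "A m = {p \<in> lattice. (1 / real m) *\<^sub>R p \<in> K}" for m
  define C where "C m p = {x::real^'n. \<forall>i. ((1 / real m) *\<^sub>R p) $ i \<le> x $ i \<and> x $ i < ((1 / real m) *\<^sub>R p) $ i + 1 / real m}" for m p
  have in_C: "x \<in> C m p \<longleftrightarrow> p = fl m x" if m: "m > 0" "p \<in> lattice" for m p x
  proof -
    have "(((1 / real m) *\<^sub>R p) $ i \<le> x $ i \<and> x $ i < ((1 / real m) *\<^sub>R p) $ i + 1 / real m) \<longleftrightarrow>
       p $ i = real_of_int \<lfloor>real m * x $ i\<rfloor>" for i
    proof -
      obtain k where k: "p $ i = of_int k"
        using m(2) by (auto simp: lattice_def elim: Ints_cases)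
      have "(((1 / real m) *\<^sub>R p) $ i \<le> x $ i \<and> x $ i < ((1 / real m) *\<^sub>R p) $ i + 1 / real m) \<longleftrightarrow>
        of_int k \<le> real m * x $ i \<and> real m * x $ i < of_int k + 1"
        using m(1) by (simp add: k field_simps)
      also have "\<dots> \<longleftrightarrow> \<lfloor>real m * x $ i\<rfloor> = k"
        by linarith
      finally show ?thesis by (auto simp: k)
    qed
    then show ?thesis by (simp only: C_def fl_def Finite_Cartesian_Product.vec_eq_iff mem_Collect_eq vec_lambda_beta)
  qed
  have fl_lattice: "fl m x \<in> lattice" for m x
    by (simp add: fl_def lattice_def)
  have finA: "finite (A m)" if "m > 0" for m
  proof -
    have "A m \<subseteq> (\<lambda>p. real m *\<^sub>R p) ` K \<inter> lattice"
      using that by (auto simp: A_def intro!: image_eqI[of _ _ "(1 / real m) *\<^sub>R _"])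
    moreover have "bounded ((\<lambda>p. real m *\<^sub>R p) ` K)"
      using assms(1) by (intro bounded_scaling compact_imp_bounded)
    ultimately show ?thesis
      using finite_lattice_bounded finite_subset by blast
  qed
  have Q_eq: "Q m = (\<Union>p\<in>A m. C m p)" if "m > 0" for m
    using that in_C fl_lattice by (auto simp: Q_def A_def)
  have Cm: "C m p \<in> lmeasurable" "measure lebesgue (C m p) = (1 / real m) ^ CARD('n)" for m p
    unfolding C_def by (rule measure_half_open_cube, simp)+
  have Q_meas: "Q m \<in> lmeasurable" if "m > 0" for m
    unfolding Q_eq[OF that] by (intro fmeasurable.finite_UN finA that) (auto simp: Cm)
  have Q_vol: "measure lebesgue (Q m) = real (card (A m)) / real m ^ CARD('n)" if m: "m > 0" for m
  proof -
    have "measure lebesgue (Q m) = (\<Sum>p\<in>A m. measure lebesgue (C m p))"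
      unfolding Q_eq[OF m]
    proof (rule measure_UNION')
      show "pairwise (\<lambda>p q. disjnt (C m p) (C m q)) (A m)"
        using m by (auto simp: pairwise_def disjnt_def in_C A_def)
    qed (auto simp: finA m Cm)
    then show ?thesis by (simp add: Cm power_one_over)
  qed
  have close: "norm (x - (1 / real m) *\<^sub>R fl m x) \<le> real CARD('n) / real m" if m: "m > 0" for m x
  proof -
    have "\<bar>(x - (1 / real m) *\<^sub>R fl m x) $ i\<bar> \<le> 1 / real m" for i
    proof -
      have "(x - (1 / real m) *\<^sub>R fl m x) $ i = (real m * x $ i - of_int \<lfloor>real m * x $ i\<rfloor>) / real m"
        using m by (simp add: fl_def field_simps)
      moreover have "\<bar>real m * x $ i - of_int \<lfloor>real m * x $ i\<rfloor>\<bar> \<le> 1" by linarith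
      ultimately show ?thesis using m by (simp add: divide_right_mono)
    qed
    then have "(\<Sum>i\<in>UNIV. \<bar>(x - (1 / real m) *\<^sub>R fl m x) $ i\<bar>) \<le> (\<Sum>i\<in>(UNIV::'n set). 1 / real m)"
      by (intro sum_mono) auto
    then show ?thesis
      using norm_le_l1_cart[of "x - (1 / real m) *\<^sub>R fl m x"] by simp
  qed
  obtain B where B: "\<And>x. x \<in> K \<Longrightarrow> norm x \<le> B"
    using compact_imp_bounded[OF assms(1)] by (auto simp: bounded_iff)
  \<comment> \<open>A bound independent of \<open>m\<close>; the indicator of this ball is the
    dominating function.\<close>
  have Q_bound: "Q m \<subseteq> cball 0 (B + real CARD('n))" if m: "m > 0" for m
  proof
    fix x assume "x \<in> Q m"
    then have "norm ((1 / real m) *\<^sub>R fl m x) \<le> B" using B unfolding Q_def by blast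
    moreover have "real CARD('n) / real m \<le> real CARD('n)"
      using m by (simp add: divide_le_eq)
    ultimately show "x \<in> cball 0 (B + real CARD('n))"
      using close[OF m, of x] norm_triangle_sub[of x "(1 / real m) *\<^sub>R fl m x"] by simp
  qed
  have lim: "(\<lambda>m. (1 / real (Suc m)) *\<^sub>R fl (Suc m) x) \<longlonglongrightarrow> x" for x
  proof -
    have "(\<lambda>m. x - (1 / real (Suc m)) *\<^sub>R fl (Suc m) x) \<longlonglongrightarrow> 0"
    proof (rule Lim_null_comparison)
      show "\<forall>\<^sub>F m in sequentially. norm (x - (1 / real (Suc m)) *\<^sub>R fl (Suc m) x) \<le> real CARD('n) / real (Suc m)"
        by (intro always_eventually allI close) simp
      show "(\<lambda>m. real CARD('n) / real (Suc m)) \<longlonglongrightarrow> 0"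
        by (rule LIMSEQ_Suc[OF lim_const_over_n])
    qed
    from tendsto_diff[OF tendsto_const this, of x] show ?thesis by simp
  qed
  have K: "K \<in> lmeasurable" using assms(1) lmeasurable_compact by blast
  \<comment> \<open>The index is shifted because \<open>1 / real 0\<close> is 0, which makes
    \<open>Q 0\<close> the whole space as soon as \<open>K\<close> contains 0.\<close>
  have "(\<lambda>m. integral\<^sup>L lebesgue (indicator (Q (Suc m)) :: _ \<Rightarrow> real)) \<longlonglongrightarrow> integral\<^sup>L lebesgue (indicator K)"
  proof (rule integral_dominated_convergence)
    show "integrable lebesgue (indicator (cball 0 (B + real CARD('n))) :: real^'n \<Rightarrow> real)"
      using lmeasurable_cball lmeasurable_iff_integrable by blast
    show "AE x in lebesgue. (\<lambda>m. indicator (Q (Suc m)) x :: real) \<longlonglongrightarrow> indicator K x"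
    proof -
      have "(\<lambda>m. indicator (Q (Suc m)) x :: real) \<longlonglongrightarrow> indicator K x" if x: "x \<notin> frontier K" for x
      proof (rule tendsto_eventually)
        have "open (interior K)" "open (- K)"
          using assms(1) by (auto simp: compact_imp_closed open_Compl)
        consider "x \<in> interior K" | "x \<in> - K"
          using x assms(1) by (auto simp: frontier_def compact_imp_closed)
        then show "\<forall>\<^sub>F m in sequentially. indicator (Q (Suc m)) x = (indicator K x :: real)"
        proof cases
          case 1
          from topological_tendstoD[OF lim \<open>open (interior K)\<close> 1]
          show ?thesis
            by eventually_elim (use 1 interior_subset[of K] in \<open>auto simp: Q_def indicator_def\<close>)
        next
          case 2
          from topological_tendstoD[OF lim \<open>open (- K)\<close> 2]
          show ?thesis
            by eventually_elim (use 2 in \<open>auto simp: Q_def indicator_def\<close>)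
        qed
      qed
      moreover have "AE x in lebesgue. x \<notin> frontier K"
        using negligible_convex_frontier[OF assms(2)]
        by (auto simp: negligible_iff_null_sets AE_not_in)
      ultimately show ?thesis by auto
    qed
    show "AE x in lebesgue. norm (indicator (Q (Suc m)) x :: real) \<le> indicator (cball 0 (B + real CARD('n))) x" for m
      using Q_bound[of "Suc m"] by (intro AE_I2) (auto simp: indicator_def)
  qed (use K Q_meas in \<open>auto simp: fmeasurableD\<close>)
  then have "(\<lambda>m. measure lebesgue (Q (Suc m))) \<longlonglongrightarrow> measure lebesgue K"
    using K Q_meas by simp
  then have "(\<lambda>m. real (card (A (Suc m))) / real (Suc m) ^ CARD('n)) \<longlonglongrightarrow> measure lebesgue K"
    by (simp add: Q_vol)
  then show ?thesis unfolding A_def by (rule LIMSEQ_imp_Suc)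
qed

section \<open>Discrete valuations and Laurent polynomials\<close>

lemma units_at_mult:
  assumes "\<And>a b. a \<in> R \<Longrightarrow> b \<in> R \<Longrightarrow> a * b \<in> R" "u \<in> units_at R" "v \<in> units_at R"
  shows "u * v \<in> units_at R"
  using assms by (simp add: units_at_def)

lemma units_at_inverse: "u \<in> units_at R \<Longrightarrow> inverse u \<in> units_at R"
  by (simp add: units_at_def)

lemma units_at_powi:
  assumes "1 \<in> R" "\<And>a b. a \<in> R \<Longrightarrow> b \<in> R \<Longrightarrow> a * b \<in> R" "u \<in> units_at R"
  shows "u powi j \<in> units_at R"
proof -
  have pow: "v ^ n \<in> units_at R" if "v \<in> units_at R" for v n
    using that assms(1,2) by (induction n) (auto simp: units_at_def)
  show ?thesis
    using pow[OF assms(3)] pow[OF units_at_inverse[OF assms(3)]] by (simp add: power_int_def)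
qed

text \<open>If a power of \<open>\<pi>\<close> with nonzero exponent were a unit, so would be some
  \<open>\<pi> ^ Suc n\<close>, and multiplying its inverse by \<open>\<pi> ^ n\<close> would invert
  \<open>\<pi>\<close> in \<open>R\<close>.\<close>

lemma units_at_powi_cancel:
  assumes one: "1 \<in> R" and mult: "\<And>a b. a \<in> R \<Longrightarrow> b \<in> R \<Longrightarrow> a * b \<in> R"
    and "\<pi> \<in> R" "\<pi> \<notin> units_at R" "\<pi> powi j \<in> units_at R"
  shows "j = 0"
proof (rule ccontr)
  assume "j \<noteq> 0"
  then obtain n where n: "nat \<bar>j\<bar> = Suc n" by (cases "nat \<bar>j\<bar>") auto
  have "\<pi> ^ nat \<bar>j\<bar> \<in> units_at R"
    using assms(5) units_at_inverse[OF assms(5)]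
    by (cases "j \<ge> 0") (auto simp: power_int_def power_inverse)
  then have unit: "\<pi> ^ Suc n \<in> units_at R" by (simp add: n)
  have "\<pi> ^ n \<in> R" by (induction n) (auto simp: assms)
  then have "\<pi> ^ n * inverse (\<pi> ^ Suc n) \<in> R"
    using unit by (intro mult) (auto simp: units_at_def)
  moreover have "\<pi> \<noteq> 0" using unit by (auto simp: units_at_def)
  ultimately have "inverse \<pi> \<in> R" by (simp add: field_simps)
  then show False using assms(3,4) \<open>\<pi> \<noteq> 0\<close> by (simp add: units_at_def)
qed

text \<open>\<open>vanishing_order\<close> admits every uniformizer, so uniqueness of the exponent
  requires comparing two of them. Each generates the nonunits, hence they differ by a unit factor
  \<open>t\<close>, and two exponents then produce a unit power of \<open>\<pi>'\<close>.\<close>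

lemma vanishing_order_eqI:
  fixes R :: "'a::field set"
  assumes one: "1 \<in> R" and mult: "\<And>a b. a \<in> R \<Longrightarrow> b \<in> R \<Longrightarrow> a * b \<in> R"
    and "\<pi> \<noteq> 0" and max: "R - units_at R = (\<lambda>t. \<pi> * t) ` R"
    and unit: "g / \<pi> powi j \<in> units_at R"
  shows "vanishing_order R g = j"
  unfolding vanishing_order_def
proof (rule the_equality)
  show "\<exists>\<pi>. R - units_at R = (\<lambda>t. \<pi> * t) ` R \<and> g / \<pi> powi j \<in> units_at R"
    using max unit by blast
next
  fix j'
  assume "\<exists>\<pi>. R - units_at R = (\<lambda>t. \<pi> * t) ` R \<and> g / \<pi> powi j' \<in> units_at R"
  then obtain \<pi>' where max': "R - units_at R = (\<lambda>t. \<pi>' * t) ` R"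
    and unit': "g / \<pi>' powi j' \<in> units_at R" by blast
  have "\<pi> \<in> R - units_at R" unfolding max using one by force
  then obtain t where t: "t \<in> R" "\<pi> = \<pi>' * t" unfolding max' by blast
  have \<pi>': "\<pi>' \<in> R - units_at R" unfolding max' using one by force
  then obtain t' where t': "t' \<in> R" "\<pi>' = \<pi> * t'" unfolding max by blast
  have "\<pi> = \<pi> * (t' * t)" using t t' by (metis mult.assoc)
  then have tt: "t' * t = 1" using \<open>\<pi> \<noteq> 0\<close> by simp
  then have "t' = inverse t" "t \<noteq> 0" by (metis inverse_unique mult.commute, auto)
  then have "t \<in> units_at R" using t t' by (simp add: units_at_def)
  have nz: "\<pi>' \<noteq> 0" "g \<noteq> 0"
    using t(2) \<open>\<pi> \<noteq> 0\<close> unit by (auto simp: units_at_def)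
  have "\<pi>' powi (j' - j) = (g / \<pi> powi j) * t powi j * inverse (g / \<pi>' powi j')"
    using nz \<open>t \<noteq> 0\<close> by (simp add: t(2) power_int_mult_distrib power_int_diff field_simps)
  also have "\<dots> \<in> units_at R"
    by (intro units_at_mult units_at_powi units_at_inverse one mult unit unit' \<open>t \<in> units_at R\<close>)
  finally have "j' - j = 0"
    using \<pi>' units_at_powi_cancel[OF one mult] by blast
  then show "j' = j" by simp
qed

section \<open>Laurent polynomials inside the function field\<close>

definition of_laurent :: "'n::{finite,linorder} laurent \<Rightarrow> 'n ratfun" where
  "of_laurent a = Fract a 1"

definition chi :: "('n::{finite,linorder} \<Rightarrow>\<^sub>0 int) \<Rightarrow> 'n ratfun" where
  "chi m = of_laurent (Poly_Mapping.single m 1)"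

lemma of_laurent_simps [simp]:
  "of_laurent (a * b) = of_laurent a * of_laurent b" "of_laurent (a + b) = of_laurent a + of_laurent b" "of_laurent 1 = 1" "of_laurent 0 = 0"
  "of_laurent a = of_laurent b \<longleftrightarrow> a = b" "of_laurent a = 0 \<longleftrightarrow> a = 0"
  by (simp_all add: of_laurent_def eq_fract One_fract_def Zero_fract_def)

lemma Fract_of_laurent: "Fract a b = of_laurent a / of_laurent b"
  by (simp add: of_laurent_def)

lemma chi_add: "chi (a + b) = chi a * chi b"
  by (simp add: chi_def mult_single flip: of_laurent_simps)

lemma chi_0 [simp]: "chi 0 = 1"
  by (simp add: chi_def flip: of_laurent_simps)

lemma chi_nonzero [simp]: "chi a \<noteq> 0"
  by (simp add: chi_def) (metis lookup_single_eq lookup_zero zero_neq_one)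

lemma chi_uminus: "chi (- a) = inverse (chi a)"
  using chi_add[of "- a" a] by (simp add: field_simps)

lemma chi_frag_cmul: "chi (frag_cmul j e) = chi e powi j"
proof -
  have nat: "chi (frag_cmul (int n) e) = chi e ^ n" for n
    by (induction n) (auto simp: frag_cmul_distrib chi_add)
  have "chi (frag_cmul (- int n) e) = inverse (chi e ^ n)" for n
    using nat[of n] by (metis minus_frag_cmul chi_uminus)
  with nat show ?thesis
    by (cases j rule: int_cases2) (auto simp: power_int_minus)
qed

text \<open>Terms of a product may cancel, so \<open>keys_mult\<close> gives one inclusion only. A
  monomial is invertible, and the same inclusion for its inverse gives the other.\<close>

lemma keys_mult_single:
  fixes a :: "'n::{finite,linorder} laurent"
  shows "Poly_Mapping.keys (a * Poly_Mapping.single k 1) = (\<lambda>m. m + k) ` Poly_Mapping.keys a"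
proof -
  have sub: "Poly_Mapping.keys (b * Poly_Mapping.single l 1) \<subseteq> (\<lambda>m. m + l) ` Poly_Mapping.keys b"
    for b :: "'n laurent" and l
    using keys_mult[of b "Poly_Mapping.single l 1"] by (simp add: image_def) blast
  have "a = (a * Poly_Mapping.single k 1) * Poly_Mapping.single (- k) 1"
    by (simp add: mult.assoc mult_single)
  then have sub': "Poly_Mapping.keys a \<subseteq> (\<lambda>m. m + - k) ` Poly_Mapping.keys (a * Poly_Mapping.single k 1)"
    using sub by metis
  have "m + k \<in> Poly_Mapping.keys (a * Poly_Mapping.single k 1)"
    if m: "m \<in> Poly_Mapping.keys a" for m
  proof -
    obtain m' where "m' \<in> Poly_Mapping.keys (a * Poly_Mapping.single k 1)" "m = m' + - k"
      using subsetD[OF sub' m] by blast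
    then show ?thesis by simp
  qed
  then have "(\<lambda>m. m + k) ` Poly_Mapping.keys a \<subseteq> Poly_Mapping.keys (a * Poly_Mapping.single k 1)"
    by (rule image_subsetI)
  with sub show ?thesis by blast
qed

lemma char_vec_add: "char_vec (a + b) = char_vec a + char_vec b"
  by (simp add: char_vec_def Finite_Cartesian_Product.vec_eq_iff lookup_add)

lemma char_vec_0 [simp]: "char_vec 0 = 0"
  by (simp add: char_vec_def Finite_Cartesian_Product.vec_eq_iff)

lemma char_vec_frag_cmul: "char_vec (frag_cmul j a) = of_int j *\<^sub>R char_vec a"
  by (simp add: char_vec_def Finite_Cartesian_Product.vec_eq_iff)

section \<open>Cone rings and their ideals\<close>

lemma cone_algebra_add: "a \<in> cone_algebra \<sigma> \<Longrightarrow> b \<in> cone_algebra \<sigma> \<Longrightarrow> a + b \<in> cone_algebra \<sigma>"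
  using keys_add[of a b] unfolding cone_algebra_def by blast

lemma cone_algebra_mult:
  assumes "a \<in> cone_algebra \<sigma>" "b \<in> cone_algebra \<sigma>"
  shows "a * b \<in> cone_algebra \<sigma>"
  unfolding cone_algebra_def
proof (intro CollectI ballI)
  fix m u assume "m \<in> Poly_Mapping.keys (a * b)" "u \<in> \<sigma>"
  then obtain p q where "m = p + q" "p \<in> Poly_Mapping.keys a" "q \<in> Poly_Mapping.keys b"
    using keys_mult[of a b] by blast
  then show "0 \<le> char_vec m \<bullet> u"
    using assms \<open>u \<in> \<sigma>\<close> by (simp add: cone_algebra_def char_vec_add inner_add_left)
qed

lemma cone_algebra_uminus: "a \<in> cone_algebra \<sigma> \<Longrightarrow> - a \<in> cone_algebra \<sigma>"
  by (simp add: cone_algebra_def)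

lemma cone_algebra_0 [simp]: "0 \<in> cone_algebra \<sigma>"
  by (simp add: cone_algebra_def)

lemma cone_algebra_1 [simp]: "1 \<in> cone_algebra \<sigma>"
  by (simp add: cone_algebra_def)

lemma cring_cone_ring: "cring (cone_ring \<sigma>)"
proof (rule cringI)
  show "abelian_group (cone_ring \<sigma>)"
  proof (rule abelian_groupI)
    fix x assume "x \<in> carrier (cone_ring \<sigma>)"
    then show "\<exists>y\<in>carrier (cone_ring \<sigma>). y \<oplus>\<^bsub>cone_ring \<sigma>\<^esub> x = \<zero>\<^bsub>cone_ring \<sigma>\<^esub>"
      by (intro bexI[of _ "- x"]) (auto simp: cone_ring_def cone_algebra_uminus)
  qed (auto simp: cone_ring_def cone_algebra_add)
  show "Group.comm_monoid (cone_ring \<sigma>)"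
    by (rule comm_monoidI) (auto simp: cone_ring_def cone_algebra_mult mult.assoc mult.commute)
qed (auto simp: cone_ring_def algebra_simps)

text \<open>Closure under negation is automatic, since \<open>- 1\<close> lies in every cone algebra
  and is absorbed by \<open>I\<close>.\<close>

lemma ideal_cone_ringI:
  assumes "I \<subseteq> cone_algebra \<sigma>" "0 \<in> I" "\<And>a b. a \<in> I \<Longrightarrow> b \<in> I \<Longrightarrow> a + b \<in> I"
    "\<And>a b. a \<in> I \<Longrightarrow> b \<in> cone_algebra \<sigma> \<Longrightarrow> b * a \<in> I"
  shows "ideal I (cone_ring \<sigma>)"
proof -
  interpret cring "cone_ring \<sigma>" by (rule cring_cone_ring)
  have "ring (cone_ring \<sigma>)" by unfold_locales
  then show ?thesis
  proof (rule idealI)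
    show "subgroup I (add_monoid (cone_ring \<sigma>))"
    proof
      fix x assume x: "x \<in> I"
      have "\<ominus>\<^bsub>cone_ring \<sigma>\<^esub> x = - x"
        using x assms(1) by (intro minus_equality) (auto simp: cone_ring_def cone_algebra_uminus)
      moreover have "- x \<in> I"
        using assms(4)[OF x, of "- 1"] by (simp add: cone_algebra_uminus)
      ultimately show "inv\<^bsub>add_monoid (cone_ring \<sigma>)\<^esub> x \<in> I"
        by (simp add: a_inv_def)
    qed (use assms in \<open>auto simp: cone_ring_def\<close>)
    fix a x assume "a \<in> I" "x \<in> carrier (cone_ring \<sigma>)"
    then show "x \<otimes>\<^bsub>cone_ring \<sigma>\<^esub> a \<in> I" "a \<otimes>\<^bsub>cone_ring \<sigma>\<^esub> x \<in> I"
      using assms(4)[of a x] by (simp_all add: cone_ring_def mult.commute[of a x])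
  qed
qed

lemma cone_algebra_zero_cone [simp]: "cone_algebra {0} = UNIV"
  by (auto simp: cone_algebra_def)

text \<open>
  The denominators of an element that lies in all localizations at prime ideals form an ideal that
  is contained in no maximal one.
\<close>
lemma Inter_chart_zero_cone:
  assumes "\<And>x. x \<in> chart {0} \<Longrightarrow> g \<in> x"
  shows "g \<in> range (of_laurent :: 'n::{finite,linorder} laurent \<Rightarrow> _)"
proof (rule ccontr)
  assume g: "g \<notin> range (of_laurent :: 'n laurent \<Rightarrow> _)"
  let ?R = "cone_ring {0} :: 'n laurent ring"
  interpret cring ?R by (rule cring_cone_ring)
  define J where "J = {b :: 'n laurent. of_laurent b * g \<in> range of_laurent}"
  \<comment> \<open>The zero cone imposes no condition on exponents, so the carrier is everything
    and absorption holds for every Laurent polynomial.\<close>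
  have ideal_iff: "ideal I ?R \<longleftrightarrow> 0 \<in> I \<and> (\<forall>a\<in>I. \<forall>b\<in>I. a + b \<in> I) \<and> (\<forall>a\<in>I. \<forall>b. b * a \<in> I)" for I
  proof
    assume "ideal I ?R"
    then interpret ideal I ?R .
    show "0 \<in> I \<and> (\<forall>a\<in>I. \<forall>b\<in>I. a + b \<in> I) \<and> (\<forall>a\<in>I. \<forall>b. b * a \<in> I)"
      using additive_subgroup.zero_closed[OF additive_subgroup_axioms] a_closed I_l_closed
      by (auto simp: cone_ring_def)
  qed (intro ideal_cone_ringI, auto)
  define S where "S = {I. ideal I ?R \<and> J \<subseteq> I \<and> 1 \<notin> I}"
  have range_add: "a + b \<in> range of_laurent" if "a \<in> range of_laurent" "b \<in> range of_laurent" for a b :: "'n ratfun"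
    using that by (elim rangeE) (auto intro: range_eqI[of _ _ "_ + _"])
  have range_mult: "of_laurent c * a \<in> range of_laurent" if "a \<in> range of_laurent" for a :: "'n ratfun" and c
    using that by (elim rangeE) (auto intro: range_eqI[of _ _ "_ * _"])
  have "0 \<in> J" by (auto simp: J_def intro: range_eqI[of _ _ 0])
  moreover have "a + b \<in> J" if "a \<in> J" "b \<in> J" for a b
    using that by (simp add: J_def distrib_right range_add)
  moreover have "b * a \<in> J" if "a \<in> J" for a b
    using that by (simp add: J_def mult.assoc range_mult)
  ultimately have "ideal J ?R" unfolding ideal_iff by blast
  then have "J \<in> S" using g by (simp add: S_def J_def)
  \<comment> \<open>Zorn on the ideals that contain \<open>J\<close> and avoid 1; the union of a
    chain still avoids 1.\<close>
  have "\<exists>M\<in>S. \<forall>X\<in>S. M \<subseteq> X \<longrightarrow> X = M"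
  proof (rule subset_Zorn_nonempty)
    show "S \<noteq> {}" using \<open>J \<in> S\<close> by blast
    fix C assume C: "C \<noteq> {}" "subset.chain S C"
    have sub: "C \<subseteq> S" and tot: "\<And>X Y. X \<in> C \<Longrightarrow> Y \<in> C \<Longrightarrow> X \<subseteq> Y \<or> Y \<subseteq> X"
      using C(2) by (auto simp: subset_chain_def)
    have id: "ideal X ?R" and J1: "J \<subseteq> X" "1 \<notin> X" if "X \<in> C" for X
      using sub that by (auto simp: S_def)
    have closed: "0 \<in> X" "\<And>a b. a \<in> X \<Longrightarrow> b \<in> X \<Longrightarrow> a + b \<in> X" "\<And>a b. a \<in> X \<Longrightarrow> b * a \<in> X"
      if "X \<in> C" for X
      using id[OF that] unfolding ideal_iff by blast+
    obtain X0 where X0: "X0 \<in> C" using C(1) by blast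
    have "ideal (\<Union>C) ?R"
      unfolding ideal_iff
    proof (intro conjI ballI allI)
      show "0 \<in> \<Union>C" using closed(1)[OF X0] X0 by (intro UnionI)
      fix a b assume "a \<in> \<Union>C" "b \<in> \<Union>C"
      then obtain X Y where XY: "X \<in> C" "a \<in> X" "Y \<in> C" "b \<in> Y" by (elim UnionE)
      show "a + b \<in> \<Union>C"
      proof (cases "X \<subseteq> Y")
        case True
        then show ?thesis using XY by (intro UnionI[of Y] closed(2)) auto
      next
        case False
        then have "Y \<subseteq> X" using tot XY by blast
        then show ?thesis using XY by (intro UnionI[of X] closed(2)) auto
      qed
    next
      fix a b assume "a \<in> \<Union>C"
      then obtain X where X: "X \<in> C" "a \<in> X" by (elim UnionE)
      then show "b * a \<in> \<Union>C" by (intro UnionI[of X] closed(3))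
    qed
    moreover have "J \<subseteq> \<Union>C" "1 \<notin> \<Union>C" using J1 X0 by auto
    ultimately show "\<Union>C \<in> S" by (simp add: S_def)
  qed
  then obtain M where M: "M \<in> S" "\<forall>X\<in>S. M \<subseteq> X \<longrightarrow> X = M" by (elim bexE)
  have "maximalideal M ?R"
  proof (rule maximalidealI)
    show "ideal M ?R" using M by (simp add: S_def)
    show "carrier ?R \<noteq> M" using M by (auto simp: S_def cone_ring_def)
    fix I assume I: "ideal I ?R" "M \<subseteq> I"
    show "I = M \<or> I = carrier ?R"
    proof (cases "1 \<in> I")
      case True
      then have "x * 1 \<in> I" for x
        using I(1) unfolding ideal_iff by blast
      then show ?thesis by (auto simp: cone_ring_def)
    next
      case False
      then have "I \<in> S" using I M(1) unfolding S_def by blast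
      then show ?thesis using M(2) I by blast
    qed
  qed
  then have "primeideal M ?R" by (rule maximalideal_prime)
  then have "local_ring {0} M \<in> chart {0}" unfolding chart_def by blast
  \<comment> \<open>Membership of \<open>g\<close> in this local ring supplies a denominator outside
    \<open>M\<close>, yet every denominator of \<open>g\<close> lies in \<open>J\<close> and so in
    \<open>M\<close>.\<close>
  then have "g \<in> local_ring {0} M" by (rule assms)
  then obtain a b where ab: "g = Fract a b" "b \<notin> M" unfolding local_ring_def by blast
  have "ideal M ?R" "J \<subseteq> M" using M(1) unfolding S_def by blast+
  then have "0 \<in> M" unfolding ideal_iff by blast
  with ab(2) have "b \<noteq> 0" by metis
  then have "of_laurent b * g = of_laurent a" unfolding ab(1) Fract_of_laurent by simp
  then have "b \<in> J" by (simp add: J_def)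
  then show False using ab(2) \<open>J \<subseteq> M\<close> by blast
qed

section \<open>The order of vanishing along a torus-invariant prime divisor\<close>

text \<open>The character \<open>e\<close> of weight 1 provides the uniformizer \<open>chi e\<close>
  of the local ring along the divisor; for a primitive \<open>u\<close> such an \<open>e\<close>
  exists.\<close>

locale ray_chart =
  fixes \<rho> :: "(real ^ 'n::{finite,linorder}) set" and u :: "real ^ 'n::{finite,linorder}" and e :: "'n::{finite,linorder} \<Rightarrow>\<^sub>0 int"
  assumes ray: "\<rho> = (\<lambda>t. t *\<^sub>R u) ` {0..}"
    and gen: "ray_gen \<rho> = u"
    and lattice: "u \<in> Defs.lattice"
    and dual: "char_vec e \<bullet> u = 1"
begin

text \<open>The pairing with \<open>u\<close> as an integer; the floors are exact because
  \<open>u\<close> is a lattice vector.\<close>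

definition wt :: "('n \<Rightarrow>\<^sub>0 int) \<Rightarrow> int" where
  "wt m = (\<Sum>i\<in>UNIV. Poly_Mapping.lookup m i * \<lfloor>u $ i\<rfloor>)"

lemma of_int_wt: "of_int (wt m) = char_vec m \<bullet> u"
proof -
  have floor: "of_int \<lfloor>u $ i\<rfloor> = u $ i" for i
    using lattice by (simp add: Defs.lattice_def)
  show ?thesis
    by (simp only: wt_def char_vec_def inner_vec_def of_int_sum of_int_mult floor vec_lambda_beta inner_real_def)
qed

lemma wt_add: "wt (a + b) = wt a + wt b"
  by (simp add: wt_def lookup_add distrib_right sum.distrib)

lemma wt_uminus: "wt (- a) = - wt a"
  by (simp add: wt_def sum_negf)

lemma wt_diff: "wt (a - b) = wt a - wt b"
  using wt_add[of a "- b"] by (simp add: wt_uminus)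

lemma wt_e: "wt e = 1"
  using of_int_wt[of e] dual by simp

lemma wt_frag_cmul: "wt (frag_cmul j a) = j * wt a"
  by (simp add: wt_def sum_distrib_left mult.assoc)

lemma in_cone_algebra: "a \<in> cone_algebra \<rho> \<longleftrightarrow> (\<forall>m\<in>Poly_Mapping.keys a. 0 \<le> wt m)"
proof -
  have "(\<forall>v\<in>\<rho>. 0 \<le> char_vec m \<bullet> v) \<longleftrightarrow> 0 \<le> wt m" for m
  proof
    assume "\<forall>v\<in>\<rho>. 0 \<le> char_vec m \<bullet> v"
    moreover have "u \<in> \<rho>" unfolding ray by (rule image_eqI[of _ _ 1]) auto
    ultimately have "0 \<le> real_of_int (wt m)" unfolding of_int_wt by blast
    then show "0 \<le> wt m" by simp
  next
    assume "0 \<le> wt m"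
    then have "0 \<le> real_of_int (wt m)" by simp
    then show "\<forall>v\<in>\<rho>. 0 \<le> char_vec m \<bullet> v" by (auto simp: ray of_int_wt)
  qed
  then show ?thesis by (simp add: cone_algebra_def)
qed

definition I :: "'n laurent set" where
  "I = {a. \<forall>m\<in>Poly_Mapping.keys a. 0 < wt m}"

lemma I_subset: "I \<subseteq> cone_algebra \<rho>"
  unfolding I_def in_cone_algebra subset_iff using less_imp_le by blast

lemma I_add: "a \<in> I \<Longrightarrow> b \<in> I \<Longrightarrow> a + b \<in> I"
  using keys_add[of a b] unfolding I_def by blast

lemma I_mult:
  assumes "a \<in> I" "b \<in> cone_algebra \<rho>"
  shows "b * a \<in> I"
  unfolding I_def
proof (intro CollectI ballI)
  fix m assume "m \<in> Poly_Mapping.keys (b * a)"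
  then obtain p q where "m = p + q" "p \<in> Poly_Mapping.keys b" "q \<in> Poly_Mapping.keys a"
    using keys_mult[of b a] by blast
  then show "0 < wt m"
    using assms by (auto simp: I_def in_cone_algebra wt_add intro: add_nonneg_pos)
qed

text \<open>Modulo \<open>I\<close> only the components of weight 0 survive, and these form a
  domain. The product of the parts of \<open>a\<close> and \<open>b\<close> is nonzero with all
  exponents of weight 0, while it is congruent to \<open>a * b\<close>.\<close>

lemma I_prime:
  assumes a: "a \<in> cone_algebra \<rho>" "a \<notin> I" and b: "b \<in> cone_algebra \<rho>" "b \<notin> I"
  shows "a * b \<notin> I"
proof
  assume ab: "a * b \<in> I"
  define part :: "'n laurent \<Rightarrow> 'n laurent"
    where "part c = Poly_Mapping.mapp (\<lambda>m z. if wt m = 0 then z else 0) c" for c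
  have lookup_part: "Poly_Mapping.lookup (part c) m = (if wt m = 0 then Poly_Mapping.lookup c m else 0)"
    for c m
    by (auto simp: part_def Poly_Mapping.lookup_mapp in_keys_iff when_def)
  have part: "part c \<in> cone_algebra \<rho>" "part c \<noteq> 0" "c - part c \<in> I"
    if c: "c \<in> cone_algebra \<rho>" "c \<notin> I" for c
  proof -
    show "part c \<in> cone_algebra \<rho>"
      by (auto simp: in_cone_algebra in_keys_iff lookup_part split: if_splits)
    obtain m where m: "m \<in> Poly_Mapping.keys c" "\<not> 0 < wt m"
      using c(2) unfolding I_def by blast
    then have "wt m = 0" using c(1) unfolding in_cone_algebra by fastforce
    then have "Poly_Mapping.lookup (part c) m \<noteq> 0"
      using m(1) by (simp add: lookup_part in_keys_iff)
    then show "part c \<noteq> 0" by (metis lookup_zero)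
    show "c - part c \<in> I"
      unfolding I_def
    proof (intro CollectI ballI)
      fix m assume "m \<in> Poly_Mapping.keys (c - part c)"
      then have "m \<in> Poly_Mapping.keys c" "wt m \<noteq> 0"
        by (auto simp: in_keys_iff lookup_minus lookup_part split: if_splits)
      then show "0 < wt m" using c(1) unfolding in_cone_algebra by fastforce
    qed
  qed
  have "part a * part b \<noteq> 0" using part(2)[OF a] part(2)[OF b] by simp
  then obtain m where m: "m \<in> Poly_Mapping.keys (part a * part b)"
    by (metis keys_eq_empty ex_in_conv)
  then obtain p q where "m = p + q" "p \<in> Poly_Mapping.keys (part a)" "q \<in> Poly_Mapping.keys (part b)"
    using keys_mult[of "part a" "part b"] by blast
  then have "wt m = 0"
    by (auto simp: in_keys_iff lookup_part wt_add split: if_splits)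
  \<comment> \<open>These two terms add up to \<open>a * b - part a * part b\<close>.\<close>
  have "part b * (a - part a) \<in> I" "a * (b - part b) \<in> I"
    using I_mult part a b by blast+
  from I_add[OF this] have "- 1 * (part b * (a - part a) + a * (b - part b)) \<in> I"
    by (rule I_mult) (simp add: cone_algebra_uminus)
  then have "a * b + (- 1 * (part b * (a - part a) + a * (b - part b))) \<in> I"
    using ab I_add by blast
  moreover have "a * b + (- 1 * (part b * (a - part a) + a * (b - part b))) = part a * part b"
    by (simp add: algebra_simps)
  ultimately have "part a * part b \<in> I" by simp
  then show False using m \<open>wt m = 0\<close> by (auto simp: I_def)
qed

lemma one_notin_I: "1 \<notin> I"
  by (auto simp: I_def wt_def)

lemma primeideal_I: "primeideal I (cone_ring \<rho>)"
proof (rule primeidealI)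
  show "ideal I (cone_ring \<rho>)"
    by (intro ideal_cone_ringI I_subset I_add I_mult) (auto simp: I_def)
  show "carrier (cone_ring \<rho>) \<noteq> I"
  proof -
    have "1 \<in> carrier (cone_ring \<rho>)" by (simp add: cone_ring_def)
    then show ?thesis using one_notin_I by blast
  qed
  fix a b assume "a \<in> carrier (cone_ring \<rho>)" "b \<in> carrier (cone_ring \<rho>)" "a \<otimes>\<^bsub>cone_ring \<rho>\<^esub> b \<in> I"
  then show "a \<in> I \<or> b \<in> I" using I_prime[of a b] by (auto simp: cone_ring_def)
qed (rule cring_cone_ring)

abbreviation R where "R \<equiv> prime_divisor \<rho>"

lemma R_eq: "R = local_ring \<rho> I"
proof -
  have "{a \<in> cone_algebra \<rho>. \<forall>m\<in>Poly_Mapping.keys a. 0 < char_vec m \<bullet> ray_gen \<rho>} = I"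
    using I_subset by (auto simp: I_def gen simp flip: of_int_wt)
  then show ?thesis by (simp add: prime_divisor_def)
qed

lemma R_in_chart: "R \<in> chart \<rho>"
  using primeideal_I by (auto simp: R_eq chart_def)

lemma of_laurent_in_R: "a \<in> cone_algebra \<rho> \<Longrightarrow> of_laurent a \<in> R"
  unfolding R_eq local_ring_def of_laurent_def using one_notin_I cone_algebra_1 by blast

lemma one_in_R: "1 \<in> R"
  using of_laurent_in_R[of 1] by simp

lemma mult_in_R:
  assumes "x \<in> R" "y \<in> R"
  shows "x * y \<in> R"
proof -
  obtain a b where ab: "x = Fract a b" "a \<in> cone_algebra \<rho>" "b \<in> cone_algebra \<rho>" "b \<notin> I"
    using assms(1) unfolding R_eq local_ring_def by blast
  obtain c d where cd: "y = Fract c d" "c \<in> cone_algebra \<rho>" "d \<in> cone_algebra \<rho>" "d \<notin> I"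
    using assms(2) unfolding R_eq local_ring_def by blast
  have "x * y = Fract (a * c) (b * d)" by (simp add: ab cd)
  then show ?thesis
    unfolding R_eq local_ring_def using I_prime[of b d] ab cd cone_algebra_mult by blast
qed

lemma of_laurent_in_units:
  assumes "b \<in> cone_algebra \<rho>" "b \<notin> I"
  shows "of_laurent b \<in> units_at R"
proof -
  have "b \<noteq> 0" using assms(2) by (auto simp: I_def)
  have "Fract 1 b \<in> R"
    unfolding R_eq local_ring_def using assms cone_algebra_1 by blast
  then show ?thesis
    using \<open>b \<noteq> 0\<close> assms of_laurent_in_R by (simp add: units_at_def of_laurent_def) (simp flip: of_laurent_def)
qed

text \<open>The order of vanishing along the divisor. For 0 it is the unspecified minimum of the
  empty set, hence the nonzero assumptions below.\<close>

definition vord :: "'n laurent \<Rightarrow> int" where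
  "vord a = Min (wt ` Poly_Mapping.keys a)"

lemma vord_le: "m \<in> Poly_Mapping.keys a \<Longrightarrow> vord a \<le> wt m"
  by (simp add: vord_def)

text \<open>Dividing by the power of \<open>chi e\<close> of this order moves the least weight to 0.
  All weights are then nonnegative and one is 0, so the result lies in the cone algebra and outside
  \<open>I\<close>.\<close>

lemma shifted_unit:
  assumes "a \<noteq> 0"
  shows "of_laurent a / chi (frag_cmul (vord a) e) \<in> units_at R"
proof -
  let ?k = "- frag_cmul (vord a) e"
  define b where "b = a * Poly_Mapping.single ?k 1"
  have keys_b: "Poly_Mapping.keys b = (\<lambda>m. m + ?k) ` Poly_Mapping.keys a"
    unfolding b_def by (rule keys_mult_single)
  have "b \<in> cone_algebra \<rho>"
    using vord_le[of _ a] unfolding in_cone_algebra keys_b by (simp add: wt_add wt_frag_cmul wt_e)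
  moreover have "vord a \<in> wt ` Poly_Mapping.keys a"
    unfolding vord_def using assms by (intro Min_in) auto
  then obtain m where "m \<in> Poly_Mapping.keys a" "wt m = vord a" by auto
  then have "m + ?k \<in> Poly_Mapping.keys b" "wt (m + ?k) = 0"
    by (simp_all add: keys_b wt_add wt_frag_cmul wt_e)
  then have "b \<notin> I" unfolding I_def by fastforce
  ultimately have "of_laurent b \<in> units_at R" by (rule of_laurent_in_units)
  moreover have "of_laurent b = of_laurent a / chi (frag_cmul (vord a) e)"
    unfolding b_def of_laurent_simps chi_def[symmetric] chi_uminus by (simp add: divide_inverse)
  ultimately show ?thesis by simp
qed

text \<open>A denominator outside \<open>I\<close> has an exponent of weight at most 0. Clearing it
  from the fraction shifts that weight by \<open>j\<close> into the support of the numerator, where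
  weights are nonnegative. This is what keeps \<open>chi e\<close> from being a unit.\<close>

lemma chi_in_R_imp_nonneg:
  assumes "chi (frag_cmul j e) \<in> R"
  shows "0 \<le> j"
proof -
  obtain a b where ab: "chi (frag_cmul j e) = Fract a b" "a \<in> cone_algebra \<rho>" "b \<in> cone_algebra \<rho>" "b \<notin> I"
    using assms unfolding R_eq local_ring_def by blast
  have "b \<noteq> 0" using ab(4) by (auto simp: I_def)
  then have "of_laurent a = of_laurent (b * Poly_Mapping.single (frag_cmul j e) 1)"
    using ab(1) unfolding Fract_of_laurent of_laurent_simps chi_def[symmetric] by (simp add: field_simps)
  then have "a = b * Poly_Mapping.single (frag_cmul j e) 1" by (simp only: of_laurent_simps(5))
  then have keys_a: "Poly_Mapping.keys a = (\<lambda>m. m + frag_cmul j e) ` Poly_Mapping.keys b"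
    by (simp only: keys_mult_single)
  obtain m where m: "m \<in> Poly_Mapping.keys b" "wt m \<le> 0"
    using ab(4) unfolding I_def by force
  have "0 \<le> wt (m + frag_cmul j e)"
    using ab(2) m(1) unfolding in_cone_algebra keys_a by blast
  then show ?thesis using m(2) by (simp add: wt_add wt_frag_cmul wt_e)
qed

text \<open>A nonunit has a numerator in \<open>I\<close>; its weights are positive integers, hence
  at least 1, so one factor \<open>chi e\<close> can be split off within the cone algebra.\<close>

lemma nonunits_R: "R - units_at R = (\<lambda>t. chi e * t) ` R"
proof (intro subset_antisym subsetI)
  fix x assume x: "x \<in> R - units_at R"
  then obtain a b where ab: "x = Fract a b" "a \<in> cone_algebra \<rho>" "b \<in> cone_algebra \<rho>" "b \<notin> I"
    unfolding R_eq local_ring_def by blast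
  have "b \<noteq> 0" using ab(4) by (auto simp: I_def)
  have "a \<in> I"
  proof (rule ccontr)
    assume "a \<notin> I"
    then have "of_laurent a * inverse (of_laurent b) \<in> units_at R"
      using ab of_laurent_in_units by (intro units_at_mult mult_in_R units_at_inverse)
    then show False using x by (simp add: ab(1) Fract_of_laurent divide_inverse)
  qed
  define c where "c = a * Poly_Mapping.single (- e) 1"
  have "c \<in> cone_algebra \<rho>"
    unfolding in_cone_algebra c_def keys_mult_single using \<open>a \<in> I\<close>
    by (fastforce simp: I_def wt_diff wt_e)
  then have "Fract c b \<in> R" unfolding R_eq local_ring_def using ab by blast
  moreover have "x = chi e * Fract c b"
    unfolding ab(1) Fract_of_laurent c_def of_laurent_simps chi_def[symmetric] chi_uminus by simp
  ultimately show "x \<in> (\<lambda>t. chi e * t) ` R" by blast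
next
  fix x assume "x \<in> (\<lambda>t. chi e * t) ` R"
  then obtain t where t: "t \<in> R" "x = chi e * t" by blast
  have "chi e \<in> R"
    unfolding chi_def by (rule of_laurent_in_R) (simp add: in_cone_algebra wt_e)
  then have "x \<in> R" unfolding t(2) by (rule mult_in_R[OF _ t(1)])
  moreover have "x \<notin> units_at R"
  proof
    assume "x \<in> units_at R"
    then have "inverse x \<in> R" "x \<noteq> 0" by (auto simp: units_at_def)
    have "chi (frag_cmul (- 1) e) = t * inverse x"
      unfolding chi_frag_cmul using t(2) \<open>x \<noteq> 0\<close> by simp
    also have "\<dots> \<in> R" by (rule mult_in_R[OF t(1) \<open>inverse x \<in> R\<close>])
    finally have "0 \<le> (- 1 :: int)" by (rule chi_in_R_imp_nonneg)
    then show False by simp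
  qed
  ultimately show "x \<in> R - units_at R" by blast
qed

lemma vanishing_order_of_laurent:
  assumes "a \<noteq> 0"
  shows "vanishing_order R (of_laurent a) = vord a"
proof (rule vanishing_order_eqI[OF one_in_R mult_in_R])
  show "R - units_at R = (\<lambda>t. chi e * t) ` R" by (rule nonunits_R)
  show "of_laurent a / chi e powi vord a \<in> units_at R"
    using shifted_unit[OF assms] by (simp add: chi_frag_cmul)
qed auto

text \<open>This converts regularity of a section times a local equation at the generic point of the
  divisor into an inequality between exponents. Both factors are units up to powers of
  \<open>chi e\<close>, so the question is reduced to a power of \<open>chi e\<close>.\<close>

lemma vord_sum_nonneg:
  assumes "a \<noteq> 0" "b \<noteq> 0" "of_laurent a * of_laurent b \<in> R"
  shows "0 \<le> vord a + vord b"
proof (rule chi_in_R_imp_nonneg)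
  have units: "of_laurent a / chi (frag_cmul (vord a) e) \<in> units_at R"
    "of_laurent b / chi (frag_cmul (vord b) e) \<in> units_at R"
    using shifted_unit assms by blast+
  have "chi (frag_cmul (vord a + vord b) e) = (of_laurent a * of_laurent b) *
      (inverse (of_laurent a / chi (frag_cmul (vord a) e)) * inverse (of_laurent b / chi (frag_cmul (vord b) e)))"
    using assms by (simp add: frag_cmul_distrib chi_add field_simps)
  also have "\<dots> \<in> R"
    using units unfolding units_at_def by (intro mult_in_R assms(3)) blast+
  finally show "chi (frag_cmul (vord a + vord b) e) \<in> R" .
qed

lemma vord_single: "c \<noteq> 0 \<Longrightarrow> vord (Poly_Mapping.single m c) = wt m"
  by (simp add: vord_def)

end

section \<open>Hyperplane arrangement complexes\<close>

text \<open>Finitely many strict inequalities survive a small step; this is the perturbation behind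
  all relative interior and general position arguments below.\<close>

lemma finite_small_multiple:
  fixes p q :: "'a \<Rightarrow> real"
  assumes "finite J" "\<And>j. j \<in> J \<Longrightarrow> 0 < p j"
  shows "\<exists>\<epsilon>>0. \<forall>j\<in>J. \<epsilon> * q j < p j"
  using assms
proof (induction J rule: finite_induct)
  case empty
  then show ?case by (auto intro: exI[of _ 1])
next
  case (insert j J)
  then obtain \<epsilon> where \<epsilon>: "0 < \<epsilon>" "\<forall>j\<in>J. \<epsilon> * q j < p j" by auto
  \<comment> \<open>Adding 1 to the absolute value avoids division by zero and makes the new
    inequality strict.\<close>
  define \<delta> where "\<delta> = min \<epsilon> (p j / (1 + \<bar>q j\<bar>))"
  have pj: "0 < p j" using insert.prems by simp
  have \<delta>: "0 < \<delta>" "\<delta> \<le> \<epsilon>" "\<delta> \<le> p j / (1 + \<bar>q j\<bar>)" using \<epsilon> pj by (auto simp: \<delta>_def)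
  have "\<delta> * q i < p i" if "i \<in> J" for i
  proof (cases "q i \<le> 0")
    case True
    then have "\<delta> * q i \<le> 0" using \<delta> by (simp add: mult_nonneg_nonpos)
    also have "0 < p i" using insert.prems that by simp
    finally show ?thesis .
  next
    case False
    then have "\<delta> * q i \<le> \<epsilon> * q i" using \<delta> by (simp add: mult_right_mono)
    also have "\<dots> < p i" using \<epsilon> that by blast
    finally show ?thesis .
  qed
  moreover have "\<delta> * q j < p j"
  proof -
    have "\<delta> * q j < \<delta> * (1 + \<bar>q j\<bar>)"
      using \<delta>(1) by (intro mult_strict_left_mono) auto
    also have "\<dots> \<le> p j" using \<delta>(3) by (simp add: field_simps)
    finally show ?thesis .
  qed
  ultimately show ?case using \<delta>(1) by auto
qed

definition chamber_signs :: "real mat \<Rightarrow> (nat \<Rightarrow> real) \<Rightarrow> bool" where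
  "chamber_signs L s \<longleftrightarrow> (\<forall>i. s i \<in> {1, -1}) \<and>
     (\<exists>x \<in> carrier_vec (dim_col L). \<forall>i<dim_row L.
        row L i \<noteq> 0\<^sub>v (dim_col L) \<longrightarrow> 0 < s i * scalar_prod (row L i) x)"

text \<open>A normal form for the faces of a chamber. Unlike the supporting functionals of
  \<open>cone_faces\<close>, it makes explicit which inequalities are tight, as the induction over
  the layers requires.\<close>

definition cell :: "real mat \<Rightarrow> (nat \<Rightarrow> real) \<Rightarrow> nat set \<Rightarrow> real Matrix.vec set" where
  "cell L s J = {x \<in> carrier_vec (dim_col L).
     (\<forall>i<dim_row L. 0 \<le> s i * scalar_prod (row L i) x) \<and>
     (\<forall>i<dim_row L. i \<in> J \<longrightarrow> scalar_prod (row L i) x = 0)}"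

lemma closed_chambers_eq: "closed_chambers L = {cell L s {} | s. chamber_signs L s}"
  by (simp add: closed_chambers_def cell_def chamber_signs_def)

text \<open>The sum \<open>c\<close> of the signed rows in \<open>J\<close> is nonnegative on the
  chamber, and as a sum of nonnegative terms it vanishes exactly where all of them do; so it exposes
  this face.\<close>

lemma cell_in_arrangement_complex:
  assumes s: "chamber_signs L s"
  shows "cell L s J \<in> arrangement_complex L"
proof -
  let ?J = "J \<inter> {..<dim_row L}"
  define c where "c = Matrix.vec (dim_col L) (\<lambda>l. \<Sum>j\<in>?J. s j * L $$ (j, l))"
  have c: "scalar_prod c x = (\<Sum>j\<in>?J. s j * scalar_prod (row L j) x)"
    if "x \<in> carrier_vec (dim_col L)" for x
  proof -
    have "scalar_prod c x = (\<Sum>l\<in>{0..<dim_col L}. \<Sum>j\<in>?J. s j * L $$ (j, l) * vec_index x l)"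
      using that by (simp add: scalar_prod_def c_def sum_distrib_right)
    also have "\<dots> = (\<Sum>j\<in>?J. \<Sum>l\<in>{0..<dim_col L}. s j * L $$ (j, l) * vec_index x l)"
      by (rule sum.swap)
    also have "\<dots> = (\<Sum>j\<in>?J. s j * scalar_prod (row L j) x)"
      using that by (intro sum.cong) (auto simp: scalar_prod_def sum_distrib_left mult.assoc)
    finally show ?thesis .
  qed
  have nonneg: "0 \<le> scalar_prod c x" if "x \<in> cell L s {}" for x
    using that by (subst c) (auto simp: cell_def intro!: sum_nonneg)
  have zero: "scalar_prod c x = 0 \<longleftrightarrow> (\<forall>j\<in>?J. scalar_prod (row L j) x = 0)" if "x \<in> cell L s {}" for x
  proof -
    have "s j \<noteq> 0" for j using s unfolding chamber_signs_def by (metis insertE neg_equal_0_iff_equal one_neq_zero singletonD)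
    moreover have "(\<Sum>j\<in>?J. s j * scalar_prod (row L j) x) = 0 \<longleftrightarrow>
        (\<forall>j\<in>?J. s j * scalar_prod (row L j) x = 0)"
      using that by (intro sum_nonneg_eq_0_iff) (auto simp: cell_def)
    ultimately show ?thesis using that c[of x] by (simp add: cell_def)
  qed
  have "cell L s J = {x \<in> cell L s {}. scalar_prod c x = 0}"
    using zero by (auto simp: cell_def)
  then have "cell L s J \<in> cone_faces (dim_col L) (cell L s {})"
    unfolding cone_faces_def using nonneg by (auto simp: c_def)
  then show ?thesis
    using s unfolding arrangement_complex_def closed_chambers_eq by blast
qed

text \<open>The tight rows \<open>J\<close> of a face \<open>Y\<close> already determine it. A point
  \<open>y\<close> of \<open>Y\<close> with the fewest tight rows lies in the relative interior. For
  \<open>x\<close> in the cell of \<open>J\<close>, subtracting a small multiple of \<open>x\<close>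
  from \<open>y\<close> stays in the chamber, and \<open>c\<close> vanishes at \<open>y\<close>, so
  \<open>c\<close> is at most 0 at \<open>x\<close>.\<close>

lemma arrangement_complex_cell:
  assumes "Y \<in> arrangement_complex L"
  obtains s J where "chamber_signs L s" "Y = cell L s J"
proof -
  obtain s where s: "chamber_signs L s" and "Y \<in> cone_faces (dim_col L) (cell L s {})"
    using assms unfolding arrangement_complex_def closed_chambers_eq by blast
  then obtain c where c: "c \<in> carrier_vec (dim_col L)" "\<And>x. x \<in> cell L s {} \<Longrightarrow> 0 \<le> scalar_prod c x"
    and Y: "Y = {x \<in> cell L s {}. scalar_prod c x = 0}"
    unfolding cone_faces_def by blast
  define J where "J = {j. j < dim_row L \<and> (\<forall>y\<in>Y. scalar_prod (row L j) y = 0)}"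
  have carr: "x \<in> carrier_vec (dim_col L)" if "x \<in> cell L s K" for x K
    using that by (simp add: cell_def)
  have sign: "0 \<le> s j * scalar_prod (row L j) x" if "x \<in> cell L s K" "j < dim_row L" for x K j
    using that by (simp add: cell_def)
  have s0: "s j \<noteq> 0" for j using s unfolding chamber_signs_def by (metis insertE neg_equal_0_iff_equal one_neq_zero singletonD)
  have row: "row L j \<in> carrier_vec (dim_col L)" if "j < dim_row L" for j
    using that by (simp add: row_carrier_vec)
  have Y_add: "x + y \<in> Y" if "x \<in> Y" "y \<in> Y" for x y
    using that c(1) unfolding Y cell_def
    by (auto simp: scalar_prod_add_distrib[OF row] scalar_prod_add_distrib[OF c(1)] distrib_left)
  define Z where "Z y = {j. j < dim_row L \<and> scalar_prod (row L j) y = 0}" for y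
  have "0\<^sub>v (dim_col L) \<in> Y" using c(1) by (simp add: Y cell_def)
  then obtain y where y: "y \<in> Y" "\<And>x. x \<in> Y \<Longrightarrow> card (Z y) \<le> card (Z x)"
    using ex_has_least_nat[of "\<lambda>y. y \<in> Y" _ "\<lambda>y. card (Z y)"] by blast
  have Zy: "Z y \<subseteq> J"
  proof
    fix j assume j: "j \<in> Z y"
    show "j \<in> J"
    proof (rule ccontr)
      assume "j \<notin> J"
      then obtain x where x: "x \<in> Y" "scalar_prod (row L j) x \<noteq> 0"
        using j by (auto simp: J_def Z_def)
      have add: "scalar_prod (row L i) (y + x) = scalar_prod (row L i) y + scalar_prod (row L i) x"
        if "i < dim_row L" for i
        using that x(1) y(1) by (intro scalar_prod_add_distrib[OF row]) (auto simp: Y carr)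
      \<comment> \<open>Both values have the same sign, so a row vanishing at the sum vanishes at
        each summand; adding \<open>x\<close> would reduce the number of tight rows below the
        minimum.\<close>
      have "Z (y + x) \<subseteq> Z y"
      proof
        fix i assume i: "i \<in> Z (y + x)"
        then have "0 \<le> s i * scalar_prod (row L i) y" "0 \<le> s i * scalar_prod (row L i) x"
          "s i * scalar_prod (row L i) y + s i * scalar_prod (row L i) x = 0"
          using sign x(1) y(1) add by (auto simp: Z_def Y simp flip: distrib_left)
        then have "s i * scalar_prod (row L i) y = 0" by linarith
        then show "i \<in> Z y" using i s0 by (simp add: Z_def)
      qed
      moreover have "j \<notin> Z (y + x)" using j x add by (auto simp: Z_def)
      ultimately have "Z (y + x) \<subset> Z y" using j by blast
      then have "card (Z (y + x)) < card (Z y)"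
        by (intro psubset_card_mono) (auto simp: Z_def)
      then show False using y(2)[OF Y_add[OF y(1) x(1)]] by simp
    qed
  qed
  have "x \<in> Y" if x: "x \<in> cell L s J" for x
  proof -
    have yc: "y \<in> cell L s {}" using y(1) by (simp add: Y)
    have "finite ({..<dim_row L} - Z y)" by simp
    moreover have "0 < s j * scalar_prod (row L j) y" if "j \<in> {..<dim_row L} - Z y" for j
      using sign[OF yc, of j] s0[of j] that by (auto simp: Z_def less_le)
    ultimately obtain \<epsilon> where \<epsilon>: "0 < \<epsilon>"
      "\<And>j. j \<in> {..<dim_row L} - Z y \<Longrightarrow> \<epsilon> * (s j * scalar_prod (row L j) x) < s j * scalar_prod (row L j) y"
      
          using finite_small_multiple[of "{..<dim_row L} - Z y" "\<lambda>j. s j * scalar_prod (row L j) y" "\<lambda>j. s j * scalar_prod (row L j) x"] by blast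
    define z where "z = y + (- \<epsilon>) \<cdot>\<^sub>v x"
    have z: "scalar_prod v z = scalar_prod v y - \<epsilon> * scalar_prod v x"
      if "v \<in> carrier_vec (dim_col L)" for v
      using that carr[OF yc] carr[OF x]
      by (simp add: z_def scalar_prod_add_distrib[of _ "dim_col L"])
    have "0 \<le> s j * scalar_prod (row L j) z" if j: "j < dim_row L" for j
    proof (cases "j \<in> Z y")
      case True
      then have "scalar_prod (row L j) x = 0" "scalar_prod (row L j) y = 0"
        using x Zy j by (auto simp: cell_def Z_def)
      then show ?thesis using z[OF row[OF j]] by simp
    next
      case False
      then have "0 < s j * scalar_prod (row L j) y - \<epsilon> * (s j * scalar_prod (row L j) x)"
        using \<epsilon>(2)[of j] j by simp
      also have "\<dots> = s j * scalar_prod (row L j) z"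
        by (simp add: z[OF row[OF j]] algebra_simps)
      finally show ?thesis by simp
    qed
    then have "z \<in> cell L s {}"
      using carr[OF yc] carr[OF x] by (simp add: cell_def z_def)
    then have "0 \<le> - \<epsilon> * scalar_prod c x"
      using c(2)[of z] z[OF c(1)] y(1) by (simp add: Y)
    then have "scalar_prod c x \<le> 0"
      using \<epsilon>(1) by (simp add: mult_le_0_iff)
    moreover have "x \<in> cell L s {}" using x by (simp add: cell_def)
    ultimately show "x \<in> Y" using c(2)[of x] by (simp add: Y)
  qed
  moreover have "x \<in> cell L s J" if "x \<in> Y" for x
    using that by (auto simp: J_def Y cell_def)
  ultimately have "Y = cell L s J" by blast
  then show ?thesis using s that by blast
qed

text \<open>A chamber needs a point off all hyperplanes, and \<open>v\<close> leaves open the signs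
  of the rows that vanish at it. They are taken from a generic \<open>x\<close>, and
  \<open>v\<close> moved slightly in the direction of \<open>x\<close> is the required
  point.\<close>

lemma arrangement_complex_covers:
  assumes v: "v \<in> carrier_vec (dim_col L)"
  shows "\<exists>Y\<in>arrangement_complex L. v \<in> Y"
proof -
  let ?n = "dim_col L"
  have row: "row L j \<in> carrier_vec ?n" if "j < dim_row L" for j
    using that by (simp add: row_carrier_vec)
  \<comment> \<open>Rows are treated one at a time: if the next row vanishes at the current point, a
    small step along that row itself makes it nonzero and keeps the earlier ones nonzero.\<close>
  have "\<exists>x\<in>carrier_vec ?n. \<forall>j<r. row L j \<noteq> 0\<^sub>v ?n \<longrightarrow> scalar_prod (row L j) x \<noteq> 0"
    if "r \<le> dim_row L" for r
    using that
  proof (induction r)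
    case 0
    then show ?case by (intro bexI[of _ "0\<^sub>v ?n"]) auto
  next
    case (Suc r)
    then obtain x where x: "x \<in> carrier_vec ?n"
      "\<And>j. j < r \<Longrightarrow> row L j \<noteq> 0\<^sub>v ?n \<Longrightarrow> scalar_prod (row L j) x \<noteq> 0" by auto
    show ?case
    proof (cases "row L r = 0\<^sub>v ?n \<or> scalar_prod (row L r) x \<noteq> 0")
      case True
      then show ?thesis using x by (auto simp: less_Suc_eq intro!: bexI[of _ x])
    next
      case False
      let ?w = "row L r"
      have w: "?w \<in> carrier_vec ?n" using Suc.prems row by simp
      have "scalar_prod ?w ?w \<noteq> 0"
      proof
        assume "scalar_prod ?w ?w = 0"
        then have "vec_index ?w l = 0" if "l < ?n" for l
          using that w by (auto simp: scalar_prod_def sum_nonneg_eq_0_iff)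
        then have "?w = 0\<^sub>v ?n" using w by (intro eq_vecI) auto
        then show False using False by simp
      qed
      define P where "P = {j. j < r \<and> row L j \<noteq> 0\<^sub>v ?n}"
      have "finite P" by (simp add: P_def)
      moreover have "0 < \<bar>scalar_prod (row L j) x\<bar>" if "j \<in> P" for j
        using that x(2) by (simp add: P_def)
      ultimately obtain \<epsilon> where \<epsilon>: "0 < \<epsilon>"
        "\<And>j. j \<in> P \<Longrightarrow> \<epsilon> * \<bar>scalar_prod (row L j) ?w\<bar> < \<bar>scalar_prod (row L j) x\<bar>"
        
          using finite_small_multiple[of "P" "\<lambda>j. \<bar>scalar_prod (row L j) x\<bar>" "\<lambda>j. \<bar>scalar_prod (row L j) ?w\<bar>"] by blast
      define z where "z = x + \<epsilon> \<cdot>\<^sub>v ?w"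
      have z: "scalar_prod (row L j) z = scalar_prod (row L j) x + \<epsilon> * scalar_prod (row L j) ?w"
        if "j < Suc r" for j
        using that Suc.prems x(1) w row[of j]
        by (simp add: z_def scalar_prod_add_distrib[of _ ?n])
      have "scalar_prod (row L j) z \<noteq> 0" if j: "j < Suc r" "row L j \<noteq> 0\<^sub>v ?n" for j
      proof (cases "j = r")
        case True
        then show ?thesis using z[of r] False \<epsilon>(1) \<open>scalar_prod ?w ?w \<noteq> 0\<close> by simp
      next
        case False
        then have "\<bar>\<epsilon> * scalar_prod (row L j) ?w\<bar> < \<bar>scalar_prod (row L j) x\<bar>"
          using \<epsilon>(1) \<epsilon>(2)[of j] j by (simp add: P_def abs_mult)
        then show ?thesis using z[OF j(1)] by linarith
      qed
      moreover have "z \<in> carrier_vec ?n" using x(1) w by (simp add: z_def)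
      ultimately show ?thesis by blast
    qed
  qed
  from this[OF order_refl] obtain x where x: "x \<in> carrier_vec ?n"
    "\<And>j. j < dim_row L \<Longrightarrow> row L j \<noteq> 0\<^sub>v ?n \<Longrightarrow> scalar_prod (row L j) x \<noteq> 0" by blast
  define s :: "nat \<Rightarrow> real" where "s j = (if scalar_prod (row L j) v > 0 then 1
    else if scalar_prod (row L j) v < 0 then -1
    else if scalar_prod (row L j) x > 0 then 1 else -1)" for j
  define P where "P = {j. j < dim_row L \<and> scalar_prod (row L j) v \<noteq> 0}"
  have "finite P" by (simp add: P_def)
  moreover have "0 < s j * scalar_prod (row L j) v" if "j \<in> P" for j
    using that by (auto simp: P_def s_def)
  ultimately obtain \<epsilon> where \<epsilon>: "0 < \<epsilon>"
    "\<And>j. j \<in> P \<Longrightarrow> \<epsilon> * (- (s j * scalar_prod (row L j) x)) < s j * scalar_prod (row L j) v"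
    
          using finite_small_multiple[of "P" "\<lambda>j. s j * scalar_prod (row L j) v" "\<lambda>j. - (s j * scalar_prod (row L j) x)"] by blast
  define z where "z = v + \<epsilon> \<cdot>\<^sub>v x"
  have "0 < s j * scalar_prod (row L j) z" if j: "j < dim_row L" "row L j \<noteq> 0\<^sub>v ?n" for j
  proof -
    have z: "scalar_prod (row L j) z = scalar_prod (row L j) v + \<epsilon> * scalar_prod (row L j) x"
      using v x(1) row[OF j(1)] by (simp add: z_def scalar_prod_add_distrib[of _ ?n])
    show ?thesis
    proof (cases "j \<in> P")
      case True
      then show ?thesis using \<epsilon>(2)[OF True] z by (simp add: algebra_simps)
    next
      case False
      then have v0: "scalar_prod (row L j) v = 0" using j by (simp add: P_def)
      have "0 < s j * scalar_prod (row L j) x"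
        using x(2)[OF j] by (auto simp: s_def v0)
      then have "0 < \<epsilon> * (s j * scalar_prod (row L j) x)"
        using \<epsilon>(1) by simp
      then show ?thesis using z v0 by (simp add: algebra_simps)
    qed
  qed
  moreover have "z \<in> carrier_vec ?n" using v x(1) by (simp add: z_def)
  moreover have "\<forall>j. s j \<in> {1, -1}" by (simp add: s_def)
  ultimately have "chamber_signs L s" unfolding chamber_signs_def by blast
  then have "cell L s {} \<in> arrangement_complex L" by (rule cell_in_arrangement_complex)
  moreover have "v \<in> cell L s {}" using v by (auto simp: cell_def s_def)
  ultimately show ?thesis by blast
qed

lemma finite_arrangement_complex: "finite (arrangement_complex L)"
proof -
  let ?S = "(\<Pi>\<^sub>E i\<in>{..<dim_row L}. {1, -1 :: real}) \<times> Pow {..<dim_row L}"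
  have "Y \<in> (\<lambda>(s, J). cell L s J) ` ?S" if "Y \<in> arrangement_complex L" for Y
  proof -
    obtain s J where s: "chamber_signs L s" and Y: "Y = cell L s J"
      using \<open>Y \<in> arrangement_complex L\<close> by (rule arrangement_complex_cell)
    have "restrict s {..<dim_row L} \<in> (\<Pi>\<^sub>E i\<in>{..<dim_row L}. {1, -1})"
      using s unfolding chamber_signs_def by (intro restrict_PiE_iff[THEN iffD2]) blast
    then show ?thesis
      by (intro image_eqI[of _ _ "(restrict s {..<dim_row L}, J \<inter> {..<dim_row L})"])
        (auto simp: Y cell_def)
  qed
  then have "arrangement_complex L \<subseteq> (\<lambda>(s, J). cell L s J) ` ?S" by blast
  moreover have "finite ?S" by (intro finite_cartesian_product finite_PiE) auto
  ultimately show ?thesis by (meson finite_imageI finite_subset)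
qed

section \<open>Linearity of the network on the cones of the ReLU fan\<close>

definition rational_vec :: "real ^ 'n \<Rightarrow> bool" where
  "rational_vec a \<longleftrightarrow> (\<forall>i. a $ i \<in> \<rat>)"

lemma rational_vec_scaleR: "c \<in> \<rat> \<Longrightarrow> rational_vec a \<Longrightarrow> rational_vec (c *\<^sub>R a)"
  by (simp add: rational_vec_def)

lemma rational_vec_uminus: "rational_vec a \<Longrightarrow> rational_vec (- a)"
  by (simp add: rational_vec_def)

lemma rational_vec_0: "rational_vec 0"
  by (simp add: rational_vec_def)

lemma rational_vec_sum: "(\<And>l. l \<in> X \<Longrightarrow> rational_vec (g l)) \<Longrightarrow> rational_vec (sum g X)"
  unfolding rational_vec_def sum_component by (intro allI Rats_sum) blast

definition dual_cone :: "(real ^ 'n) set \<Rightarrow> (real ^ 'n) set" where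
  "dual_cone A = {x. \<forall>a\<in>A. 0 \<le> a \<bullet> x}"

lemma dim_hidden:
  fixes x :: "real ^ 'n::{finite,linorder}"
  assumes "unbiased_network CARD('n) k Ls" "i \<le> k"
  shows "hidden Ls i x \<in> carrier_vec (dim_col (Ls ! i))"
  using assms(2)
proof (induction i)
  case 0
  have "dim_col (Ls ! 0) = CARD('n)" using assms(1) by (simp add: unbiased_network_def)
  then show ?case by (simp add: hidden_def coords_def)
next
  case (Suc i)
  then have "i < length Ls" "dim_col (Ls ! Suc i) = dim_row (Ls ! i)"
    using assms(1) by (auto simp: unbiased_network_def)
  then show ?case by (intro carrier_vecI) (simp add: hidden_Suc relu_layer_def)
qed

text \<open>
  \<open>A\<close> may be redundant, so a subset of it need not cut out a facet; the fan contains the subcones cut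
  out by all subsets.
\<close>
definition linear_on_cone :: "real mat list \<Rightarrow> nat \<Rightarrow> (real ^ 'n::{finite,linorder}) set \<Rightarrow>
    (real ^ 'n::{finite,linorder}) set \<Rightarrow> (nat \<Rightarrow> real ^ 'n::{finite,linorder}) \<Rightarrow> bool" where
  "linear_on_cone Ls i S A C \<longleftrightarrow> finite A \<and> (\<forall>a\<in>A. rational_vec a) \<and> S = dual_cone A \<and>
     (\<forall>B\<subseteq>A. {x \<in> S. \<forall>b\<in>B. b \<bullet> x = 0} \<in> relu_fan i Ls) \<and>
     (\<forall>j<dim_col (Ls ! i). rational_vec (C j)) \<and>
     (\<forall>x\<in>S. \<forall>j<dim_col (Ls ! i). vec_index (hidden Ls i x) j = C j \<bullet> x)"

text \<open>On a cone of the previous stage the pre-activations of the next layer are linear with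
  slopes \<open>R j\<close>, so a cell pulls back to linear inequalities and equations. The cell
  fixes the sign of each pre-activation, and hence the rectifier is linear on the new cone.\<close>

lemma relu_fan_linear_on_cone:
  fixes S :: "(real ^ 'n::{finite,linorder}) set"
  assumes net: "unbiased_network CARD('n) k Ls"
    and rat: "\<forall>L\<in>set Ls. elements_mat L \<subseteq> \<rat>"
    and "i \<le> k" "S \<in> relu_fan i Ls"
  shows "\<exists>A C. linear_on_cone Ls i S A C"
  using assms(3,4)
proof (induction i arbitrary: S)
  case 0
  let ?C = "\<lambda>j. axis (sorted_list_of_set (UNIV :: 'n set) ! j) (1 :: real)"
  have "vec_index (hidden Ls 0 x) j = ?C j \<bullet> x" if "j < dim_col (Ls ! 0)" for j and x :: "real ^ 'n::{finite,linorder}"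
    using that net by (simp add: hidden_def coords_def unbiased_network_def inner_axis')
  then have "linear_on_cone Ls 0 S {} ?C"
    using 0 by (auto simp: linear_on_cone_def dual_cone_def rational_vec_def axis_def)
  then show ?case by blast
next
  case (Suc i)
  define L where "L = Ls ! i"
  have i: "i < length Ls" "i \<le> k" using Suc.prems net by (auto simp: unbiased_network_def)
  obtain S0 Y where S: "S = S0 \<inter> {x. hidden Ls i x \<in> Y}" and S0: "S0 \<in> relu_fan i Ls"
    and Y: "Y \<in> arrangement_complex L"
    using Suc.prems(2) by (auto simp: L_def)
  obtain s J where s: "chamber_signs L s" and Y_cell: "Y = cell L s J"
    using Y by (rule arrangement_complex_cell)
  obtain A C where AC: "linear_on_cone Ls i S0 A C" using Suc.IH[OF i(2) S0] by blast
  have A: "finite A" "\<And>a. a \<in> A \<Longrightarrow> rational_vec a" "S0 = dual_cone A"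
    and faces: "\<And>B. B \<subseteq> A \<Longrightarrow> {x \<in> S0. \<forall>b\<in>B. b \<bullet> x = 0} \<in> relu_fan i Ls"
    and C: "\<And>j. j < dim_col L \<Longrightarrow> rational_vec (C j)"
      "\<And>x j. x \<in> S0 \<Longrightarrow> j < dim_col L \<Longrightarrow> vec_index (hidden Ls i x) j = C j \<bullet> x"
    using AC unfolding linear_on_cone_def L_def by blast+
  have dims: "dim_col (Ls ! Suc i) = dim_row L"
    using net Suc.prems(1) by (simp add: unbiased_network_def L_def)
  define R where "R j = (\<Sum>l<dim_col L. L $$ (j, l) *\<^sub>R C l)" for j
  have ent: "L $$ (j, l) \<in> \<rat>" if "j < dim_row L" "l < dim_col L" for j l
    using rat i(1) that unfolding L_def elements_mat_def by (force dest: nth_mem)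
  have ratR: "rational_vec (R j)" if "j < dim_row L" for j
    unfolding R_def using that C(1) ent by (intro rational_vec_sum rational_vec_scaleR) auto
  have hid: "hidden Ls i x \<in> carrier_vec (dim_col L)" for x :: "real ^ 'n::{finite,linorder}"
    unfolding L_def by (rule dim_hidden[OF net i(2)])
  have prod_R: "scalar_prod (row L j) (hidden Ls i x) = R j \<bullet> x" if "x \<in> S0" "j < dim_row L" for x j
  proof -
    have "scalar_prod (row L j) (hidden Ls i x) = (\<Sum>l<dim_col L. L $$ (j, l) * (C l \<bullet> x))"
      using hid[of x] C(2) that by (auto simp: scalar_prod_def lessThan_atLeast0 intro!: sum.cong)
    then show ?thesis by (simp add: R_def inner_sum_left)
  qed
  have in_cell: "hidden Ls i x \<in> cell L s K \<longleftrightarrow>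
      (\<forall>j<dim_row L. 0 \<le> s j * (R j \<bullet> x)) \<and> (\<forall>j<dim_row L. j \<in> K \<longrightarrow> R j \<bullet> x = 0)"
    if "x \<in> S0" for x K
    using hid prod_R[OF that] by (simp add: cell_def)
  have sgn: "s j = 1 \<or> s j = -1" for j using s by (simp add: chamber_signs_def)
  have ratS: "s j \<in> \<rat>" for j using sgn[of j] by auto
  \<comment> \<open>An equation for a row in \<open>J\<close> is entered as a pair of opposite
    inequalities, so that the new cone is again a dual cone.\<close>
  define A' where "A' = A \<union> (\<lambda>j. s j *\<^sub>R R j) ` {..<dim_row L} \<union>
    (\<lambda>j. - (s j *\<^sub>R R j)) ` (J \<inter> {..<dim_row L})"
  \<comment> \<open>With sign 1 the rectifier is the identity on the cone, with sign -1 it is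
    0.\<close>
  define C' where "C' j = (if s j = 1 then R j else 0)" for j
  have "finite A'" "\<forall>a\<in>A'. rational_vec a"
    using A(1,2) ratR ratS unfolding A'_def
    by (auto intro!: rational_vec_scaleR rational_vec_uminus)
  moreover have S_dual: "S = dual_cone A'"
  proof (intro Set.set_eqI)
    fix x
    have S0_iff: "x \<in> S0 \<longleftrightarrow> (\<forall>a\<in>A. 0 \<le> a \<bullet> x)"
      by (simp add: A(3) dual_cone_def)
    have "R j \<bullet> x = 0 \<longleftrightarrow> 0 \<le> - (s j * (R j \<bullet> x))" if "0 \<le> s j * (R j \<bullet> x)" for j
      using sgn[of j] that by auto
    then have "x \<in> S \<longleftrightarrow> x \<in> S0 \<and> (\<forall>j<dim_row L. 0 \<le> s j * (R j \<bullet> x)) \<and>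
        (\<forall>j<dim_row L. j \<in> J \<longrightarrow> 0 \<le> - (s j * (R j \<bullet> x)))"
      using in_cell[of x J] unfolding S Y_cell by blast
    then show "x \<in> S \<longleftrightarrow> x \<in> dual_cone A'"
      unfolding S0_iff dual_cone_def A'_def by (auto simp: ball_Un)
  qed
  moreover have "{x \<in> S. \<forall>b\<in>B. b \<bullet> x = 0} \<in> relu_fan (Suc i) Ls" if B: "B \<subseteq> A'" for B
  proof -
    \<comment> \<open>Tightening the inequalities in \<open>B\<close> splits into tightening old
      ones, handled by the induction hypothesis, and enlarging \<open>J\<close>. The negated rows
      come from \<open>J\<close> and are tight already.\<close>
    let ?J = "J \<union> {j. j < dim_row L \<and> s j *\<^sub>R R j \<in> B}"
    have s0: "s j \<noteq> 0" for j using sgn[of j] by auto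
    have eq: "{x \<in> S. \<forall>b\<in>B. b \<bullet> x = 0} = {x \<in> S0. \<forall>b\<in>B \<inter> A. b \<bullet> x = 0} \<inter> {x. hidden Ls i x \<in> cell L s ?J}"
    proof (intro Set.set_eqI iffI)
      fix x assume x: "x \<in> {x \<in> S. \<forall>b\<in>B. b \<bullet> x = 0}"
      then have x0: "x \<in> S0" "hidden Ls i x \<in> cell L s J" by (auto simp: S Y_cell)
      have "R j \<bullet> x = 0" if "s j *\<^sub>R R j \<in> B" for j
        using x that s0[of j] by fastforce
      then have "hidden Ls i x \<in> cell L s ?J"
        using x0(2) unfolding in_cell[OF x0(1)] by blast
      then show "x \<in> {x \<in> S0. \<forall>b\<in>B \<inter> A. b \<bullet> x = 0} \<inter> {x. hidden Ls i x \<in> cell L s ?J}"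
        using x x0 by blast
    next
      fix x assume x: "x \<in> {x \<in> S0. \<forall>b\<in>B \<inter> A. b \<bullet> x = 0} \<inter> {x. hidden Ls i x \<in> cell L s ?J}"
      then have x0: "x \<in> S0" and cell_J: "hidden Ls i x \<in> cell L s ?J" by blast+
      have cell: "\<forall>j<dim_row L. 0 \<le> s j * (R j \<bullet> x)" "\<forall>j<dim_row L. j \<in> ?J \<longrightarrow> R j \<bullet> x = 0"
        using cell_J unfolding in_cell[OF x0] by blast+
      then have "x \<in> S" unfolding S Y_cell using x0 in_cell[OF x0, of J] by blast
      moreover have "b \<bullet> x = 0" if b: "b \<in> B" for b
      proof -
        consider "b \<in> A" | j where "j < dim_row L" "b = s j *\<^sub>R R j"
          | j where "j < dim_row L" "j \<in> J" "b = - (s j *\<^sub>R R j)"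
          using subsetD[OF B b] unfolding A'_def by blast
        then show ?thesis
        proof cases
          case 1
          then show ?thesis using x b by blast
        next
          case (2 j)
          then have "R j \<bullet> x = 0" using cell(2) b by blast
          then show ?thesis by (simp add: 2)
        next
          case (3 j)
          then have "R j \<bullet> x = 0" using cell(2) by blast
          then show ?thesis by (simp add: 3)
        qed
      qed
      ultimately show "x \<in> {x \<in> S. \<forall>b\<in>B. b \<bullet> x = 0}" by blast
    qed
    moreover have "{x \<in> S0. \<forall>b\<in>B \<inter> A. b \<bullet> x = 0} \<in> relu_fan i Ls"
      by (rule faces) blast
    moreover have "cell L s ?J \<in> arrangement_complex (Ls ! i)"
      using cell_in_arrangement_complex[OF s] by (simp add: L_def)
    ultimately show ?thesis
      unfolding eq relu_fan.simps by (intro CollectI exI conjI refl)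
  qed
  moreover have "rational_vec (C' j)" if "j < dim_row L" for j
    using ratR[OF that] by (simp add: C'_def rational_vec_0)
  moreover have "vec_index (hidden Ls (Suc i) x) j = C' j \<bullet> x" if "x \<in> S" "j < dim_row L" for x j
  proof -
    have x: "x \<in> S0" "0 \<le> s j * (R j \<bullet> x)"
      using that in_cell[of x J] by (auto simp: S Y_cell)
    have "vec_index (hidden Ls (Suc i) x) j = max 0 (R j \<bullet> x)"
      using that prod_R[OF x(1)] i by (simp add: hidden_Suc relu_layer_def L_def)
    then show ?thesis using x(2) sgn[of j] by (auto simp: C'_def)
  qed
  ultimately have "linear_on_cone Ls (Suc i) S A' C'"
    unfolding linear_on_cone_def dims by blast
  then show ?case by blast
qed

lemma finite_relu_fan: "finite (relu_fan i Ls :: (real ^ 'n::{finite,linorder}) set set)"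
proof (induction i)
  case (Suc i)
  have "(relu_fan (Suc i) Ls :: (real ^ 'n::{finite,linorder}) set set) =
      (\<Union>S\<in>relu_fan i Ls. (\<lambda>Y. S \<inter> {x. hidden Ls i x \<in> Y}) ` arrangement_complex (Ls ! i))"
    unfolding relu_fan.simps by blast
  also have "finite \<dots>"
    by (intro finite_UN_I finite_imageI Suc finite_arrangement_complex)
  finally show ?case .
qed simp

lemma relu_fan_covers:
  fixes x :: "real ^ 'n::{finite,linorder}"
  assumes net: "unbiased_network CARD('n) k Ls" and "i \<le> k"
  shows "\<exists>S\<in>relu_fan i Ls. x \<in> S"
  using assms(2)
proof (induction i)
  case (Suc i)
  then have "i \<le> k" by simp
  then obtain S where S: "S \<in> relu_fan i Ls" "x \<in> S" using Suc.IH by blast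
  obtain Y where "Y \<in> arrangement_complex (Ls ! i)" "hidden Ls i x \<in> Y"
    using arrangement_complex_covers[OF dim_hidden[OF net \<open>i \<le> k\<close>]] by blast
  then show ?case
    unfolding relu_fan.simps using S by (intro bexI[of _ "S \<inter> {x. hidden Ls i x \<in> Y}"]) blast+
qed simp

lemma network_fun_linear_on_cone:
  fixes S :: "(real ^ 'n::{finite,linorder}) set"
  assumes net: "unbiased_network CARD('n) k Ls" and S: "linear_on_cone Ls k S A C"
  shows "\<exists>c. \<forall>x\<in>S. network_fun k Ls x = c \<bullet> x"
proof (intro exI ballI)
  fix x assume x: "x \<in> S"
  have "dim_row (Ls ! k) = 1" using net by (simp add: unbiased_network_def)
  moreover have "vec_index (hidden Ls k x) j = C j \<bullet> x" if "j < dim_col (Ls ! k)" for j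
    using S x that unfolding linear_on_cone_def by blast
  moreover have "dim_vec (hidden Ls k x) = dim_col (Ls ! k)"
    using dim_hidden[OF net order_refl, of x] by (rule carrier_vecD)
  ultimately show "network_fun k Ls x = (\<Sum>l<dim_col (Ls ! k). (Ls ! k) $$ (0, l) *\<^sub>R C l) \<bullet> x"
    by (simp add: network_fun_def scalar_prod_def inner_sum_left atLeast0LessThan)
qed

section \<open>Rays of pointed rational cones\<close>

text \<open>
  A vector of a pointed polyhedral cone that does not span the smallest face containing it is the
  sum of two vectors on which more of the inequalities are tight.
\<close>
lemma pointed_cone_induct:
  assumes "finite A" and pointed: "\<And>x. x \<in> dual_cone A \<Longrightarrow> - x \<in> dual_cone A \<Longrightarrow> x = 0"
    and zero: "P 0" and add: "\<And>x y. P x \<Longrightarrow> P y \<Longrightarrow> P (x + y)"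
    and scale: "\<And>t x. 0 \<le> t \<Longrightarrow> P x \<Longrightarrow> P (t *\<^sub>R x)"
    and ray: "\<And>B x. B \<subseteq> A \<Longrightarrow> dim {y \<in> dual_cone A. \<forall>b\<in>B. b \<bullet> y = 0} = 1 \<Longrightarrow>
      x \<in> dual_cone A \<Longrightarrow> \<forall>b\<in>B. b \<bullet> x = 0 \<Longrightarrow> P x"
    and "x \<in> dual_cone A"
  shows "P x"
  using \<open>x \<in> dual_cone A\<close>
proof (induction "card {a \<in> A. a \<bullet> x \<noteq> 0}" arbitrary: x rule: less_induct)
  case less
  define N where "N z = {a \<in> A. a \<bullet> z \<noteq> 0}" for z
  have finN: "finite (N z)" for z using assms(1) by (simp add: N_def)
  have ge0: "0 \<le> a \<bullet> z" if "z \<in> dual_cone A" "a \<in> A" for z a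
    using that by (simp add: dual_cone_def)
  have IH: "P z" if "z \<in> dual_cone A" "N z \<subset> N x" for z
    using less.hyps[of z] psubset_card_mono[OF finN that(2)] that(1) by (simp add: N_def)
  \<comment> \<open>Only 0 makes every inequality tight, because the cone is pointed.\<close>
  have N_nonempty: "N z \<noteq> {}" if "z \<in> dual_cone A" "z \<noteq> 0" for z
  proof
    assume "N z = {}"
    then have "- z \<in> dual_cone A" by (auto simp: N_def dual_cone_def)
    then show False using pointed that by blast
  qed
  let ?B = "{a \<in> A. a \<bullet> x = 0}"
  let ?F = "{y \<in> dual_cone A. \<forall>b\<in>?B. b \<bullet> y = 0}"
  show ?case
  proof (cases "x = 0")
    case False
    have xF: "x \<in> ?F" using less.prems by simp
    have pos: "0 < a \<bullet> x" if "a \<in> N x" for a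
      using that ge0[OF less.prems, of a] by (simp add: N_def less_le)
    show ?thesis
    proof (cases "?F \<subseteq> span {x}")
      case True
      have "dim ?F \<le> dim {x}" using True by (rule dim_mono)
      moreover have "dim {x} \<le> dim ?F" using xF by (intro dim_subset) blast
      ultimately have "dim ?F = 1" using False by (simp add: dim_singleton)
      then show ?thesis using ray[of ?B x] less.prems by blast
    next
      case not_ray: False
      then obtain y where y: "y \<in> dual_cone A" "\<And>b. b \<in> ?B \<Longrightarrow> b \<bullet> y = 0" "y \<notin> span {x}"
        by blast
      \<comment> \<open>The largest \<open>s\<close> for which \<open>y - s *\<^sub>R x\<close>
        stays in the cone; the inequality attaining the minimum becomes tight.\<close>
      define s where "s = Min ((\<lambda>a. (a \<bullet> y) / (a \<bullet> x)) ` N x)"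
      have "s \<in> (\<lambda>a. (a \<bullet> y) / (a \<bullet> x)) ` N x"
        unfolding s_def using finN N_nonempty[OF less.prems False] by (intro Min_in) auto
      then obtain a0 where a0: "a0 \<in> N x" "s = (a0 \<bullet> y) / (a0 \<bullet> x)" by blast
      have s_le: "s * (a \<bullet> x) \<le> a \<bullet> y" if "a \<in> N x" for a
      proof -
        have "s \<le> (a \<bullet> y) / (a \<bullet> x)" unfolding s_def using finN that by (intro Min_le) auto
        then show ?thesis using pos[OF that] by (simp add: field_simps)
      qed
      define y' where "y' = y - s *\<^sub>R x"
      have y'_tight: "a \<bullet> y' = 0" if "a \<in> A" "a \<notin> N x" for a
        using that y(2)[of a] by (simp add: N_def y'_def inner_diff_right)
      have y'_ge: "0 \<le> a \<bullet> y'" if "a \<in> N x" for a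
        using s_le[OF that] by (simp add: y'_def inner_diff_right)
      have "a0 \<bullet> y' = 0"
        using a0 pos[OF a0(1)] by (simp add: y'_def inner_diff_right)
      have y'_cone: "y' \<in> dual_cone A"
      proof -
        have "0 \<le> a \<bullet> y'" if "a \<in> A" for a
          using y'_tight[OF that] y'_ge[of a] by (cases "a \<in> N x") simp_all
        then show ?thesis by (simp add: dual_cone_def)
      qed
      have "N y' \<subset> N x"
      proof
        show "N y' \<subseteq> N x" using y'_tight by (auto simp: N_def)
        show "N y' \<noteq> N x" using a0(1) \<open>a0 \<bullet> y' = 0\<close> by (auto simp: N_def)
      qed
      then have Py': "P y'" using IH y'_cone by blast
      have "y' \<noteq> 0"
      proof
        assume "y' = 0"
        then have y_eq: "y = s *\<^sub>R x" by (simp add: y'_def)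
        have "y \<in> span {x}" unfolding y_eq by (intro span_scale span_base) simp
        then show False using y(3) by blast
      qed
      \<comment> \<open>The same move again, now subtracting from \<open>x\<close> as much of
        \<open>y'\<close> as the cone allows; \<open>x' + t *\<^sub>R y'\<close> is the desired
        splitting of \<open>x\<close>.\<close>
      define t where "t = Min ((\<lambda>a. (a \<bullet> x) / (a \<bullet> y')) ` N y')"
      have "t \<in> (\<lambda>a. (a \<bullet> x) / (a \<bullet> y')) ` N y'"
        unfolding t_def using finN N_nonempty[OF y'_cone \<open>y' \<noteq> 0\<close>] by (intro Min_in) auto
      then obtain a1 where a1: "a1 \<in> N y'" "t = (a1 \<bullet> x) / (a1 \<bullet> y')" by blast
      have pos': "0 < a \<bullet> y'" if "a \<in> N y'" for a
        using that ge0[OF y'_cone, of a] by (simp add: N_def less_le)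
      have "0 \<le> t"
        unfolding a1(2) using pos'[OF a1(1)] pos[of a1] a1(1) \<open>N y' \<subset> N x\<close>
        by (intro divide_nonneg_pos) (auto intro: less_imp_le)
      have t_le: "t * (a \<bullet> y') \<le> a \<bullet> x" if "a \<in> N y'" for a
      proof -
        have "t \<le> (a \<bullet> x) / (a \<bullet> y')" unfolding t_def using finN that by (intro Min_le) auto
        then show ?thesis using pos'[OF that] by (simp add: field_simps)
      qed
      define x' where "x' = x - t *\<^sub>R y'"
      have x'_out: "a \<bullet> x' = a \<bullet> x" if "a \<in> A" "a \<notin> N y'" for a
        using that by (simp add: N_def x'_def inner_diff_right)
      have x'_ge: "0 \<le> a \<bullet> x'" if "a \<in> A" for a
      proof (cases "a \<in> N y'")
        case True
        then show ?thesis using t_le by (simp add: x'_def inner_diff_right)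
      next
        case False
        then show ?thesis using x'_out[OF that] ge0[OF less.prems that] by simp
      qed
      have x'_cone: "x' \<in> dual_cone A" using x'_ge by (simp add: dual_cone_def)
      have "a1 \<bullet> x' = 0"
        using a1 pos'[OF a1(1)] by (simp add: x'_def inner_diff_right)
      have "N x' \<subset> N x"
      proof
        show "N x' \<subseteq> N x"
        proof
          fix a assume a: "a \<in> N x'"
          show "a \<in> N x"
          proof (cases "a \<in> N y'")
            case True
            then show ?thesis using \<open>N y' \<subset> N x\<close> by blast
          next
            case False
            then show ?thesis using a x'_out[of a] by (simp add: N_def)
          qed
        qed
        show "N x' \<noteq> N x" using a1(1) \<open>a1 \<bullet> x' = 0\<close> \<open>N y' \<subset> N x\<close> by (auto simp: N_def)
      qed
      then have "P x'" using IH x'_cone by blast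
      then have "P (x' + t *\<^sub>R y')" using Py' \<open>0 \<le> t\<close> add scale by blast
      then show ?thesis by (simp add: x'_def)
    qed
  qed (use zero in simp)
qed

text \<open>Since 1 is linearly independent over the rationals, the functional with value 1 there
  extends to all reals. Applied coordinatewise it turns a real solution of homogeneous rational
  equations into a rational one.\<close>

lemma rational_linear_retraction:
  obtains \<phi> :: "real \<Rightarrow> real" where "\<And>r s. \<phi> (r + s) = \<phi> r + \<phi> s"
    "\<And>q r. q \<in> \<rat> \<Longrightarrow> \<phi> (q * r) = q * \<phi> r" "\<phi> 1 = 1" "\<And>r. \<phi> r \<in> \<rat>"
proof -
  interpret R: vector_space "\<lambda>(q::rat) (r::real). of_rat q * r"
    by unfold_locales (auto simp: algebra_simps of_rat_add of_rat_mult)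
  interpret Q: vector_space "(*) :: rat \<Rightarrow> rat \<Rightarrow> rat"
    by unfold_locales (auto simp: algebra_simps)
  interpret RQ: vector_space_pair "\<lambda>(q::rat) (r::real). of_rat q * r" "(*) :: rat \<Rightarrow> rat \<Rightarrow> rat" ..
  have "\<not> R.dependent {1}" by (simp add: R.dependent_single)
  then obtain g where g: "Vector_Spaces.linear (\<lambda>(q::rat) (r::real). of_rat q * r) (*) g" "g 1 = 1"
    using RQ.linear_independent_extend[of "{1}" "\<lambda>_. 1"] by auto
  interpret g: Vector_Spaces.linear "\<lambda>(q::rat) (r::real). of_rat q * r" "(*)" g by (rule g(1))
  show ?thesis
  proof
    show "real_of_rat (g (r + s)) = real_of_rat (g r) + real_of_rat (g s)" for r s
      by (simp add: g.add of_rat_add)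
    show "real_of_rat (g (q * r)) = q * real_of_rat (g r)" if "q \<in> \<rat>" for q r
      using that by (elim Rats_cases) (simp add: g.scale of_rat_mult)
  qed (auto simp: g(2))
qed

text \<open>
  A coordinatewise rational-linear map preserves the rational equations that cut out the line, so a
  direction vector with a coordinate of absolute value one is fixed by such a map.
\<close>
lemma rational_direction:
  fixes x :: "real ^ 'n"
  assumes "\<And>a. a \<in> T \<Longrightarrow> rational_vec a" "\<And>a. a \<in> T \<Longrightarrow> a \<bullet> x = 0"
    and line: "\<And>y. (\<And>a. a \<in> T \<Longrightarrow> a \<bullet> y = 0) \<Longrightarrow> y \<in> span {x}"
    and i: "\<bar>x $ i\<bar> = 1"
  shows "rational_vec x"
proof -
  obtain \<phi> :: "real \<Rightarrow> real" where \<phi>: "\<And>r s. \<phi> (r + s) = \<phi> r + \<phi> s"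
    "\<And>q r. q \<in> \<rat> \<Longrightarrow> \<phi> (q * r) = q * \<phi> r" "\<phi> 1 = 1" "\<And>r. \<phi> r \<in> \<rat>"
    by (rule rational_linear_retraction) blast
  have \<phi>0: "\<phi> 0 = 0" using \<phi>(1)[of 0 0] by simp
  have \<phi>_sum: "\<phi> (sum h X) = (\<Sum>j\<in>X. \<phi> (h j))" for h :: "'n \<Rightarrow> real" and X
    by (induction X rule: infinite_finite_induct) (simp_all add: \<phi>0 \<phi>(1))
  define y :: "real ^ 'n" where "y = (\<chi> j. \<phi> (x $ j))"
  have "a \<bullet> y = 0" if a: "a \<in> T" for a
  proof -
    have "a \<bullet> y = (\<Sum>j\<in>UNIV. \<phi> (a $ j * x $ j))"
      using assms(1)[OF a] by (simp add: inner_vec_def y_def rational_vec_def \<phi>(2))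
    also have "\<dots> = \<phi> (a \<bullet> x)" by (simp add: \<phi>_sum inner_vec_def)
    finally show ?thesis using assms(2)[OF a] \<phi>0 by simp
  qed
  then obtain c where c: "y = c *\<^sub>R x" using line by (auto simp: span_singleton)
  have \<phi>_eq: "\<phi> (x $ j) = c * x $ j" for j
  proof -
    have "\<phi> (x $ j) = y $ j" by (simp add: y_def)
    then show ?thesis by (simp add: c)
  qed
  \<comment> \<open>The map fixes 1 and -1, so the normalized coordinate shows that the factor
    \<open>c\<close> is 1.\<close>
  have "x $ i = 1 \<or> x $ i = - 1" using i by linarith
  moreover have "\<phi> (- 1) = - 1" using \<phi>(2)[of "- 1" 1] \<phi>(3) by simp
  ultimately have "\<phi> (x $ i) = x $ i" using \<phi>(3) by (elim disjE) simp_all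
  then have "c * x $ i = 1 * x $ i" using \<phi>_eq[of i] by simp
  moreover have "x $ i \<noteq> 0" using i by (cases "x $ i = 0") simp_all
  ultimately have "c = 1" by simp
  show ?thesis
    unfolding rational_vec_def
  proof
    fix j
    show "x $ j \<in> \<rat>" using \<phi>(4)[of "x $ j"] \<phi>_eq[of j] \<open>c = 1\<close> by simp
  qed
qed

lemma ray_direction:
  fixes \<rho> :: "(real ^ 'n) set"
  assumes \<rho>: "\<rho> = dual_cone A" and "dim \<rho> = 1"
    and pointed: "\<And>x. x \<in> \<rho> \<Longrightarrow> - x \<in> \<rho> \<Longrightarrow> x = 0"
  obtains x where "x \<noteq> 0" "\<rho> = (\<lambda>t. t *\<^sub>R x) ` {0..}"
proof -
  have "\<not> \<rho> \<subseteq> {0}"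
    using \<open>dim \<rho> = 1\<close> by (metis dim_eq_0 zero_neq_one)
  then obtain x where x: "x \<in> \<rho>" "x \<noteq> 0" by blast
  have scale: "t *\<^sub>R y \<in> \<rho>" if "0 \<le> t" "y \<in> \<rho>" for t y
    using that by (simp add: \<rho> dual_cone_def)
  have "\<rho> \<subseteq> span {x}"
  proof (rule card_ge_dim_independent)
    show "{x} \<subseteq> \<rho>" using x(1) by blast
    show "independent {x}" using x(2) by (simp add: independent_insert)
    show "dim \<rho> \<le> card {x}" using \<open>dim \<rho> = 1\<close> by simp
  qed
  have "y \<in> (\<lambda>t. t *\<^sub>R x) ` {0..}" if y: "y \<in> \<rho>" for y
  proof -
    obtain t where t: "y = t *\<^sub>R x"
      using subsetD[OF \<open>\<rho> \<subseteq> span {x}\<close> y] unfolding span_singleton by blast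
    have "0 \<le> t"
    proof (rule ccontr)
      assume "\<not> 0 \<le> t"
      then have "(1 / (- t)) *\<^sub>R y \<in> \<rho>" by (intro scale y) simp
      moreover have "(1 / (- t)) *\<^sub>R y = - x" using \<open>\<not> 0 \<le> t\<close> by (simp add: t)
      ultimately show False using pointed[OF x(1)] x(2) by simp
    qed
    then show ?thesis using t by blast
  qed
  moreover have "y \<in> \<rho>" if "y \<in> (\<lambda>t. t *\<^sub>R x) ` {0..}" for y
    using that scale x(1) by auto
  ultimately show ?thesis using x(2) that by blast
qed

text \<open>Inequalities that are strict at \<open>x\<close> remain so nearby; the tight ones alone
  therefore cut out the line through \<open>x\<close>. They are rational, which makes
  \<open>x\<close> rational once a coordinate is normalized to absolute value 1.\<close>

lemma ray_rational_direction:
  fixes \<rho> :: "(real ^ 'n) set"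
  assumes \<rho>: "\<rho> = dual_cone A" "finite A" "\<And>a. a \<in> A \<Longrightarrow> rational_vec a" and "dim \<rho> = 1"
    and pointed: "\<And>x. x \<in> \<rho> \<Longrightarrow> - x \<in> \<rho> \<Longrightarrow> x = 0"
  obtains x i where "rational_vec x" "\<bar>x $ i\<bar> = 1" "\<rho> = (\<lambda>t. t *\<^sub>R x) ` {0..}"
proof -
  obtain x0 where x0: "x0 \<noteq> 0" "\<rho> = (\<lambda>t. t *\<^sub>R x0) ` {0..}"
    using ray_direction[OF \<rho>(1) \<open>dim \<rho> = 1\<close> pointed] by blast
  obtain i where i: "x0 $ i \<noteq> 0" using x0(1) by (auto simp: Finite_Cartesian_Product.vec_eq_iff)
  define x where "x = (1 / \<bar>x0 $ i\<bar>) *\<^sub>R x0"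
  have xi: "\<bar>x $ i\<bar> = 1" using i by (simp add: x_def abs_mult)
  have \<rho>_x: "\<rho> = (\<lambda>t. t *\<^sub>R x) ` {0..}"
  proof (intro subset_antisym subsetI)
    fix y assume "y \<in> \<rho>"
    then obtain t where "0 \<le> t" "y = t *\<^sub>R x0" using x0(2) by auto
    then have "y = (t * \<bar>x0 $ i\<bar>) *\<^sub>R x" "0 \<le> t * \<bar>x0 $ i\<bar>" using i by (auto simp: x_def)
    then show "y \<in> (\<lambda>t. t *\<^sub>R x) ` {0..}" by auto
  next
    fix y assume "y \<in> (\<lambda>t. t *\<^sub>R x) ` {0..}"
    then obtain t where "0 \<le> t" "y = t *\<^sub>R x" by auto
    then have "y = (t / \<bar>x0 $ i\<bar>) *\<^sub>R x0" "0 \<le> t / \<bar>x0 $ i\<bar>" by (auto simp: x_def)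
    then show "y \<in> \<rho>" using x0(2) by auto
  qed
  have x: "x \<in> \<rho>" unfolding \<rho>_x by (rule image_eqI[of _ _ 1]) auto
  have span: "\<rho> \<subseteq> span {x}" unfolding \<rho>_x by (auto intro: span_scale span_base)
  let ?T = "{a \<in> A. a \<bullet> x = 0}"
  have line: "y \<in> span {x}" if y: "\<And>a. a \<in> ?T \<Longrightarrow> a \<bullet> y = 0" for y
  proof -
    have pos: "0 < a \<bullet> x" if "a \<in> A - ?T" for a
      using x that by (auto simp: \<rho>(1) dual_cone_def less_le)
    obtain \<epsilon> where \<epsilon>: "0 < \<epsilon>" "\<forall>a\<in>A - ?T. \<epsilon> * (- (a \<bullet> y)) < a \<bullet> x"
      using finite_small_multiple[of "A - ?T" "\<lambda>a. a \<bullet> x" "\<lambda>a. - (a \<bullet> y)"] \<rho>(2) pos by blast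
    have "0 \<le> a \<bullet> (x + \<epsilon> *\<^sub>R y)" if a: "a \<in> A" for a
    proof (cases "a \<in> ?T")
      case True
      then show ?thesis using y by (simp add: inner_add_right)
    next
      case False
      then show ?thesis using \<epsilon>(2) a by (auto simp: inner_add_right less_imp_le dest!: bspec)
    qed
    then have "x + \<epsilon> *\<^sub>R y \<in> \<rho>" by (simp add: \<rho>(1) dual_cone_def)
    then have "x + \<epsilon> *\<^sub>R y \<in> span {x}" using span by blast
    from span_diff[OF this span_base[of x]] have "\<epsilon> *\<^sub>R y \<in> span {x}" by simp
    from span_scale[OF this, of "1 / \<epsilon>"] show ?thesis using \<epsilon>(1) by simp
  qed
  have "rational_vec x"
  proof (rule rational_direction[where T = ?T and i = i])
    show "rational_vec a" if "a \<in> ?T" for a using that \<rho>(3) by blast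
    show "y \<in> span {x}" if "\<And>a. a \<in> ?T \<Longrightarrow> a \<bullet> y = 0" for y using that by (rule line)
  qed (use xi in auto)
  then show ?thesis using that xi \<rho>_x by blast
qed

section \<open>Primitive generators and dual characters\<close>

lemma rational_vec_multiple_in_lattice:
  fixes x :: "real ^ 'n"
  assumes "rational_vec x"
  obtains N :: nat where "0 < N" "real N *\<^sub>R x \<in> lattice"
proof -
  have "\<exists>q::nat. 0 < q \<and> real q * x $ i \<in> \<int>" for i
  proof -
    obtain a b :: int where "0 < b" "x $ i = of_int a / of_int b"
      using assms unfolding rational_vec_def by (metis Rats_cases')
    then have "0 < nat b" "real (nat b) * x $ i = of_int a" by simp_all
    then show ?thesis by (metis Ints_of_int)
  qed
  then obtain q :: "'n \<Rightarrow> nat" where q: "\<And>i. 0 < q i" "\<And>i. real (q i) * x $ i \<in> \<int>" by metis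
  show ?thesis
  proof
    show "0 < prod q UNIV" using q(1) by (simp add: prod_pos)
    have "real (prod q UNIV) * x $ i \<in> \<int>" for i
    proof -
      have "real (prod q UNIV) * x $ i = real (prod q (UNIV - {i})) * (real (q i) * x $ i)"
        by (subst prod.remove[of UNIV i]) auto
      then show ?thesis by (simp only: Ints_mult Ints_of_nat q(2))
    qed
    then show "real (prod q UNIV) *\<^sub>R x \<in> lattice" by (simp add: lattice_def)
  qed
qed

lemma lattice_scale: "u \<in> lattice \<Longrightarrow> c \<in> \<int> \<Longrightarrow> c *\<^sub>R u \<in> lattice"
  by (simp add: lattice_def)

lemma lattice_diff: "u \<in> lattice \<Longrightarrow> v \<in> lattice \<Longrightarrow> u - v \<in> lattice"
  by (simp add: lattice_def)

text \<open>Since \<open>x $ i\<close> is 1 or -1, each lattice point of the ray is an integral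
  multiple of \<open>x\<close>. The least positive multiple in the lattice generates the others by
  division with remainder.\<close>

lemma ray_primitive_generator:
  fixes \<rho> :: "(real ^ 'n) set"
  assumes \<rho>: "\<rho> = dual_cone A" "finite A" "\<And>a. a \<in> A \<Longrightarrow> rational_vec a" and "dim \<rho> = 1"
    and pointed: "\<And>x. x \<in> \<rho> \<Longrightarrow> - x \<in> \<rho> \<Longrightarrow> x = 0"
  obtains u where "u \<noteq> 0" "u \<in> lattice" "\<rho> = (\<lambda>t. t *\<^sub>R u) ` {0..}"
    "\<rho> \<inter> lattice = range (\<lambda>j::nat. real j *\<^sub>R u)"
proof -
  obtain x i where x: "rational_vec x" "\<bar>x $ i\<bar> = 1" "\<rho> = (\<lambda>t. t *\<^sub>R x) ` {0..}"
    using ray_rational_direction[OF \<rho> \<open>dim \<rho> = 1\<close> pointed] by blast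
  let ?P = "\<lambda>n::nat. 0 < n \<and> real n *\<^sub>R x \<in> lattice"
  define n where "n = (LEAST n. ?P n)"
  have "\<exists>n. ?P n" using rational_vec_multiple_in_lattice[OF x(1)] by metis
  then have n: "0 < n" "real n *\<^sub>R x \<in> lattice" unfolding n_def by (metis (mono_tags, lifting) LeastI)+
  have least: "n \<le> m" if "?P m" for m unfolding n_def using that by (rule Least_le)
  define u where "u = real n *\<^sub>R x"
  have "x $ i \<noteq> 0" using x(2) by (cases "x $ i = 0") simp_all
  then have "x \<noteq> 0" by (cases "x = 0") simp_all
  show ?thesis
  proof
    show "u \<noteq> 0" using n(1) \<open>x \<noteq> 0\<close> by (simp add: u_def)
    show "u \<in> lattice" using n(2) by (simp add: u_def)
    show \<rho>_u: "\<rho> = (\<lambda>t. t *\<^sub>R u) ` {0..}"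
    proof (intro subset_antisym subsetI)
      fix y assume "y \<in> \<rho>"
      then obtain t where "0 \<le> t" "y = t *\<^sub>R x" using x(3) by auto
      then have "y = (t / real n) *\<^sub>R u" "0 \<le> t / real n" using n(1) by (auto simp: u_def)
      then show "y \<in> (\<lambda>t. t *\<^sub>R u) ` {0..}" by auto
    next
      fix y assume "y \<in> (\<lambda>t. t *\<^sub>R u) ` {0..}"
      then obtain t where "0 \<le> t" "y = t *\<^sub>R u" by auto
      then have "y = (t * real n) *\<^sub>R x" "0 \<le> t * real n" by (auto simp: u_def)
      then show "y \<in> \<rho>" using x(3) by auto
    qed
    show "\<rho> \<inter> lattice = range (\<lambda>j::nat. real j *\<^sub>R u)"
    proof (intro subset_antisym subsetI)
      fix v assume v: "v \<in> \<rho> \<inter> lattice"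
      then obtain t where t: "0 \<le> t" "v = t *\<^sub>R x" using x(3) by auto
      have "t * x $ i \<in> \<int>" using v t(2) by (simp add: lattice_def)
      moreover have "x $ i = 1 \<or> x $ i = -1" using x(2) by linarith
      ultimately have "t \<in> \<int>" by auto
      then obtain c :: int where "t = of_int c" by (elim Ints_cases)
      then have m: "t = real (nat c)" using t(1) by simp
      define m where "m = nat c"
      note m = m[folded m_def]
      have "real (m mod n) *\<^sub>R x = v - real (m div n) *\<^sub>R u"
      proof -
        have "real m = real (m div n) * real n + real (m mod n)"
          by (metis div_mult_mod_eq of_nat_add of_nat_mult)
        then show ?thesis by (simp add: t(2) m u_def scaleR_add_left)
      qed
      also have "\<dots> \<in> lattice"
        using v n(2) by (intro lattice_diff lattice_scale) (auto simp: u_def)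
      finally have lat: "real (m mod n) *\<^sub>R x \<in> lattice" .
      have "m mod n = 0"
      proof (rule ccontr)
        assume "m mod n \<noteq> 0"
        then have "n \<le> m mod n" using lat by (intro least) simp
        then show False using mod_less_divisor[OF n(1), of m] by linarith
      qed
      then have "m = m div n * n" by (metis add.right_neutral div_mult_mod_eq)
      then have "v = real (m div n) *\<^sub>R u"
        unfolding t(2) m u_def by (metis of_nat_mult scaleR_scaleR)
      then show "v \<in> range (\<lambda>j::nat. real j *\<^sub>R u)" by blast
    next
      fix v assume "v \<in> range (\<lambda>j::nat. real j *\<^sub>R u)"
      then obtain j :: nat where v: "v = real j *\<^sub>R u" by blast
      have "v \<in> \<rho>" unfolding v \<rho>_u by (rule image_eqI[of _ _ "real j"]) auto
      moreover have "v \<in> lattice" unfolding v using n(2) by (intro lattice_scale) (auto simp: u_def)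
      ultimately show "v \<in> \<rho> \<inter> lattice" by blast
    qed
  qed
qed

text \<open>Two generators are natural multiples of each other; as \<open>u\<close> is nonzero, the
  product of the two factors is 1.\<close>

lemma ray_gen_eq:
  assumes "\<rho> \<inter> lattice = range (\<lambda>j::nat. real j *\<^sub>R u)" "u \<noteq> 0"
  shows "ray_gen \<rho> = u"
  unfolding ray_gen_def
proof (rule the_equality)
  fix v assume "\<rho> \<inter> lattice = range (\<lambda>j::nat. real j *\<^sub>R v)"
  then have eq: "range (\<lambda>j::nat. real j *\<^sub>R v) = range (\<lambda>j::nat. real j *\<^sub>R u)" using assms(1) by simp
  have "v \<in> range (\<lambda>j::nat. real j *\<^sub>R v)" by (rule range_eqI[of _ _ 1]) simp
  then obtain j :: nat where j: "v = real j *\<^sub>R u" unfolding eq by blast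
  have "u \<in> range (\<lambda>j::nat. real j *\<^sub>R u)" by (rule range_eqI[of _ _ 1]) simp
  then obtain k :: nat where k: "u = real k *\<^sub>R v" unfolding eq[symmetric] by blast
  have "u = (real k * real j) *\<^sub>R u" using j k by (metis scaleR_scaleR)
  then have "(1 - real k * real j) *\<^sub>R u = 0" by (simp add: scaleR_diff_left)
  then have "real (k * j) = real 1" using assms(2) by simp
  then have "k * j = 1" by (simp only: of_nat_eq_iff)
  then show "v = u" using j by simp
qed (rule assms(1))

text \<open>Bezout for the coordinates of \<open>u\<close>: the least positive value
  \<open>d\<close> of the pairing divides every coordinate, since a remainder would be a smaller
  value. Then \<open>u\<close> divided by \<open>d\<close> is a lattice vector, and primitivity
  gives \<open>d = 1\<close>.\<close>

lemma primitive_dual_character: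
  fixes u :: "real ^ 'n::{finite,linorder}"
  assumes u: "u \<noteq> 0" "u \<in> lattice"
    and primitive: "\<And>d::int. 0 < d \<Longrightarrow> (1 / of_int d) *\<^sub>R u \<in> lattice \<Longrightarrow> d = 1"
  obtains e where "char_vec e \<bullet> u = 1"
proof -
  define w where "w e = (\<Sum>i\<in>UNIV. Poly_Mapping.lookup e i * \<lfloor>u $ i\<rfloor>)" for e :: "'n \<Rightarrow>\<^sub>0 int"
  have floor: "of_int \<lfloor>u $ i\<rfloor> = u $ i" for i
    using u(2) by (simp add: lattice_def)
  have w: "real_of_int (w e) = char_vec e \<bullet> u" for e
    by (simp only: w_def char_vec_def inner_vec_def of_int_sum of_int_mult floor vec_lambda_beta inner_real_def)
  have w_diff: "w (a - b) = w a - w b" for a b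
    by (simp add: w_def lookup_minus left_diff_distrib sum_subtractf)
  have w_cmul: "w (frag_cmul c a) = c * w a" for c a
    by (simp add: w_def sum_distrib_left mult.assoc)
  have w_single: "w (Poly_Mapping.single i c) = c * \<lfloor>u $ i\<rfloor>" for i c
  proof -
    have "w (Poly_Mapping.single i c) = (\<Sum>j\<in>UNIV. if j = i then c * \<lfloor>u $ j\<rfloor> else 0)"
      unfolding w_def by (intro sum.cong refl) (auto simp: lookup_single when_def)
    then show ?thesis by simp
  qed
  let ?P = "\<lambda>d::nat. 0 < d \<and> (\<exists>e. w e = int d)"
  obtain i where i: "u $ i \<noteq> 0" using u(1) by (auto simp: Finite_Cartesian_Product.vec_eq_iff)
  then have "\<lfloor>u $ i\<rfloor> \<noteq> 0" using floor[of i] by (metis of_int_0)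
  moreover have "w (Poly_Mapping.single i (sgn \<lfloor>u $ i\<rfloor>)) = \<bar>\<lfloor>u $ i\<rfloor>\<bar>"
    by (simp add: w_single abs_sgn mult.commute)
  ultimately have ex: "?P (nat \<bar>\<lfloor>u $ i\<rfloor>\<bar>)" by auto
  define d where "d = (LEAST d. ?P d)"
  have d: "?P d" unfolding d_def using ex by (rule LeastI)
  have least: "d \<le> m" if "?P m" for m unfolding d_def using that by (rule Least_le)
  obtain e where e: "w e = int d" using d by blast
  have dvd: "int d dvd \<lfloor>u $ i\<rfloor>" for i
  proof (rule ccontr)
    assume nd: "\<not> int d dvd \<lfloor>u $ i\<rfloor>"
    let ?r = "\<lfloor>u $ i\<rfloor> mod int d"
    have "w (Poly_Mapping.single i 1 - frag_cmul (\<lfloor>u $ i\<rfloor> div int d) e) = ?r"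
      by (simp add: w_diff w_cmul w_single e minus_div_mult_eq_mod)
    moreover have r: "0 < ?r" "?r < int d"
    proof -
      have "?r \<noteq> 0" using nd by (metis mod_eq_0_iff_dvd)
      moreover have "0 \<le> ?r" using d by (intro pos_mod_sign) simp
      ultimately show "0 < ?r" by simp
      show "?r < int d" using d by (intro pos_mod_bound) simp
    qed
    ultimately have "?P (nat ?r)" by (metis int_nat_eq less_imp_le zero_less_nat_eq)
    then have "d \<le> nat ?r" by (rule least)
    then show False using r by simp
  qed
  have "(1 / of_int (int d)) *\<^sub>R u \<in> lattice"
  proof -
    have "(1 / of_int (int d)) * u $ i \<in> \<int>" for i
    proof -
      obtain c where "\<lfloor>u $ i\<rfloor> = int d * c" using dvd[of i] by (elim dvdE)
      then have "u $ i = of_int (int d) * of_int c" using floor[of i] by (metis of_int_mult)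
      then show ?thesis using d by simp
    qed
    then show ?thesis by (simp add: lattice_def)
  qed
  then have "int d = 1" using primitive[of "int d"] d by simp
  then have "char_vec e \<bullet> u = 1" using w[of e] e by simp
  then show ?thesis using that by blast
qed

section \<open>Tropical polynomials and Newton polytopes\<close>

lemma tropical_polynomial_convex:
  fixes f :: "real ^ 'n \<Rightarrow> real"
  assumes "tropical_polynomial f"
  shows "convex_on UNIV f"
proof -
  obtain r :: nat and c u where r: "1 \<le> r" and f: "\<And>x. f x = Max ((\<lambda>i. c i + u i \<bullet> x) ` {1..r})"
    using assms unfolding tropical_polynomial_def tropical_expression_def by blast
  have ge: "c i + u i \<bullet> x \<le> f x" if "i \<in> {1..r}" for i x
    unfolding f using that by (intro Max_ge) auto
  show ?thesis
  proof (rule convex_onI)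
    fix t :: real and x y :: "real ^ 'n"
    assume t: "0 < t" "t < 1"
    let ?z = "(1 - t) *\<^sub>R x + t *\<^sub>R y"
    have "f ?z \<in> (\<lambda>i. c i + u i \<bullet> ?z) ` {1..r}"
      unfolding f[of ?z] using r by (intro Max_in) auto
    then obtain i where i: "i \<in> {1..r}" "f ?z = c i + u i \<bullet> ?z" by blast
    have "f ?z = (1 - t) * (c i + u i \<bullet> x) + t * (c i + u i \<bullet> y)"
      unfolding i(2) by (simp add: inner_add_right algebra_simps)
    also have "\<dots> \<le> (1 - t) * f x + t * f y"
      using t ge[OF i(1)] by (intro add_mono mult_left_mono) auto
    finally show "f ?z \<le> (1 - t) * f x + t * f y" .
  qed simp
qed

text \<open>A slope above \<open>f x\<close> at \<open>x\<close> would push its term above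
  \<open>f\<close> at far multiples of \<open>x\<close>, whatever the constant
  \<open>c i\<close>.\<close>

lemma tropical_expression_slope_le:
  assumes "tropical_expression f r c u" and hom: "\<And>t x. 0 \<le> t \<Longrightarrow> f (t *\<^sub>R x) = t * f x"
    and i: "i \<in> {1..r}"
  shows "u i \<bullet> x \<le> f x"
proof (rule ccontr)
  assume "\<not> u i \<bullet> x \<le> f x"
  then have d: "0 < u i \<bullet> x - f x" by simp
  have le: "c i + t * (u i \<bullet> x) \<le> t * f x" if "0 \<le> t" for t
  proof -
    have "c i + u i \<bullet> (t *\<^sub>R x) \<le> f (t *\<^sub>R x)"
      using assms(1) i unfolding tropical_expression_def by simp
    then show ?thesis using hom[OF that] by simp
  qed
  \<comment> \<open>Far enough for the gap to reach \<open>\<bar>c i\<bar> + 1\<close>, which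
    outweighs \<open>c i\<close>.\<close>
  define t where "t = (\<bar>c i\<bar> + 1) / (u i \<bullet> x - f x)"
  have "0 \<le> t" using d by (simp add: t_def)
  moreover have "t * (u i \<bullet> x - f x) = \<bar>c i\<bar> + 1" using d by (simp add: t_def)
  ultimately show False using le[of t] by (simp add: algebra_simps)
qed

text \<open>If every slope were below \<open>f x\<close> at \<open>x\<close>, then far out on the
  ray through \<open>x\<close> no term of the maximum could reach \<open>f\<close>, whatever its
  constant.\<close>

lemma tropical_expression_attained:
  assumes "tropical_expression f r c u" and hom: "\<And>t x. 0 \<le> t \<Longrightarrow> f (t *\<^sub>R x) = t * f x"
  shows "\<exists>i\<in>{1..r}. f x \<le> u i \<bullet> x"
proof (rule ccontr)
  assume "\<not> (\<exists>i\<in>{1..r}. f x \<le> u i \<bullet> x)"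
  then have d: "0 < f x - u i \<bullet> x" if "i \<in> {1..r}" for i using that by force
  have r: "1 \<le> r" using assms(1) by (simp add: tropical_expression_def)
  obtain \<epsilon> where \<epsilon>: "0 < \<epsilon>" "\<forall>i\<in>{1..r}. \<epsilon> * c i < f x - u i \<bullet> x"
    using finite_small_multiple[of "{1..r}" "\<lambda>i. f x - u i \<bullet> x" c] d by blast
  define t where "t = 1 / \<epsilon>"
  have "f (t *\<^sub>R x) \<in> (\<lambda>i. c i + u i \<bullet> (t *\<^sub>R x)) ` {1..r}"
    using assms(1) r Max_in[of "(\<lambda>i. c i + u i \<bullet> (t *\<^sub>R x)) ` {1..r}"]
    by (simp add: tropical_expression_def)
  then obtain i where i: "i \<in> {1..r}" "f (t *\<^sub>R x) = c i + u i \<bullet> (t *\<^sub>R x)" by blast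
  have "t * f x = c i + t * (u i \<bullet> x)" using i(2) hom[of t x] \<epsilon>(1) by (simp add: t_def)
  then have "f x = \<epsilon> * c i + u i \<bullet> x" using \<epsilon>(1) by (simp add: t_def field_simps)
  then show False using bspec[OF \<epsilon>(2) i(1)] by simp
qed

text \<open>For a positively homogeneous \<open>f\<close> this is the subdifferential at the origin.
  It does not refer to an expression of \<open>f\<close> as a maximum, which makes the Newton
  polytope independent of that expression.\<close>

definition subgradients :: "(real ^ 'n \<Rightarrow> real) \<Rightarrow> (real ^ 'n) set" where
  "subgradients f = {m. \<forall>x. m \<bullet> x \<le> f x}"

lemma tropical_expression_hull:
  assumes f: "tropical_expression f r c u" and hom: "\<And>t x. 0 \<le> t \<Longrightarrow> f (t *\<^sub>R x) = t * f x"
  shows "convex hull (u ` {1..r}) = subgradients f"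
proof
  have "convex (subgradients f)"
    unfolding subgradients_def convex_def
    by (auto simp: inner_add_left intro: convex_bound_le)
  moreover have "u ` {1..r} \<subseteq> subgradients f"
    using tropical_expression_slope_le[OF f hom] by (auto simp: subgradients_def)
  ultimately show "convex hull (u ` {1..r}) \<subseteq> subgradients f" by (rule hull_minimal[rotated])
  show "subgradients f \<subseteq> convex hull (u ` {1..r})"
  proof (rule ccontr)
    assume "\<not> subgradients f \<subseteq> convex hull (u ` {1..r})"
    then obtain m where m: "m \<in> subgradients f" "m \<notin> convex hull (u ` {1..r})" by blast
    have "closed (convex hull (u ` {1..r}))"
      by (intro compact_imp_closed finite_imp_compact_convex_hull) simp
    then obtain a b where ab: "a \<bullet> m < b" "\<And>z. z \<in> convex hull (u ` {1..r}) \<Longrightarrow> b < a \<bullet> z"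
      using separating_hyperplane_closed_point[OF convex_convex_hull _ m(2)] by blast
    \<comment> \<open>Evaluating at \<open>- a\<close> turns the separation around: some slope
      \<open>u i\<close> reaches \<open>f (- a)\<close> there, while \<open>m\<close> is strictly
      above \<open>u i\<close> and so would exceed \<open>f\<close>.\<close>
    obtain i where i: "i \<in> {1..r}" "f (- a) \<le> u i \<bullet> (- a)"
      using tropical_expression_attained[OF f hom] by blast
    have "b < a \<bullet> u i" using i(1) by (intro ab(2) hull_inc) blast
    moreover have "m \<bullet> (- a) \<le> f (- a)" using m(1) unfolding subgradients_def by blast
    ultimately show False using ab(1) i(2) by (simp add: inner_commute)
  qed
qed

lemma newton_polytope_eq_subgradients:
  assumes "tropical_polynomial f" and hom: "\<And>t x. 0 \<le> t \<Longrightarrow> f (t *\<^sub>R x) = t * f x"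
  shows "newton_polytope f = subgradients f"
proof -
  obtain r c u where e: "tropical_expression f r c u"
    using assms(1) unfolding tropical_polynomial_def by blast
  show ?thesis
    unfolding newton_polytope_def
  proof (rule the_equality)
    show "\<exists>r c u. tropical_expression f r c u \<and> subgradients f = convex hull (u ` {1..r})"
      using e tropical_expression_hull[OF e hom] by metis
    show "P = subgradients f"
      if P: "\<exists>r c u. tropical_expression f r c u \<and> P = convex hull (u ` {1..r})" for P
    proof -
      obtain r c u where "tropical_expression f r c u" "P = convex hull (u ` {1..r})"
        using P by (elim exE conjE)
      then show ?thesis using tropical_expression_hull[OF _ hom] by simp
    qed
  qed
qed

section \<open>Convex piecewise linear functions on complete fans of pointed cones\<close>

lemma interior_Union_closed_empty:
  fixes F :: "'a::topological_space set set"
  assumes "finite F" "\<And>S. S \<in> F \<Longrightarrow> closed S" "\<And>S. S \<in> F \<Longrightarrow> interior S = {}"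
  shows "interior (\<Union>F) = {}"
  using assms
proof (induction F rule: finite_induct)
  case (insert S F)
  then have "interior (S \<union> \<Union>F) = interior S"
    by (intro interior_closed_Un_empty_interior) auto
  then show ?case using insert.prems(2)[of S] by simp
qed simp

text \<open>A large multiple of an interior ball has room for rounding its centre to a lattice point
  and for a unit ball around that point.\<close>

lemma lattice_points_in_fat_cone:
  fixes S :: "(real ^ 'n) set"
  assumes "interior S \<noteq> {}" and scale: "\<And>t x. 0 \<le> t \<Longrightarrow> x \<in> S \<Longrightarrow> t *\<^sub>R x \<in> S"
  obtains p where "p \<in> lattice" "p \<in> S" "\<And>i. p + axis i 1 \<in> S"
proof -
  obtain x e where e: "0 < e" "ball x e \<subseteq> S"
    using assms(1) by (metis ex_in_conv mem_interior)
  \<comment> \<open>The rounding error is at most \<open>CARD('n)\<close>, and the unit vectors add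
    1.\<close>
  obtain N :: nat where N: "(real CARD('n) + 1) / e < real N" using reals_Archimedean2 by blast
  have "0 \<le> (real CARD('n) + 1) / e" using e(1) by simp
  then have N0: "0 < real N" using N by linarith
  have Ne: "real CARD('n) + 1 < real N * e" using N e(1) by (simp add: field_simps)
  define p :: "real ^ 'n" where "p = (\<chi> i. of_int \<lfloor>real N * x $ i\<rfloor>)"
  have dist_p: "norm (real N *\<^sub>R x - p) \<le> real CARD('n)"
  proof -
    have "\<bar>(real N *\<^sub>R x - p) $ i\<bar> \<le> 1" for i
      by (simp add: p_def) linarith
    then have "(\<Sum>i\<in>UNIV. \<bar>(real N *\<^sub>R x - p) $ i\<bar>) \<le> (\<Sum>i\<in>(UNIV::'n set). 1)" by (intro sum_mono)
    then show ?thesis using norm_le_l1_cart[of "real N *\<^sub>R x - p"] by simp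
  qed
  have inS: "p + v \<in> S" if v: "norm v \<le> 1" for v
  proof -
    have "norm (real N *\<^sub>R x - (p + v)) < real N * e"
      using dist_p v Ne norm_triangle_ineq4[of "real N *\<^sub>R x - p" v] by (simp add: algebra_simps)
    moreover have "real N *\<^sub>R x - (p + v) = real N *\<^sub>R (x - (1 / real N) *\<^sub>R (p + v))"
      using N0 by (simp add: scaleR_diff_right)
    ultimately have "norm (x - (1 / real N) *\<^sub>R (p + v)) < e" using N0 by simp
    then have "(1 / real N) *\<^sub>R (p + v) \<in> S" using e(2) by (auto simp: dist_norm)
    then have "real N *\<^sub>R ((1 / real N) *\<^sub>R (p + v)) \<in> S" by (rule scale[rotated]) simp
    moreover have "real N *\<^sub>R ((1 / real N) *\<^sub>R (p + v)) = p + v" using N0 by simp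
    ultimately show ?thesis by (simp only:)
  qed
  show ?thesis
  proof
    show "p \<in> lattice" by (simp add: p_def lattice_def)
    show "p \<in> S" using inS[of 0] by simp
    show "p + axis i 1 \<in> S" for i by (intro inS) simp
  qed
qed

text \<open>The interface between networks and toric geometry. Besides rational inequalities,
  \<open>polyhedral\<close> records that the fan contains the subcones on which chosen inequalities
  are tight, among them the rays.\<close>

locale pl_fan =
  fixes \<Sigma> :: "(real ^ 'n::{finite,linorder}) set set" and f :: "real ^ 'n::{finite,linorder} \<Rightarrow> real"
  assumes finite_fan: "finite \<Sigma>"
    and covers: "\<exists>S\<in>\<Sigma>. x \<in> S"
    and polyhedral: "S \<in> \<Sigma> \<Longrightarrow> \<exists>A. finite A \<and> (\<forall>a\<in>A. rational_vec a) \<and> S = dual_cone A \<and>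
      (\<forall>B\<subseteq>A. {x \<in> S. \<forall>b\<in>B. b \<bullet> x = 0} \<in> \<Sigma>)"
    and strongly_convex: "S \<in> \<Sigma> \<Longrightarrow> strongly_convex_cone S"
    and linear: "S \<in> \<Sigma> \<Longrightarrow> \<exists>c. \<forall>x\<in>S. f x = c \<bullet> x"
    and convex: "convex_on UNIV f"
    and integral: "u \<in> lattice \<Longrightarrow> f u \<in> \<int>"
begin

lemma cone_scale: "S \<in> \<Sigma> \<Longrightarrow> 0 \<le> t \<Longrightarrow> x \<in> S \<Longrightarrow> t *\<^sub>R x \<in> S"
  using polyhedral[of S] by (auto simp: dual_cone_def)

lemma cone_add: "S \<in> \<Sigma> \<Longrightarrow> x \<in> S \<Longrightarrow> y \<in> S \<Longrightarrow> x + y \<in> S"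
  using polyhedral[of S] by (auto simp: dual_cone_def inner_add_right)

lemma zero_in_cone: "S \<in> \<Sigma> \<Longrightarrow> 0 \<in> S"
  using polyhedral[of S] by (auto simp: dual_cone_def)

lemma pointed: "S \<in> \<Sigma> \<Longrightarrow> x \<in> S \<Longrightarrow> - x \<in> S \<Longrightarrow> x = 0"
  using strongly_convex[of S] unfolding strongly_convex_cone_def by (metis Int_iff imageI minus_minus singletonD)

lemma closed_cone: "S \<in> \<Sigma> \<Longrightarrow> closed S"
proof -
  assume "S \<in> \<Sigma>"
  then obtain A where "S = dual_cone A" using polyhedral by blast
  moreover have "dual_cone A = (\<Inter>a\<in>A. {x. 0 \<le> a \<bullet> x})" by (auto simp: dual_cone_def)
  ultimately show ?thesis by (auto intro!: closed_INT closed_halfspace_ge)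
qed

lemma homogeneous: "0 \<le> t \<Longrightarrow> f (t *\<^sub>R x) = t * f x"
proof -
  assume t: "0 \<le> t"
  obtain S where S: "S \<in> \<Sigma>" "x \<in> S" using covers by blast
  obtain c where c: "\<And>x. x \<in> S \<Longrightarrow> f x = c \<bullet> x" using linear[OF S(1)] by blast
  show ?thesis using c[OF S(2)] c[OF cone_scale[OF S(1) t S(2)]] by simp
qed

text \<open>Making all inequalities tight leaves a linear subspace, which is trivial in a pointed
  cone. Thus the torus is among the charts.\<close>

lemma zero_cone_in_fan: "{0} \<in> \<Sigma>"
proof -
  obtain S where S: "S \<in> \<Sigma>" using covers by blast
  obtain A where A: "S = dual_cone A" "\<And>B. B \<subseteq> A \<Longrightarrow> {x \<in> S. \<forall>b\<in>B. b \<bullet> x = 0} \<in> \<Sigma>"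
    using polyhedral[OF S] by blast
  have "x = 0" if "x \<in> S" "\<forall>b\<in>A. b \<bullet> x = 0" for x
    using that pointed[OF S, of x] by (simp add: A(1) dual_cone_def)
  then have "{x \<in> S. \<forall>b\<in>A. b \<bullet> x = 0} = {0}" using zero_in_cone[OF S] by auto
  then show ?thesis using A(2)[of A] by simp
qed

text \<open>The complement of the closed union of the full-dimensional cones is open and covered by
  finitely many closed cones with empty interior, whose union again has empty interior.\<close>

lemma fat_cones_cover: "\<exists>S\<in>\<Sigma>. interior S \<noteq> {} \<and> x \<in> S"
proof (rule ccontr)
  let ?F = "{S \<in> \<Sigma>. interior S \<noteq> {}}" and ?G = "{S \<in> \<Sigma>. interior S = {}}"
  assume "\<not> (\<exists>S\<in>\<Sigma>. interior S \<noteq> {} \<and> x \<in> S)"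
  then have x: "x \<in> - \<Union>?F" by blast
  have "closed (\<Union>?F)" using finite_fan closed_cone by (intro closed_Union) auto
  then have "open (- \<Union>?F)" by (rule open_Compl)
  moreover have "- \<Union>?F \<subseteq> \<Union>?G" using covers by blast
  ultimately have "- \<Union>?F \<subseteq> interior (\<Union>?G)" by (intro interior_maximal)
  moreover have "interior (\<Union>?G) = {}"
    using finite_fan closed_cone by (intro interior_Union_closed_empty) auto
  ultimately show False using x by blast
qed

text \<open>Neighbouring lattice points in the cone show that the slope is integral. By convexity a
  linear function that agrees with \<open>f\<close> near an interior point supports \<open>f\<close>
  everywhere.\<close>

lemma fat_cone_slope:
  assumes S: "S \<in> \<Sigma>" "interior S \<noteq> {}"
  shows "\<exists>c\<in>lattice. (\<forall>x\<in>S. f x = c \<bullet> x) \<and> (\<forall>x. c \<bullet> x \<le> f x)"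
proof -
  obtain c where c: "\<And>x. x \<in> S \<Longrightarrow> f x = c \<bullet> x" using linear[OF S(1)] by blast
  obtain p where p: "p \<in> lattice" "p \<in> S" "\<And>i. p + axis i 1 \<in> S"
    using lattice_points_in_fat_cone[OF S(2) cone_scale[OF S(1)]] by blast
  have "c $ i \<in> \<int>" for i
  proof -
    have "c $ i = f (p + axis i 1) - f p"
      using c[OF p(2)] c[OF p(3)] by (simp add: inner_add_right inner_axis)
    also have "p + axis i 1 \<in> lattice" using p(1) by (simp add: lattice_def axis_def)
    then have "f (p + axis i 1) - f p \<in> \<int>" using p(1) by (intro Ints_diff integral)
    finally show ?thesis .
  qed
  then have "c \<in> lattice" by (simp add: lattice_def)
  moreover have "c \<bullet> y \<le> f y" for y
  proof -
    obtain x e where e: "0 < e" "ball x e \<subseteq> S" using S(2) by (metis ex_in_conv mem_interior)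
    \<comment> \<open>At most 1/2 for a proper convex weight, and small enough to keep the point of
      the segment inside the ball; the summand 1 avoids division by 0.\<close>
    define t where "t = min (1/2) (e / (2 * (norm (y - x) + 1)))"
    have t: "0 < t" "t < 1" "t * norm (y - x) < e"
    proof -
      have n: "0 < norm (y - x) + 1" by (simp add: add_nonneg_pos)
      show "0 < t" "t < 1" using e(1) n by (auto simp: t_def)
      have "t * norm (y - x) \<le> e / (2 * (norm (y - x) + 1)) * norm (y - x)"
        by (intro mult_right_mono) (auto simp: t_def)
      also have "\<dots> \<le> e / (2 * (norm (y - x) + 1)) * (norm (y - x) + 1)"
        using e(1) n by (intro mult_left_mono) auto
      also have "\<dots> = e / 2" using n by (simp add: field_simps)
      finally show "t * norm (y - x) < e" using e(1) by linarith
    qed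
    let ?z = "(1 - t) *\<^sub>R x + t *\<^sub>R y"
    have "x - ?z = - (t *\<^sub>R (y - x))" by (simp add: algebra_simps)
    then have "dist x ?z < e" using t by (simp add: dist_norm)
    then have "?z \<in> S" using e(2) by auto
    have "x \<in> S" using e by auto
    have "f ?z \<le> (1 - t) * f x + t * f y"
      using convex t by (intro convex_onD[OF convex]) auto
    then have "t * (c \<bullet> y) \<le> t * f y"
      using c[OF \<open>?z \<in> S\<close>] c[OF \<open>x \<in> S\<close>] by (simp add: inner_add_right)
    then show ?thesis using t(1) by simp
  qed
  ultimately show ?thesis using c by blast
qed

lemma finite_slopes:
  obtains T where "finite T" "T \<subseteq> lattice" "\<And>m x. m \<in> T \<Longrightarrow> m \<bullet> x \<le> f x" "\<And>x. \<exists>m\<in>T. f x = m \<bullet> x"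
proof -
  obtain c where c: "\<And>S. S \<in> \<Sigma> \<Longrightarrow> interior S \<noteq> {} \<Longrightarrow>
      c S \<in> lattice \<and> (\<forall>x\<in>S. f x = c S \<bullet> x) \<and> (\<forall>x. c S \<bullet> x \<le> f x)"
    using fat_cone_slope by metis
  let ?T = "c ` {S \<in> \<Sigma>. interior S \<noteq> {}}"
  show ?thesis
  proof
    show "finite ?T" using finite_fan by simp
    show "?T \<subseteq> lattice" using c by blast
    show "m \<bullet> x \<le> f x" if "m \<in> ?T" for m x using c that by blast
    show "\<exists>m\<in>?T. f x = m \<bullet> x" for x using c fat_cones_cover[of x] by blast
  qed
qed

lemma tropical: "tropical_polynomial f"
proof -
  obtain T where T: "finite T" "T \<subseteq> lattice" "\<And>m x. m \<in> T \<Longrightarrow> m \<bullet> x \<le> f x" "\<And>x. \<exists>m\<in>T. f x = m \<bullet> x"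
    using finite_slopes by blast
  obtain h where h: "bij_betw h {1..card T} T" using ex_bij_betw_nat_finite_1[OF T(1)] by blast
  have img: "h ` {1..card T} = T" using h by (rule bij_betw_imp_surj_on)
  have "T \<noteq> {}" using T(4) by blast
  then have "1 \<le> card T" using T(1) by (simp add: Suc_le_eq card_gt_0_iff)
  moreover have "f x = Max ((\<lambda>i. 0 + h i \<bullet> x) ` {1..card T})" for x
  proof -
    have "(\<lambda>i. 0 + h i \<bullet> x) ` {1..card T} = (\<lambda>m. m \<bullet> x) ` T"
    proof -
      have "(\<lambda>i. 0 + h i \<bullet> x) ` {1..card T} = (\<lambda>m. m \<bullet> x) ` (h ` {1..card T})"
        by (simp add: image_image)
      then show ?thesis by (simp only: img)
    qed
    moreover have "Max ((\<lambda>m. m \<bullet> x) ` T) = f x"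
    proof (rule Max_eqI)
      show "finite ((\<lambda>m. m \<bullet> x) ` T)" using T(1) by simp
      show "y \<le> f x" if "y \<in> (\<lambda>m. m \<bullet> x) ` T" for y using that T(3) by blast
      show "f x \<in> (\<lambda>m. m \<bullet> x) ` T" using T(4)[of x] by auto
    qed
    ultimately show ?thesis by simp
  qed
  ultimately have "tropical_expression f (card T) (\<lambda>_. 0) h"
    unfolding tropical_expression_def using T(2) img by blast
  then show ?thesis unfolding tropical_polynomial_def by blast
qed

lemma newton_polytope: "newton_polytope f = subgradients f"
  by (rule newton_polytope_eq_subgradients[OF tropical homogeneous])

lemma compact_subgradients: "compact (subgradients f)" and convex_subgradients: "convex (subgradients f)"
proof -
  obtain r c u where e: "tropical_expression f r c u"
    using tropical unfolding tropical_polynomial_def by blast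
  have "compact (convex hull (u ` {1..r}))" by (rule finite_imp_compact_convex_hull) simp
  then show "compact (subgradients f)" "convex (subgradients f)"
    using tropical_expression_hull[OF e homogeneous] convex_convex_hull by metis+
qed

text \<open>
  If every supporting slope were strictly smaller than the function somewhere on the cone, then
  all of them would be at the sum of these points.
\<close>
lemma lattice_slope_on_cone:
  assumes S: "S \<in> \<Sigma>"
  shows "\<exists>m\<in>lattice. \<forall>x\<in>S. f x = m \<bullet> x"
proof (rule ccontr)
  assume no: "\<not> (\<exists>m\<in>lattice. \<forall>x\<in>S. f x = m \<bullet> x)"
  obtain T where T: "finite T" "T \<subseteq> lattice" "\<And>m x. m \<in> T \<Longrightarrow> m \<bullet> x \<le> f x" "\<And>x. \<exists>m\<in>T. f x = m \<bullet> x"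
    using finite_slopes by blast
  obtain c where c: "\<And>x. x \<in> S \<Longrightarrow> f x = c \<bullet> x" using linear[OF S] by blast
  have "\<exists>y. y \<in> S \<and> m \<bullet> y < c \<bullet> y" if "m \<in> T" for m
    using no T(2) T(3)[OF that] that c by (metis less_le subsetD)
  then obtain y where y: "\<And>m. m \<in> T \<Longrightarrow> y m \<in> S" "\<And>m. m \<in> T \<Longrightarrow> m \<bullet> y m < c \<bullet> y m" by metis
  define z where "z = sum y T"
  have "z \<in> S"
    unfolding z_def using T(1) y(1)
    by (induction T rule: finite_induct) (auto intro: zero_in_cone cone_add S)
  obtain m where m: "m \<in> T" "f z = m \<bullet> z" using T(4) by blast
  have "m \<bullet> z < c \<bullet> z"
    unfolding z_def inner_sum_right
  proof (rule sum_strict_mono_ex1[OF T(1)])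
    show "\<forall>k\<in>T. m \<bullet> y k \<le> c \<bullet> y k" using T(3)[OF m(1)] y(1) c by metis
    show "\<exists>k\<in>T. m \<bullet> y k < c \<bullet> y k" using m(1) y(2) by blast
  qed
  then show False using m(2) c[OF \<open>z \<in> S\<close>] by simp
qed

end

section \<open>The polytope and the sections of the ReLU divisor\<close>

context pl_fan
begin

lemma ray_data:
  assumes "\<rho> \<in> rays \<Sigma>"
  obtains u where "ray_gen \<rho> = u" "u \<noteq> 0" "u \<in> lattice" "\<rho> = (\<lambda>t. t *\<^sub>R u) ` {0..}"
    "\<rho> \<inter> lattice = range (\<lambda>j::nat. real j *\<^sub>R u)"
proof -
  have \<rho>: "\<rho> \<in> \<Sigma>" "dim \<rho> = 1" using assms by (auto simp: rays_def)
  obtain A where A: "finite A" "\<forall>a\<in>A. rational_vec a" "\<rho> = dual_cone A"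
    using polyhedral[OF \<rho>(1)] by blast
  obtain u where u: "u \<noteq> 0" "u \<in> lattice" "\<rho> = (\<lambda>t. t *\<^sub>R u) ` {0..}"
    "\<rho> \<inter> lattice = range (\<lambda>j::nat. real j *\<^sub>R u)"
    using ray_primitive_generator[OF A(3,1) _ \<rho>(2) pointed[OF \<rho>(1)]] A(2) by blast
  then show ?thesis using ray_gen_eq that by blast
qed

lemma ray_gen_in_ray: "\<rho> \<in> rays \<Sigma> \<Longrightarrow> ray_gen \<rho> \<in> \<rho>"
  by (elim ray_data) (auto intro: image_eqI[of _ _ 1])

lemma ray_gen_lattice: "\<rho> \<in> rays \<Sigma> \<Longrightarrow> ray_gen \<rho> \<in> lattice"
  by (elim ray_data) simp

lemma ray_chart_exists:
  assumes "\<rho> \<in> rays \<Sigma>"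
  obtains e where "ray_chart \<rho> (ray_gen \<rho>) e"
proof -
  obtain u where u: "ray_gen \<rho> = u" "u \<noteq> 0" "u \<in> lattice" "\<rho> = (\<lambda>t. t *\<^sub>R u) ` {0..}"
    "\<rho> \<inter> lattice = range (\<lambda>j::nat. real j *\<^sub>R u)"
    using ray_data[OF assms] by blast
  have primitive: "d = 1" if d: "0 < d" "(1 / of_int d) *\<^sub>R u \<in> lattice" for d :: int
  proof -
    have "(1 / of_int d) *\<^sub>R u \<in> \<rho>" unfolding u(4) using d(1) by (intro imageI) simp
    then have "(1 / of_int d) *\<^sub>R u \<in> range (\<lambda>j::nat. real j *\<^sub>R u)" using d(2) u(5) by blast
    then obtain j :: nat where "(1 / of_int d) *\<^sub>R u = real j *\<^sub>R u" by blast
    then have "1 / of_int d = real j" using u(2) by simp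
    then have "real_of_int (d * int j) = 1" using d(1) by (simp add: field_simps)
    then have "d * int j = 1" by linarith
    then show "d = 1" using d(1) by (simp add: zmult_eq_1_iff)
  qed
  obtain e where e: "char_vec e \<bullet> u = 1" using primitive_dual_character[OF u(2,3) primitive] by blast
  have "ray_chart \<rho> (ray_gen \<rho>) e"
    by unfold_locales (use u e in auto)
  then show ?thesis using that by blast
qed

lemma finite_rays: "finite (rays \<Sigma>)"
  using finite_fan by (simp add: rays_def)

text \<open>On one cone \<open>f\<close> is linear, so the inequality passes to sums and nonnegative
  multiples and spreads from the rays to the cone. The factor \<open>k\<close> serves both the
  polytope and the sections of multiples of the divisor.\<close>

lemma inner_le_iff_on_rays:
  "(\<forall>\<rho>\<in>rays \<Sigma>. m \<bullet> ray_gen \<rho> \<le> k * f (ray_gen \<rho>)) \<longleftrightarrow> (\<forall>x. m \<bullet> x \<le> k * f x)"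
proof
  assume rays: "\<forall>\<rho>\<in>rays \<Sigma>. m \<bullet> ray_gen \<rho> \<le> k * f (ray_gen \<rho>)"
  show "\<forall>x. m \<bullet> x \<le> k * f x"
  proof
    fix x
    obtain S where S: "S \<in> \<Sigma>" "x \<in> S" using covers by blast
    obtain c where c: "\<And>x. x \<in> S \<Longrightarrow> f x = c \<bullet> x" using linear[OF S(1)] by blast
    obtain A where A: "finite A" "S = dual_cone A" "\<And>B. B \<subseteq> A \<Longrightarrow> {x \<in> S. \<forall>b\<in>B. b \<bullet> x = 0} \<in> \<Sigma>"
      using polyhedral[OF S(1)] by blast
    have "m \<bullet> x \<le> k * (c \<bullet> x)"
    \<comment> \<open>The predicate uses the slope \<open>c\<close> because it must be additive for
      all vectors, and \<open>f\<close> is so only within the cone.\<close>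
    proof (rule pointed_cone_induct[OF A(1), where P = "\<lambda>x. m \<bullet> x \<le> k * (c \<bullet> x)"])
      show "x \<in> dual_cone A" using S(2) by (simp only: A(2))
      show "x = 0" if "x \<in> dual_cone A" "- x \<in> dual_cone A" for x
        using that unfolding A(2)[symmetric] by (rule pointed[OF S(1)])
      show "m \<bullet> (x + y) \<le> k * (c \<bullet> (x + y))"
        if "m \<bullet> x \<le> k * (c \<bullet> x)" "m \<bullet> y \<le> k * (c \<bullet> y)" for x y
        using that by (simp add: inner_add_right distrib_left)
      show "m \<bullet> (t *\<^sub>R x) \<le> k * (c \<bullet> (t *\<^sub>R x))" if "0 \<le> t" "m \<bullet> x \<le> k * (c \<bullet> x)" for t x
        using mult_left_mono[OF that(2,1)] by (simp add: mult.left_commute)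
      fix B x
      let ?F = "{y \<in> dual_cone A. \<forall>b\<in>B. b \<bullet> y = 0}"
      assume B: "B \<subseteq> A" "dim ?F = 1" "x \<in> dual_cone A" "\<forall>b\<in>B. b \<bullet> x = 0"
      then have F: "?F \<in> rays \<Sigma>" using A(3)[OF B(1)] by (simp add: rays_def A(2))
      obtain t where t: "0 \<le> t" "x = t *\<^sub>R ray_gen ?F"
      proof -
        have x: "x \<in> ?F" using B by blast
        obtain u where u: "ray_gen ?F = u" "u \<noteq> 0" "u \<in> lattice" "?F = (\<lambda>t. t *\<^sub>R u) ` {0..}"
          "?F \<inter> lattice = range (\<lambda>j::nat. real j *\<^sub>R u)"
          by (rule ray_data[OF F])
        obtain t where "t \<in> {0..}" "x = t *\<^sub>R u" using x unfolding u(4) by (elim imageE)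
        then show ?thesis using that[of t] by (simp add: u(1))
      qed
      have "ray_gen ?F \<in> S" using ray_gen_in_ray[OF F] by (simp add: A(2))
      then have "m \<bullet> ray_gen ?F \<le> k * (c \<bullet> ray_gen ?F)" using bspec[OF rays F] c by simp
      from mult_left_mono[OF this t(1)] show "m \<bullet> x \<le> k * (c \<bullet> x)"
        by (simp add: t(2) mult.left_commute)
    qed simp
    then show "m \<bullet> x \<le> k * f x" using c[OF S(2)] by simp
  qed
qed blast

lemma lookup_relu_divisor:
  assumes "\<rho> \<in> rays \<Sigma>"
  shows "real_of_int (Poly_Mapping.lookup (- relu_divisor \<Sigma> f) \<rho>) = f (ray_gen \<rho>)"
proof -
  have "Poly_Mapping.lookup (- relu_divisor \<Sigma> f) \<rho> = (\<Sum>\<rho>'\<in>rays \<Sigma>. \<lfloor>f (ray_gen \<rho>')\<rfloor> * (if \<rho>' = \<rho> then 1 else 0))"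
    unfolding relu_divisor_def minus_minus lookup_sum
    by (intro sum.cong refl) (auto simp: lookup_single when_def)
  also have "\<dots> = \<lfloor>f (ray_gen \<rho>)\<rfloor>"
    using assms finite_rays by (simp add: if_distrib[of "(*) _"] cong: if_cong)
  finally show ?thesis using integral[OF ray_gen_lattice[OF assms]] by simp
qed

text \<open>The coefficient of the negated divisor at a ray is the value of \<open>f\<close> at its
  generator, so the inequalities of the polytope are those of a subgradient for the negated
  vector.\<close>

lemma divisor_polytope: "divisor_polytope \<Sigma> (- relu_divisor \<Sigma> f) = uminus ` subgradients f"
proof -
  have "m \<in> divisor_polytope \<Sigma> (- relu_divisor \<Sigma> f) \<longleftrightarrow> - m \<in> subgradients f" for m
  proof -
    have "m \<in> divisor_polytope \<Sigma> (- relu_divisor \<Sigma> f) \<longleftrightarrow>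
        (\<forall>\<rho>\<in>rays \<Sigma>. (- m) \<bullet> ray_gen \<rho> \<le> 1 * f (ray_gen \<rho>))"
      unfolding divisor_polytope_def mem_Collect_eq
      by (intro ball_cong refl) (simp only: lookup_relu_divisor, auto)
    then show ?thesis unfolding inner_le_iff_on_rays by (simp add: subgradients_def)
  qed
  then have "divisor_polytope \<Sigma> (- relu_divisor \<Sigma> f) = {m. - m \<in> subgradients f}" by blast
  also have "\<dots> = uminus ` subgradients f"
  proof (intro subset_antisym subsetI)
    fix m assume "m \<in> {m. - m \<in> subgradients f}"
    then show "m \<in> uminus ` subgradients f" by (intro image_eqI[of _ _ "- m"]) simp_all
  qed auto
  finally show ?thesis .
qed

end

section \<open>Regular functions on the charts and on the torus\<close>

lemma of_laurent_in_local_ring: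
  assumes "primeideal P (cone_ring \<sigma>)" "a \<in> cone_algebra \<sigma>"
  shows "of_laurent a \<in> local_ring \<sigma> P"
proof -
  interpret primeideal P "cone_ring \<sigma>" by (rule assms(1))
  have "1 \<notin> P"
    using one_imp_carrier I_notcarr by (auto simp: cone_ring_def)
  then show ?thesis
    unfolding local_ring_def of_laurent_def using assms(2) cone_algebra_1 by blast
qed

lemma of_laurent_in_chart:
  assumes "x \<in> chart \<sigma>" "a \<in> cone_algebra \<sigma>"
  shows "of_laurent a \<in> x"
  using assms of_laurent_in_local_ring unfolding chart_def by blast

lemma chi_in_units_at_torus:
  assumes "x \<in> chart {0}"
  shows "chi m \<in> units_at x"
proof -
  have "chi e \<in> x" for e
    unfolding chi_def by (rule of_laurent_in_chart[OF assms]) simp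
  from this[of m] this[of "- m"] show ?thesis by (simp add: units_at_def chi_uminus)
qed

text \<open>The zero ideal is prime, which gives the generic point. Without a point, the condition
  on units over the torus would be vacuous and would admit \<open>g = 0\<close>.\<close>

lemma chart_torus_nonempty: "chart {0 :: real ^ 'n::{finite,linorder}} \<noteq> {}"
proof -
  have "primeideal {0} (cone_ring {0 :: real ^ 'n::{finite,linorder}})"
  proof (rule primeidealI)
    show "ideal {0} (cone_ring {0 :: real ^ 'n::{finite,linorder}})"
      by (rule ideal_cone_ringI) auto
    have "1 \<in> carrier (cone_ring {0 :: real ^ 'n::{finite,linorder}})" by (simp add: cone_ring_def)
    then show "carrier (cone_ring {0 :: real ^ 'n::{finite,linorder}}) \<noteq> {0}" by force
    show "cring (cone_ring {0 :: real ^ 'n::{finite,linorder}})" by (rule cring_cone_ring)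
  qed (auto simp: cone_ring_def)
  then show ?thesis unfolding chart_def by blast
qed

text \<open>A local equation need not be given as a character. Being a unit at every point of the
  torus, it and its inverse are both Laurent polynomials, which is enough to recover a section
  \<open>s\<close> from \<open>g * s\<close>.\<close>

lemma units_at_torus_laurent:
  fixes g :: "'n::{finite,linorder} ratfun"
  assumes "\<And>x. x \<in> chart {0} \<Longrightarrow> g \<in> units_at x"
  obtains b c where "g = of_laurent b" "b \<noteq> 0" "inverse g = of_laurent c"
proof -
  have units: "g \<in> x" "inverse g \<in> x" "g \<noteq> 0" if "x \<in> chart {0}" for x
    using assms[OF that] by (simp_all add: units_at_def)
  obtain b c where bc: "g = of_laurent b" "inverse g = of_laurent c"
    using Inter_chart_zero_cone[of g, OF units(1)] Inter_chart_zero_cone[of "inverse g", OF units(2)]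
    by blast
  moreover have "g \<noteq> 0" using chart_torus_nonempty units(3) by blast
  then have "b \<noteq> 0" using bc(1) by simp
  ultimately show ?thesis using that by blast
qed

section \<open>Spaces of Laurent polynomials with prescribed exponents\<close>

lemma of_laurent_sum:
  fixes h :: "'b \<Rightarrow> 'n::{finite,linorder} laurent"
  shows "of_laurent (sum h X) = (\<Sum>m\<in>X. of_laurent (h m))"
  by (induction X rule: infinite_finite_induct) simp_all

lemma cscale_chi:
  fixes m :: "'n::{finite,linorder} \<Rightarrow>\<^sub>0 int"
  shows "cscale c (chi m) = of_laurent (Poly_Mapping.single m c)"
  by (simp add: cscale_def chi_def of_laurent_def mult_single)

lemma of_laurent_eq_sum:
  fixes a :: "'n::{finite,linorder} laurent"
  shows "of_laurent a = (\<Sum>m\<in>Poly_Mapping.keys a. cscale (Poly_Mapping.lookup a m) (chi m))"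
proof -
  have "a = (\<Sum>m\<in>Poly_Mapping.keys a. Poly_Mapping.single m (Poly_Mapping.lookup a m))"
    by (rule poly_mapping_eqI)
      (auto simp: lookup_sum lookup_single when_def in_keys_iff sum.delta' cong: if_cong)
  then show ?thesis by (metis (no_types, lifting) cscale_chi of_laurent_sum sum.cong)
qed

lemma inj_chi: "inj (chi :: ('n::{finite,linorder} \<Rightarrow>\<^sub>0 int) \<Rightarrow> _)"
proof (rule injI)
  fix p q :: "'n \<Rightarrow>\<^sub>0 int" assume "chi p = chi q"
  then have "Poly_Mapping.keys (Poly_Mapping.single p (1::complex)) = Poly_Mapping.keys (Poly_Mapping.single q (1::complex))"
    by (simp add: chi_def)
  then show "p = q" by simp
qed

lemma dim_span_chi:
  fixes P :: "('n::{finite,linorder} \<Rightarrow>\<^sub>0 int) set"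
  assumes "finite P"
  shows "vector_space.dim cscale {of_laurent a | a. Poly_Mapping.keys a \<subseteq> P} = card P"
proof -
  interpret V: vector_space "cscale :: complex \<Rightarrow> 'n ratfun \<Rightarrow> _" by (rule vector_space_cscale)
  have indep: "\<not> V.dependent (chi ` P)"
  proof (rule V.independent_if_scalars_zero)
    show "finite (chi ` P)" using assms by simp
    fix c x assume sum: "(\<Sum>x\<in>chi ` P. cscale (c x) x) = 0" and x: "x \<in> chi ` P"
    have "of_laurent (\<Sum>m\<in>P. Poly_Mapping.single m (c (chi m))) = 0"
      using sum by (simp add: sum.reindex inj_on_subset[OF inj_chi] cscale_chi of_laurent_sum)
    then have zero: "(\<Sum>m\<in>P. Poly_Mapping.single m (c (chi m))) = 0" by simp
    obtain m where m: "m \<in> P" "x = chi m" using x by blast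
    have "c (chi m) = Poly_Mapping.lookup (\<Sum>m\<in>P. Poly_Mapping.single m (c (chi m))) m"
      using m(1) assms by (simp add: lookup_sum lookup_single when_def sum.delta' cong: if_cong)
    then show "c x = 0" by (simp add: zero m(2))
  qed
  have span: "{of_laurent a | a. Poly_Mapping.keys a \<subseteq> P} = V.span (chi ` P)"
  proof (intro subset_antisym subsetI)
    fix s assume "s \<in> {of_laurent a | a. Poly_Mapping.keys a \<subseteq> P}"
    then obtain a where a: "s = of_laurent a" "Poly_Mapping.keys a \<subseteq> P" by blast
    show "s \<in> V.span (chi ` P)"
      unfolding a(1) of_laurent_eq_sum[of a] using a(2)
      by (intro V.span_sum V.span_scale V.span_base) blast
  next
    fix s assume "s \<in> V.span (chi ` P)"
    then show "s \<in> {of_laurent a | a. Poly_Mapping.keys a \<subseteq> P}"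
    proof (induction rule: V.span_induct_alt)
      case base
      then show ?case by (auto intro: exI[of _ 0])
    next
      case (step c x y)
      then obtain m a where m: "m \<in> P" "x = chi m" and a: "y = of_laurent a" "Poly_Mapping.keys a \<subseteq> P"
        by blast
      have "cscale c x + y = of_laurent (Poly_Mapping.single m c + a)"
        by (simp add: m(2) a(1) cscale_chi)
      moreover have "Poly_Mapping.keys (Poly_Mapping.single m c + a) \<subseteq> P"
        using keys_add[of "Poly_Mapping.single m c" a] m(1) a(2) by (auto split: if_splits)
      ultimately show ?case by blast
    qed
  qed
  show ?thesis
    unfolding span V.dim_span_eq_card_independent[OF indep]
    by (rule card_image) (rule inj_on_subset[OF inj_chi subset_UNIV])
qed

lemma lattice_char_vec: "char_vec m \<in> lattice"
  by (simp add: char_vec_def lattice_def)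

lemma char_vec_surj:
  fixes p :: "real ^ 'n::{finite,linorder}"
  assumes "p \<in> lattice"
  obtains e where "char_vec e = p"
proof
  have floor: "of_int \<lfloor>p $ i\<rfloor> = p $ i" for i using assms by (simp add: lattice_def)
  show "char_vec (Abs_poly_mapping (\<lambda>i. \<lfloor>p $ i\<rfloor>)) = p"
    unfolding Finite_Cartesian_Product.vec_eq_iff char_vec_def
    by (simp only: vec_lambda_beta lookup_Abs_poly_mapping[OF finite] floor simp_thms)
qed

lemma inj_char_vec: "inj char_vec"
  by (rule injI) (simp add: char_vec_def Finite_Cartesian_Product.vec_eq_iff poly_mapping_eqI)

section \<open>Global sections of the multiples of the divisor, and the volume\<close>

context pl_fan
begin

text \<open>The lattice points of the polytope of the \<open>k\<close>-th multiple. The condition is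
  imposed on the whole space, so that it is directly available on every cone; it is equivalent to
  the one on the rays.\<close>

definition section_exponents :: "nat \<Rightarrow> ('n \<Rightarrow>\<^sub>0 int) set" where
  "section_exponents k = {p. \<forall>x. - char_vec p \<bullet> x \<le> real k * f x}"

lemma of_int_lookup_multiple:
  assumes "\<rho> \<in> rays \<Sigma>"
  shows "real_of_int (Poly_Mapping.lookup (frag_cmul (int k) (- relu_divisor \<Sigma> f)) \<rho>) = real k * f (ray_gen \<rho>)"
  unfolding lookup_frag_cmul of_int_mult lookup_relu_divisor[OF assms] by simp

lemma section_exponents_rays:
  "p \<in> section_exponents k \<longleftrightarrow> (\<forall>\<rho>\<in>rays \<Sigma>. - char_vec p \<bullet> ray_gen \<rho> \<le> real k * f (ray_gen \<rho>))"
  unfolding section_exponents_def inner_le_iff_on_rays by simp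

text \<open>A lattice slope of \<open>f\<close> on the cone, multiplied by \<open>k\<close>, is the
  exponent: the weight of this character at a ray generator is \<open>k\<close> times the value of
  \<open>f\<close>, the prescribed order.\<close>

lemma local_equation_exists:
  assumes \<sigma>: "\<sigma> \<in> \<Sigma>"
  obtains e where "local_equation \<Sigma> (frag_cmul (int k) (- relu_divisor \<Sigma> f)) \<sigma> (chi e)"
    "\<And>x. x \<in> \<sigma> \<Longrightarrow> char_vec e \<bullet> x = real k * f x"
proof -
  obtain p where p: "p \<in> lattice" "\<And>x. x \<in> \<sigma> \<Longrightarrow> f x = p \<bullet> x"
    using lattice_slope_on_cone[OF \<sigma>] by blast
  obtain e0 where e0: "char_vec e0 = p" using char_vec_surj[OF p(1)] by blast
  let ?e = "frag_cmul (int k) e0"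
  have e: "char_vec ?e \<bullet> x = real k * f x" if "x \<in> \<sigma>" for x
    using p(2)[OF that] by (simp add: char_vec_frag_cmul e0)
  have "vanishing_order (prime_divisor \<rho>) (chi ?e) =
      Poly_Mapping.lookup (frag_cmul (int k) (- relu_divisor \<Sigma> f)) \<rho>"
    if \<rho>: "\<rho> \<in> rays \<Sigma>" "\<rho> face_of \<sigma>" for \<rho>
  proof -
    obtain d where d: "ray_chart \<rho> (ray_gen \<rho>) d" using ray_chart_exists[OF \<rho>(1)] by blast
    interpret ray_chart \<rho> "ray_gen \<rho>" d by (rule d)
    have "ray_gen \<rho> \<in> \<sigma>"
      using ray_gen_in_ray[OF \<rho>(1)] face_of_imp_subset[OF \<rho>(2)] by blast
    then have "real_of_int (wt ?e) = real k * f (ray_gen \<rho>)"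
      unfolding of_int_wt by (rule e)
    also have "\<dots> = real_of_int (Poly_Mapping.lookup (frag_cmul (int k) (- relu_divisor \<Sigma> f)) \<rho>)"
      using of_int_lookup_multiple[OF \<rho>(1)] by simp
    finally have wt: "wt ?e = Poly_Mapping.lookup (frag_cmul (int k) (- relu_divisor \<Sigma> f)) \<rho>"
      by (simp only: of_int_eq_iff)
    have "Poly_Mapping.single ?e (1::complex) \<noteq> 0"
      by (metis lookup_single_eq lookup_zero zero_neq_one)
    then have "vanishing_order (prime_divisor \<rho>) (chi ?e) = vord (Poly_Mapping.single ?e (1::complex))"
      unfolding chi_def by (rule vanishing_order_of_laurent)
    then show ?thesis using wt vord_single[of "1::complex" ?e] by simp
  qed
  then have "local_equation \<Sigma> (frag_cmul (int k) (- relu_divisor \<Sigma> f)) \<sigma> (chi ?e)"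
    unfolding local_equation_def using chi_in_units_at_torus by blast
  then show ?thesis using e that by blast
qed

text \<open>The torus chart makes a section Laurent, and the charts of the rays bound its exponents.
  The local equations there are arbitrary, so only their orders are compared. Conversely every cone
  has a character as local equation, which moves the admissible exponents into the dual
  cone.\<close>

lemma line_bundle_sections_eq:
  "line_bundle_sections \<Sigma> (frag_cmul (int k) (- relu_divisor \<Sigma> f)) (toric_variety \<Sigma>) =
     {of_laurent a | a. Poly_Mapping.keys a \<subseteq> section_exponents k}"
proof (intro subset_antisym subsetI)
  let ?E = "frag_cmul (int k) (- relu_divisor \<Sigma> f)"
  fix s assume s: "s \<in> line_bundle_sections \<Sigma> ?E (toric_variety \<Sigma>)"
  have chart_sub: "chart \<sigma> \<inter> toric_variety \<Sigma> = chart \<sigma>" if "\<sigma> \<in> \<Sigma>" for \<sigma>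
    using that by (auto simp: toric_variety_def)
  have eqn: "\<exists>g. local_equation \<Sigma> ?E \<sigma> g \<and> (\<forall>x\<in>chart \<sigma>. g * s \<in> x)" if "\<sigma> \<in> \<Sigma>" for \<sigma>
  proof -
    have "\<exists>g. local_equation \<Sigma> ?E \<sigma> g \<and> (\<forall>x\<in>chart \<sigma> \<inter> toric_variety \<Sigma>. g * s \<in> x)"
      using s that unfolding line_bundle_sections_def by blast
    then show ?thesis by (simp only: chart_sub[OF that])
  qed
  obtain a where a: "s = of_laurent a"
  proof -
    obtain g where g: "local_equation \<Sigma> ?E {0} g" "\<And>x. x \<in> chart {0} \<Longrightarrow> g * s \<in> x"
      using eqn[OF zero_cone_in_fan] by blast
    have units: "\<And>x. x \<in> chart {0} \<Longrightarrow> g \<in> units_at x"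
      using g(1) unfolding local_equation_def by blast
    obtain b c where bc: "g = of_laurent b" "b \<noteq> 0" "inverse g = of_laurent c"
      by (rule units_at_torus_laurent[OF units])
    obtain d where d: "g * s = of_laurent d" using Inter_chart_zero_cone[of "g * s", OF g(2)] by blast
    have "g \<noteq> 0" using bc(1,2) by simp
    then have "s = inverse g * (g * s)" by (simp add: mult.assoc[symmetric])
    also have "\<dots> = of_laurent (c * d)" by (simp add: bc(3) d)
    finally show ?thesis using that by blast
  qed
  have "p \<in> section_exponents k" if p: "p \<in> Poly_Mapping.keys a" for p
    unfolding section_exponents_rays
  proof
    fix \<rho> assume \<rho>: "\<rho> \<in> rays \<Sigma>"
    then have \<rho>\<Sigma>: "\<rho> \<in> \<Sigma>" by (simp add: rays_def)
    obtain d where d: "ray_chart \<rho> (ray_gen \<rho>) d" using ray_chart_exists[OF \<rho>] by blast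
    interpret ray_chart \<rho> "ray_gen \<rho>" d by (rule d)
    obtain g where g: "local_equation \<Sigma> ?E \<rho> g" "\<And>x. x \<in> chart \<rho> \<Longrightarrow> g * s \<in> x"
      using eqn[OF \<rho>\<Sigma>] by blast
    have units: "\<And>x. x \<in> chart {0} \<Longrightarrow> g \<in> units_at x"
      using g(1) unfolding local_equation_def by blast
    obtain b c where b: "g = of_laurent b" "b \<noteq> 0" "inverse g = of_laurent c"
      by (rule units_at_torus_laurent[OF units])
    \<comment> \<open>A convex set is a face of itself, so a local equation on the chart of
      \<open>\<rho>\<close> has the prescribed order along this very divisor.\<close>
    have "convex \<rho>"
    proof -
      obtain A where "\<rho> = dual_cone A" using polyhedral[OF \<rho>\<Sigma>] by blast
      then have "\<rho> = (\<Inter>a\<in>A. {x. 0 \<le> a \<bullet> x})" by (auto simp: dual_cone_def)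
      then show ?thesis by (auto intro!: convex_INT convex_halfspace_ge)
    qed
    then have "\<rho> face_of \<rho>" by (rule face_of_refl)
    then have "vord b = Poly_Mapping.lookup ?E \<rho>"
      using g(1) \<rho> vanishing_order_of_laurent[OF b(2)] unfolding local_equation_def b(1) by simp
    then have "real_of_int (vord b) = real k * f (ray_gen \<rho>)"
      using of_int_lookup_multiple[OF \<rho>] by simp
    moreover have "a \<noteq> 0" using p by auto
    then have "0 \<le> vord b + vord a"
      using g(2)[OF R_in_chart] b by (intro vord_sum_nonneg) (simp_all add: a)
    \<comment> \<open>The order of \<open>a\<close> is a minimum over its exponents, so the bound
      holds for each of them.\<close>
    then have "0 \<le> vord b + wt p" using vord_le[OF p] by linarith
    then have "0 \<le> real_of_int (vord b) + real_of_int (wt p)" by linarith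
    ultimately show "- char_vec p \<bullet> ray_gen \<rho> \<le> real k * f (ray_gen \<rho>)"
      unfolding of_int_wt by simp
  qed
  then show "s \<in> {of_laurent a | a. Poly_Mapping.keys a \<subseteq> section_exponents k}" using a by blast
next
  let ?E = "frag_cmul (int k) (- relu_divisor \<Sigma> f)"
  fix s assume "s \<in> {of_laurent a | a. Poly_Mapping.keys a \<subseteq> section_exponents k}"
  then obtain a where a: "s = of_laurent a" "Poly_Mapping.keys a \<subseteq> section_exponents k" by blast
  show "s \<in> line_bundle_sections \<Sigma> ?E (toric_variety \<Sigma>)"
    unfolding line_bundle_sections_def
  proof (intro CollectI ballI)
    fix \<sigma> assume \<sigma>: "\<sigma> \<in> \<Sigma>"
    obtain e where e: "local_equation \<Sigma> ?E \<sigma> (chi e)" "\<And>x. x \<in> \<sigma> \<Longrightarrow> char_vec e \<bullet> x = real k * f x"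
      using local_equation_exists[OF \<sigma>] by blast
    have "a * Poly_Mapping.single e 1 \<in> cone_algebra \<sigma>"
      unfolding cone_algebra_def mem_Collect_eq keys_mult_single
    proof (intro ballI)
      fix m u assume "m \<in> (\<lambda>m. m + e) ` Poly_Mapping.keys a" and u: "u \<in> \<sigma>"
      then obtain p where p: "p \<in> Poly_Mapping.keys a" "m = p + e" by blast
      have "- char_vec p \<bullet> u \<le> real k * f u"
        using a(2) p(1) unfolding section_exponents_def by blast
      then show "0 \<le> char_vec m \<bullet> u"
        using e(2)[OF u] by (simp add: p(2) char_vec_add inner_add_left)
    qed
    then have "of_laurent (a * Poly_Mapping.single e 1) \<in> x" if "x \<in> chart \<sigma>" for x
      by (rule of_laurent_in_chart[OF that])
    then have "chi e * s \<in> x" if "x \<in> chart \<sigma>" for x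
      using that by (simp add: a(1) chi_def mult.commute)
    then show "\<exists>g. local_equation \<Sigma> ?E \<sigma> g \<and> (\<forall>x\<in>chart \<sigma> \<inter> toric_variety \<Sigma>. g * s \<in> x)"
      using e(1) by blast
  qed
qed

lemma bij_section_exponents:
  assumes "0 < k"
  shows "bij_betw (\<lambda>p. - char_vec p) (section_exponents k)
    {x \<in> lattice. (1 / real k) *\<^sub>R x \<in> subgradients f}"
  unfolding bij_betw_def
proof
  show "inj_on (\<lambda>p. - char_vec p) (section_exponents k)"
    using inj_char_vec by (auto intro!: inj_onI dest: injD)
  have scaled: "((1 / real k) *\<^sub>R x \<in> subgradients f) \<longleftrightarrow> (\<forall>y. x \<bullet> y \<le> real k * f y)" for x
    using assms by (simp add: subgradients_def field_simps)
  show "(\<lambda>p. - char_vec p) ` section_exponents k = {x \<in> lattice. (1 / real k) *\<^sub>R x \<in> subgradients f}"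
  proof (intro subset_antisym subsetI)
    fix x assume "x \<in> (\<lambda>p. - char_vec p) ` section_exponents k"
    then obtain p where p: "p \<in> section_exponents k" "x = - char_vec p" by blast
    have "- char_vec p \<in> lattice"
      using lattice_scale[OF lattice_char_vec[of p], of "-1"] by simp
    then show "x \<in> {x \<in> lattice. (1 / real k) *\<^sub>R x \<in> subgradients f}"
      using p unfolding scaled section_exponents_def by blast
  next
    fix x assume x: "x \<in> {x \<in> lattice. (1 / real k) *\<^sub>R x \<in> subgradients f}"
    then have "- x \<in> lattice" using lattice_scale[of x "-1"] by simp
    then obtain p where p: "char_vec p = - x" using char_vec_surj by blast
    have "p \<in> section_exponents k" using x unfolding scaled section_exponents_def by (simp add: p)
    moreover have "x = - char_vec p" by (simp add: p)
    ultimately show "x \<in> (\<lambda>p. - char_vec p) ` section_exponents k" by blast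
  qed
qed

lemma finite_scaled_lattice_points:
  assumes "0 < k"
  shows "finite {x \<in> lattice. (1 / real k) *\<^sub>R x \<in> subgradients f}"
proof -
  have "bounded ((\<lambda>x. real k *\<^sub>R x) ` subgradients f)"
    using compact_subgradients by (intro bounded_scaling compact_imp_bounded)
  then have "finite ((\<lambda>x. real k *\<^sub>R x) ` subgradients f \<inter> lattice)" by (rule finite_lattice_bounded)
  moreover have "x \<in> (\<lambda>x. real k *\<^sub>R x) ` subgradients f"
    if "(1 / real k) *\<^sub>R x \<in> subgradients f" for x
    using assms that by (intro image_eqI[of _ _ "(1 / real k) *\<^sub>R x"]) simp_all
  then have "{x \<in> lattice. (1 / real k) *\<^sub>R x \<in> subgradients f} \<subseteq>
      (\<lambda>x. real k *\<^sub>R x) ` subgradients f \<inter> lattice" by blast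
  ultimately show ?thesis by (rule finite_subset[rotated])
qed

lemma h0_eq:
  assumes "0 < k"
  shows "h0 \<Sigma> (frag_cmul (int k) (- relu_divisor \<Sigma> f)) =
    card {x \<in> lattice. (1 / real k) *\<^sub>R x \<in> subgradients f}"
proof -
  have "finite (section_exponents k)"
    using bij_betw_finite[OF bij_section_exponents[OF assms]] finite_scaled_lattice_points[OF assms] by simp
  then show ?thesis
    unfolding h0_def line_bundle_sections_eq
    by (simp only: dim_span_chi bij_betw_same_card[OF bij_section_exponents[OF assms]])
qed

lemma divisor_volume_eq:
  "divisor_volume \<Sigma> (- relu_divisor \<Sigma> f) = ereal (lattice_volume (subgradients f))"
  unfolding divisor_volume_def
proof (rule lim_imp_Limsup)
  let ?N = "\<lambda>m. real (card {x \<in> lattice. (1 / real m) *\<^sub>R x \<in> subgradients f})"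
  have "(\<lambda>m. fact CARD('n) * (?N m / real m ^ CARD('n))) \<longlonglongrightarrow>
      fact CARD('n) * measure lebesgue (subgradients f)"
    by (intro tendsto_mult_left lattice_points_scaled_tendsto compact_subgradients convex_subgradients)
  then have "(\<lambda>m. ereal (fact CARD('n) * (?N m / real m ^ CARD('n)))) \<longlonglongrightarrow> ereal (lattice_volume (subgradients f))"
    by (simp add: lattice_volume_def)
  \<comment> \<open>\<open>h0_eq\<close> concerns positive multiples, so the two sequences are
    compared only eventually.\<close>
  moreover have "\<forall>\<^sub>F m in sequentially. ereal (fact CARD('n) * (?N m / real m ^ CARD('n))) =
      ereal (real (h0 \<Sigma> (frag_cmul (int m) (- relu_divisor \<Sigma> f))) / (real m ^ CARD('n) / fact CARD('n)))"
    using eventually_gt_at_top[of 0] by eventually_elim (simp add: h0_eq)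
  ultimately show "(\<lambda>m. ereal (real (h0 \<Sigma> (frag_cmul (int m) (- relu_divisor \<Sigma> f))) /
      (real m ^ CARD('n) / fact CARD('n)))) \<longlonglongrightarrow> ereal (lattice_volume (subgradients f))"
    by (rule Lim_transform_eventually)
qed simp

end

theorem theorem2:
  fixes f :: "real ^ 'n::{finite,linorder} \<Rightarrow> real"
    and k :: nat
    and Ls :: "real mat list"
  defines "\<Sigma> \<equiv> (relu_fan k Ls :: (real ^ 'n::{finite,linorder}) set set)"
  defines "D \<equiv> relu_divisor \<Sigma> f"
  assumes "f \<in> ReLU_Z k"
    and "unbiased_network CARD('n) k Ls"
    and "\<forall>L\<in>set Ls. elements_mat L \<subseteq> \<rat>"
    and "network_fun k Ls = f"
    and "\<forall>\<sigma>\<in>\<Sigma>. strongly_convex_cone \<sigma>"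
    and "tropical_polynomial f \<or> convex_on UNIV f"
  shows "divisor_polytope \<Sigma> (- D) = uminus ` newton_polytope f \<and>
    ereal (lattice_volume (newton_polytope f)) = divisor_volume \<Sigma> (- D)"
proof -
  have "pl_fan \<Sigma> f"
  proof
    show "finite \<Sigma>" unfolding \<Sigma>_def by (rule finite_relu_fan)
    show "\<exists>S\<in>\<Sigma>. x \<in> S" for x
      unfolding \<Sigma>_def using assms(4) by (rule relu_fan_covers) simp
    show "\<exists>A. finite A \<and> (\<forall>a\<in>A. rational_vec a) \<and> S = dual_cone A \<and>
        (\<forall>B\<subseteq>A. {x \<in> S. \<forall>b\<in>B. b \<bullet> x = 0} \<in> \<Sigma>)" if "S \<in> \<Sigma>" for S
      using relu_fan_linear_on_cone[OF assms(4,5) order_refl that[unfolded \<Sigma>_def]]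
      unfolding linear_on_cone_def \<Sigma>_def by blast
    show "\<exists>c. \<forall>x\<in>S. f x = c \<bullet> x" if "S \<in> \<Sigma>" for S
      using relu_fan_linear_on_cone[OF assms(4,5) order_refl that[unfolded \<Sigma>_def]]
        network_fun_linear_on_cone[OF assms(4), of S] assms(6) by blast
    \<comment> \<open>A tropical polynomial is convex, so both alternatives of the hypothesis reduce
      to this one.\<close>
    show "convex_on UNIV f" using assms(8) tropical_polynomial_convex by blast
    \<comment> \<open>Integrality is taken from \<open>f \<in> ReLU_Z k\<close>; the weights in
      \<open>Ls\<close> are merely rational.\<close>
    show "f u \<in> \<int>" if "u \<in> lattice" for u using assms(3) that by (rule ReLU_Z_lattice)
  qed (use assms(7) in blast)
  then interpret pl_fan \<Sigma> f .
  show ?thesis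
    unfolding D_def newton_polytope using divisor_polytope divisor_volume_eq by simp
qed

end
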